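(* Let $S$ be a countable right LCM semigroup with identity. Then $C^*(S)$ is isomorphic to the Nica–Toeplitz algebra $\mathcal{NT}(M)$ of the product system $M$ of right-Hilbert $\mathbb C$-bimodules over $S$ with $M_p=\mathbb C$ for all $p\in S$.
   Context: A semigroup $S$ with identity $1$ is right LCM if it is left cancellative and, for all $p,q\in S$, $pS\cap qS$ is either empty or equal to $rS$ for some $r\in S$. For such $S$ the constructible right ideals are $\mathcal J(S)=\{\emptyset\}\cup\{pS\mid p\in S\}$, and the full semigroup $C^*$-algebra $C^*(S)$ is the universal $C^*$-algebra generated by isometries $(v_p)_{p\in S}$ and projections $(e_X)_{X\in\mathcal J(S)}$ with $v_pv_q=v_{pq}$, $v_pe_Xv_p^*=e_{pX}$, $e_\emptyset=0$, $e_S=1$, $e_Xe_Y=e_{X\cap Y}$. The product system $M=\bigsqcup_{p\in S}M_p$ has every fibre $M_p$ equal to $\mathbb C$ as a Hilbert space, viewed as a right-Hilbert $\mathbb C$-bimodule, and the product $M_p\times M_q\to M_{pq}$ is multiplication of complex numbers. For a product system of right-Hilbert $A$-bimodules, $\Theta_{\xi,\eta}(\mu)=\xi\cdot\langle\eta,\mu\rangle_p$ for $\xi,\eta,\mu\in M_p$, $\mathcal K(M_p)=\overline{\mathrm{span}}\{\Theta_{\xi,\eta}\}$, and $\iota_p^{pq}:\mathcal L(M_p)\to\mathcal L(M_{pq})$ is characterised by $\iota_p^{pq}(T)(\xi\eta)=(T\xi)\eta$. $M$ is compactly aligned if $\iota_p^r(T_p)\iota_q^r(T_q)\in\mathcal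 K(M_r)$ whenever $pS\cap qS=rS$, $T_p\in\mathcal K(M_p)$, $T_q\in\mathcal K(M_q)$ (which holds for the $M$ above). A representation $\psi$ of $M$ in a $C^*$-algebra $B$ is a map $M\to B$ such that, with $\psi_p=\psi|_{M_p}$: each $\psi_p$ is linear and $\psi_1:A\to B$ is a homomorphism; $\psi_p(\xi)\psi_q(\eta)=\psi_{pq}(\xi\eta)$; $\psi_p(\xi)^*\psi_p(\eta)=\psi_1(\langle\xi,\eta\rangle_p)$. Let $\psi^{(p)}:\mathcal K(M_p)\to B$ be the homomorphism with $\psi^{(p)}(\Theta_{\xi,\eta})=\psi_p(\xi)\psi_p(\eta)^*$. $\psi$ is Nica covariant if $\psi^{(p)}(T_p)\psi^{(q)}(T_q)=\psi^{(r)}(\iota_p^r(T_p)\iota_q^r(T_q))$ whenever $pS\cap qS=rS$, and $\psi^{(p)}(T_p)\psi^{(q)}(T_q)=0$ if $pS\cap qS=\emptyset$, for all $T_p\in\mathcal K(M_p)$, $T_q\in\mathcal K(M_q)$. For compactly aligned $M$, $\mathcal{NT}(M)$ is the universal $C^*$-algebra generated by a Nica covariant representation of $M$. *)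

theory Defs
  imports "HOL-Analysis.Analysis" "HOL-Algebra.Module" "HOL-Algebra.Coset"
begin

section \<open>Carrier-based C*-algebras\<close>

definition complex_field :: "complex ring" where
  "complex_field = \<lparr>carrier = UNIV, monoid.mult = (*), one = 1, ring.zero = 0, add = (+)\<rparr>"

text \<open>A complex vector space is a record \<open>E\<close> with \<open>Module.module complex_field E\<close>.\<close>

text \<open>The metric is set to 0 off the carrier because \<open>Metric_space\<close> requires nonnegativity and symmetry
  on the whole type.\<close>

definition norm_dist :: "('a, 'b) ring_scheme \<Rightarrow> ('a \<Rightarrow> real) \<Rightarrow> 'a \<Rightarrow> 'a \<Rightarrow> real" where
  "norm_dist E N x y = (if x \<in> carrier E \<and> y \<in> carrier E then N (x \<ominus>\<^bsub>E\<^esub> y) else 0)"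

abbreviation norm_complete :: "('a, 'b) ring_scheme \<Rightarrow> ('a \<Rightarrow> real) \<Rightarrow> bool" where
  "norm_complete E N \<equiv> Metric_space.mcomplete (carrier E) (norm_dist E N)"

abbreviation norm_topology :: "('a, 'b) ring_scheme \<Rightarrow> ('a \<Rightarrow> real) \<Rightarrow> 'a topology" where
  "norm_topology E N \<equiv> Metric_space.mtopology (carrier E) (norm_dist E N)"

definition complex_span :: "(complex, 'a, 'b) module_scheme \<Rightarrow> 'a set \<Rightarrow> 'a set" where
  "complex_span E X = \<Inter>{H. submodule H complex_field E \<and> X \<subseteq> H}"

definition closed_span :: "(complex, 'a, 'b) module_scheme \<Rightarrow> ('a \<Rightarrow> real) \<Rightarrow> 'a set \<Rightarrow> 'a set" where
  "closed_span E N X = norm_topology E N closure_of complex_span E X"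

record 'a cstar = "(complex, 'a) Module.module" +
  adj :: "'a \<Rightarrow> 'a"
  nrm :: "'a \<Rightarrow> real"

text \<open>C*-algebras need not be unital; the field \<open>one\<close> inherited from the library records is
  unconstrained unless \<open>unital_cstar_algebra\<close> is required.\<close>

locale cstar_algebra = Module.module complex_field A for A :: "'a cstar" (structure) +
  assumes mult_closed: "\<lbrakk>x \<in> carrier A; y \<in> carrier A\<rbrakk> \<Longrightarrow> x \<otimes> y \<in> carrier A"
    and mult_assoc: "\<lbrakk>x \<in> carrier A; y \<in> carrier A; z \<in> carrier A\<rbrakk>
          \<Longrightarrow> (x \<otimes> y) \<otimes> z = x \<otimes> (y \<otimes> z)"
    and mult_add_left: "\<lbrakk>x \<in> carrier A; y \<in> carrier A; z \<in> carrier A\<rbrakk>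
          \<Longrightarrow> (x \<oplus> y) \<otimes> z = x \<otimes> z \<oplus> y \<otimes> z"
    and mult_add_right: "\<lbrakk>x \<in> carrier A; y \<in> carrier A; z \<in> carrier A\<rbrakk>
          \<Longrightarrow> z \<otimes> (x \<oplus> y) = z \<otimes> x \<oplus> z \<otimes> y"
    and mult_smult_left: "\<lbrakk>x \<in> carrier A; y \<in> carrier A\<rbrakk> \<Longrightarrow> (c \<odot> x) \<otimes> y = c \<odot> (x \<otimes> y)"
    and mult_smult_right: "\<lbrakk>x \<in> carrier A; y \<in> carrier A\<rbrakk> \<Longrightarrow> x \<otimes> (c \<odot> y) = c \<odot> (x \<otimes> y)"
    and adj_closed: "x \<in> carrier A \<Longrightarrow> adj A x \<in> carrier A"
    and adj_adj: "x \<in> carrier A \<Longrightarrow> adj A (adj A x) = x"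
    and adj_add: "\<lbrakk>x \<in> carrier A; y \<in> carrier A\<rbrakk> \<Longrightarrow> adj A (x \<oplus> y) = adj A x \<oplus> adj A y"
    and adj_smult: "x \<in> carrier A \<Longrightarrow> adj A (c \<odot> x) = cnj c \<odot> adj A x"
    and adj_mult: "\<lbrakk>x \<in> carrier A; y \<in> carrier A\<rbrakk> \<Longrightarrow> adj A (x \<otimes> y) = adj A y \<otimes> adj A x"
    and nrm_nonneg: "x \<in> carrier A \<Longrightarrow> 0 \<le> nrm A x"
    and nrm_eq_0: "x \<in> carrier A \<Longrightarrow> nrm A x = 0 \<longleftrightarrow> x = \<zero>"
    and nrm_triangle: "\<lbrakk>x \<in> carrier A; y \<in> carrier A\<rbrakk> \<Longrightarrow> nrm A (x \<oplus> y) \<le> nrm A x + nrm A y"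
    and nrm_smult: "x \<in> carrier A \<Longrightarrow> nrm A (c \<odot> x) = cmod c * nrm A x"
    and nrm_mult: "\<lbrakk>x \<in> carrier A; y \<in> carrier A\<rbrakk> \<Longrightarrow> nrm A (x \<otimes> y) \<le> nrm A x * nrm A y"
    and cstar_identity: "x \<in> carrier A \<Longrightarrow> nrm A (adj A x \<otimes> x) = (nrm A x)\<^sup>2"
    and nrm_complete: "norm_complete A (nrm A)"

locale unital_cstar_algebra = cstar_algebra A + Group.monoid A for A :: "'a cstar" (structure)

definition star_hom :: "'a cstar \<Rightarrow> 'b cstar \<Rightarrow> ('a \<Rightarrow> 'b) set" where
  "star_hom A B = {\<phi> \<in> carrier A \<rightarrow> carrier B.
     (\<forall>x\<in>carrier A. \<forall>y\<in>carrier A. \<phi> (x \<oplus>\<^bsub>A\<^esub> y) = \<phi> x \<oplus>\<^bsub>B\<^esub> \<phi> y) \<and>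
     (\<forall>c. \<forall>x\<in>carrier A. \<phi> (c \<odot>\<^bsub>A\<^esub> x) = c \<odot>\<^bsub>B\<^esub> \<phi> x) \<and>
     (\<forall>x\<in>carrier A. \<forall>y\<in>carrier A. \<phi> (x \<otimes>\<^bsub>A\<^esub> y) = \<phi> x \<otimes>\<^bsub>B\<^esub> \<phi> y) \<and>
     (\<forall>x\<in>carrier A. \<phi> (adj A x) = adj B (\<phi> x))}"

definition cstar_isomorphic :: "'a cstar \<Rightarrow> 'b cstar \<Rightarrow> bool" where
  "cstar_isomorphic A B \<longleftrightarrow> (\<exists>\<phi> \<in> star_hom A B. bij_betw \<phi> (carrier A) (carrier B))"

definition cstar_subalgebra :: "'a cstar \<Rightarrow> 'a set \<Rightarrow> bool" where
  "cstar_subalgebra A D \<longleftrightarrow> submodule D complex_field A \<and>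
     (\<forall>x\<in>D. \<forall>y\<in>D. x \<otimes>\<^bsub>A\<^esub> y \<in> D) \<and> (\<forall>x\<in>D. adj A x \<in> D) \<and>
     closedin (norm_topology A (nrm A)) D"

definition cstar_generated_by :: "'a cstar \<Rightarrow> 'a set \<Rightarrow> bool" where
  "cstar_generated_by A X \<longleftrightarrow> X \<subseteq> carrier A \<and>
     (\<forall>D. cstar_subalgebra A D \<and> X \<subseteq> D \<longrightarrow> D = carrier A)"

definition projection :: "'a cstar \<Rightarrow> 'a \<Rightarrow> bool" where
  "projection A x \<longleftrightarrow> x \<in> carrier A \<and> adj A x = x \<and> x \<otimes>\<^bsub>A\<^esub> x = x"

definition isometry :: "'a cstar \<Rightarrow> 'a \<Rightarrow> bool" where
  "isometry A x \<longleftrightarrow> x \<in> carrier A \<and> adj A x \<otimes>\<^bsub>A\<^esub> x = \<one>\<^bsub>A\<^esub>"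

definition complex_cstar :: "complex cstar" where
  "complex_cstar = \<lparr>carrier = UNIV, monoid.mult = (*), one = 1, ring.zero = 0, add = (+),
     smult = (*), adj = cnj, nrm = cmod\<rparr>"

section \<open>Right LCM semigroups and their C*-algebras\<close>

locale right_LCM_semigroup = Group.monoid S for S (structure) +
  assumes left_cancel: "\<lbrakk>p \<in> carrier S; q \<in> carrier S; q' \<in> carrier S; p \<otimes> q = p \<otimes> q'\<rbrakk> \<Longrightarrow> q = q'"
    and right_LCM: "\<lbrakk>p \<in> carrier S; q \<in> carrier S\<rbrakk> \<Longrightarrow>
          (p <# carrier S) \<inter> (q <# carrier S) = {} \<or>
          (\<exists>r\<in>carrier S. (p <# carrier S) \<inter> (q <# carrier S) = r <# carrier S)"

definition constructible_ideals :: "('s, 't) monoid_scheme \<Rightarrow> 's set set" where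
  "constructible_ideals S = insert {} {p <#\<^bsub>S\<^esub> carrier S | p. p \<in> carrier S}"

definition semigroup_cstar_rep ::
    "('s, 't) monoid_scheme \<Rightarrow> 'a cstar \<Rightarrow> ('s \<Rightarrow> 'a) \<Rightarrow> ('s set \<Rightarrow> 'a) \<Rightarrow> bool" where
  "semigroup_cstar_rep S B v e \<longleftrightarrow> unital_cstar_algebra B \<and>
     (\<forall>p\<in>carrier S. isometry B (v p)) \<and>
     (\<forall>X\<in>constructible_ideals S. projection B (e X)) \<and>
     (\<forall>p\<in>carrier S. \<forall>q\<in>carrier S. v p \<otimes>\<^bsub>B\<^esub> v q = v (p \<otimes>\<^bsub>S\<^esub> q)) \<and>
     (\<forall>p\<in>carrier S. \<forall>X\<in>constructible_ideals S.
        v p \<otimes>\<^bsub>B\<^esub> e X \<otimes>\<^bsub>B\<^esub> adj B (v p) = e (p <#\<^bsub>S\<^esub> X)) \<and>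
     e {} = \<zero>\<^bsub>B\<^esub> \<and> e (carrier S) = \<one>\<^bsub>B\<^esub> \<and>
     (\<forall>X\<in>constructible_ideals S. \<forall>Y\<in>constructible_ideals S. e X \<otimes>\<^bsub>B\<^esub> e Y = e (X \<inter> Y))"

text \<open>\<open>(A, v, e)\<close> is the universal C*-algebra \<open>C*(S)\<close> with its generators. HOL cannot quantify over
  types inside a formula, so universality is tested against all C*-algebras whose underlying set
  lies in the type of \<open>A\<close>; that type plays the role of a universe. Since a C*-algebra generated by
  a countable family has at most continuum many elements, any type with at least continuum many
  elements gives the usual notion. Uniqueness of the induced homomorphism follows from generation.\<close>

definition full_semigroup_cstar ::
    "('s, 't) monoid_scheme \<Rightarrow> 'a cstar \<Rightarrow> ('s \<Rightarrow> 'a) \<Rightarrow> ('s set \<Rightarrow> 'a) \<Rightarrow> bool" where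
  "full_semigroup_cstar S A v e \<longleftrightarrow> semigroup_cstar_rep S A v e \<and>
     cstar_generated_by A (v ` carrier S \<union> e ` constructible_ideals S) \<and>
     (\<forall>(B :: 'a cstar) w f. semigroup_cstar_rep S B w f \<longrightarrow>
        (\<exists>\<phi> \<in> star_hom A B. (\<forall>p\<in>carrier S. \<phi> (v p) = w p) \<and>
           (\<forall>X\<in>constructible_ideals S. \<phi> (e X) = f X)))"

section \<open>Right-Hilbert bimodules\<close>

record ('a, 'm) hilb_bimod = "(complex, 'm) Module.module" +
  ract :: "'m \<Rightarrow> 'a \<Rightarrow> 'm"
  lact :: "'a \<Rightarrow> 'm \<Rightarrow> 'm"
  ip :: "'m \<Rightarrow> 'm \<Rightarrow> 'a"

definition ip_norm :: "'a cstar \<Rightarrow> ('a, 'm) hilb_bimod \<Rightarrow> 'm \<Rightarrow> real" where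
  "ip_norm A E \<xi> = sqrt (nrm A (ip E \<xi> \<xi>))"

locale hilbert_bimodule = A: cstar_algebra A + E: Module.module complex_field E
  for A :: "'a cstar" and E :: "('a, 'm) hilb_bimod" +
  assumes ract_closed: "\<lbrakk>\<xi> \<in> carrier E; a \<in> carrier A\<rbrakk> \<Longrightarrow> ract E \<xi> a \<in> carrier E"
    and ract_add_left: "\<lbrakk>\<xi> \<in> carrier E; \<eta> \<in> carrier E; a \<in> carrier A\<rbrakk>
          \<Longrightarrow> ract E (\<xi> \<oplus>\<^bsub>E\<^esub> \<eta>) a = ract E \<xi> a \<oplus>\<^bsub>E\<^esub> ract E \<eta> a"
    and ract_add_right: "\<lbrakk>\<xi> \<in> carrier E; a \<in> carrier A; b \<in> carrier A\<rbrakk>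
          \<Longrightarrow> ract E \<xi> (a \<oplus>\<^bsub>A\<^esub> b) = ract E \<xi> a \<oplus>\<^bsub>E\<^esub> ract E \<xi> b"
    and ract_mult: "\<lbrakk>\<xi> \<in> carrier E; a \<in> carrier A; b \<in> carrier A\<rbrakk>
          \<Longrightarrow> ract E \<xi> (a \<otimes>\<^bsub>A\<^esub> b) = ract E (ract E \<xi> a) b"
    and ract_smult_left: "\<lbrakk>\<xi> \<in> carrier E; a \<in> carrier A\<rbrakk>
          \<Longrightarrow> ract E (c \<odot>\<^bsub>E\<^esub> \<xi>) a = c \<odot>\<^bsub>E\<^esub> ract E \<xi> a"
    and ract_smult_right: "\<lbrakk>\<xi> \<in> carrier E; a \<in> carrier A\<rbrakk>
          \<Longrightarrow> ract E \<xi> (c \<odot>\<^bsub>A\<^esub> a) = c \<odot>\<^bsub>E\<^esub> ract E \<xi> a"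
    and ip_closed: "\<lbrakk>\<xi> \<in> carrier E; \<eta> \<in> carrier E\<rbrakk> \<Longrightarrow> ip E \<xi> \<eta> \<in> carrier A"
    and ip_add_right: "\<lbrakk>\<xi> \<in> carrier E; \<eta> \<in> carrier E; \<zeta> \<in> carrier E\<rbrakk>
          \<Longrightarrow> ip E \<xi> (\<eta> \<oplus>\<^bsub>E\<^esub> \<zeta>) = ip E \<xi> \<eta> \<oplus>\<^bsub>A\<^esub> ip E \<xi> \<zeta>"
    and ip_smult_right: "\<lbrakk>\<xi> \<in> carrier E; \<eta> \<in> carrier E\<rbrakk>
          \<Longrightarrow> ip E \<xi> (c \<odot>\<^bsub>E\<^esub> \<eta>) = c \<odot>\<^bsub>A\<^esub> ip E \<xi> \<eta>"
    and ip_ract: "\<lbrakk>\<xi> \<in> carrier E; \<eta> \<in> carrier E; a \<in> carrier A\<rbrakk>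
          \<Longrightarrow> ip E \<xi> (ract E \<eta> a) = ip E \<xi> \<eta> \<otimes>\<^bsub>A\<^esub> a"
    and ip_adj: "\<lbrakk>\<xi> \<in> carrier E; \<eta> \<in> carrier E\<rbrakk> \<Longrightarrow> adj A (ip E \<xi> \<eta>) = ip E \<eta> \<xi>"
    and ip_pos: "\<xi> \<in> carrier E \<Longrightarrow> \<exists>b\<in>carrier A. ip E \<xi> \<xi> = adj A b \<otimes>\<^bsub>A\<^esub> b"
    and ip_definite: "\<lbrakk>\<xi> \<in> carrier E; ip E \<xi> \<xi> = \<zero>\<^bsub>A\<^esub>\<rbrakk> \<Longrightarrow> \<xi> = \<zero>\<^bsub>E\<^esub>"
    and ip_complete: "norm_complete E (ip_norm A E)"
    and lact_closed: "\<lbrakk>a \<in> carrier A; \<xi> \<in> carrier E\<rbrakk> \<Longrightarrow> lact E a \<xi> \<in> carrier E"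
    and lact_add: "\<lbrakk>a \<in> carrier A; b \<in> carrier A; \<xi> \<in> carrier E\<rbrakk>
          \<Longrightarrow> lact E (a \<oplus>\<^bsub>A\<^esub> b) \<xi> = lact E a \<xi> \<oplus>\<^bsub>E\<^esub> lact E b \<xi>"
    and lact_smult: "\<lbrakk>a \<in> carrier A; \<xi> \<in> carrier E\<rbrakk>
          \<Longrightarrow> lact E (c \<odot>\<^bsub>A\<^esub> a) \<xi> = c \<odot>\<^bsub>E\<^esub> lact E a \<xi>"
    and lact_mult: "\<lbrakk>a \<in> carrier A; b \<in> carrier A; \<xi> \<in> carrier E\<rbrakk>
          \<Longrightarrow> lact E (a \<otimes>\<^bsub>A\<^esub> b) \<xi> = lact E a (lact E b \<xi>)"
    and lact_adj: "\<lbrakk>a \<in> carrier A; \<xi> \<in> carrier E; \<eta> \<in> carrier E\<rbrakk>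
          \<Longrightarrow> ip E (lact E a \<xi>) \<eta> = ip E \<xi> (lact E (adj A a) \<eta>)"

definition adjoint_pair :: "('a, 'm) hilb_bimod \<Rightarrow> ('m \<Rightarrow> 'm) \<Rightarrow> ('m \<Rightarrow> 'm) \<Rightarrow> bool" where
  "adjoint_pair E T T' \<longleftrightarrow>
     T \<in> carrier E \<rightarrow>\<^sub>E carrier E \<and> T' \<in> carrier E \<rightarrow>\<^sub>E carrier E \<and>
     (\<forall>\<xi>\<in>carrier E. \<forall>\<eta>\<in>carrier E. ip E (T \<xi>) \<eta> = ip E \<xi> (T' \<eta>))"

text \<open>The C*-algebra \<open>\<L>(E)\<close> with the operator norm.  Operators are extensional functions, so that
  equality of operators is equality on the carrier.\<close>

definition adjointables :: "'a cstar \<Rightarrow> ('a, 'm) hilb_bimod \<Rightarrow> ('m \<Rightarrow> 'm) cstar" where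
  "adjointables A E =
     \<lparr>carrier = {T. \<exists>T'. adjoint_pair E T T'},
      monoid.mult = compose (carrier E),
      one = (\<lambda>\<xi>\<in>carrier E. \<xi>),
      ring.zero = (\<lambda>\<xi>\<in>carrier E. \<zero>\<^bsub>E\<^esub>),
      add = (\<lambda>T R. \<lambda>\<xi>\<in>carrier E. T \<xi> \<oplus>\<^bsub>E\<^esub> R \<xi>),
      smult = (\<lambda>c T. \<lambda>\<xi>\<in>carrier E. c \<odot>\<^bsub>E\<^esub> T \<xi>),
      adj = (\<lambda>T. THE T'. adjoint_pair E T T'),
      nrm = (\<lambda>T. SUP \<xi>\<in>{\<xi> \<in> carrier E. ip_norm A E \<xi> \<le> 1}. ip_norm A E (T \<xi>))\<rparr>"

definition rank_one :: "('a, 'm) hilb_bimod \<Rightarrow> 'm \<Rightarrow> 'm \<Rightarrow> 'm \<Rightarrow> 'm" where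
  "rank_one E \<xi> \<eta> = (\<lambda>\<mu>\<in>carrier E. ract E \<xi> (ip E \<eta> \<mu>))"

definition compacts :: "'a cstar \<Rightarrow> ('a, 'm) hilb_bimod \<Rightarrow> ('m \<Rightarrow> 'm) cstar" where
  "compacts A E = (adjointables A E)
     \<lparr>carrier := closed_span (adjointables A E) (nrm (adjointables A E))
        {rank_one E \<xi> \<eta> | \<xi> \<eta>. \<xi> \<in> carrier E \<and> \<eta> \<in> carrier E}\<rparr>"

definition standard_bimodule :: "'a cstar \<Rightarrow> ('a, 'a) hilb_bimod" where
  "standard_bimodule A =
     \<lparr>carrier = carrier A, monoid.mult = monoid.mult A, one = one A, ring.zero = ring.zero A,
      add = add A, smult = smult A, ract = monoid.mult A, lact = monoid.mult A,
      ip = (\<lambda>a b. adj A a \<otimes>\<^bsub>A\<^esub> b)\<rparr>"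

section \<open>Product systems and Nica-Toeplitz algebras\<close>

text \<open>The fibres share one type with the coefficient algebra because the fibre over the identity
  is the coefficient algebra itself.  \<open>pmult M p q\<close> is the product from \<open>M\<^sub>p \<times> M\<^sub>q\<close> to \<open>M\<^sub>p\<^sub>q\<close>.\<close>

record ('s, 'a) prod_system =
  coeff :: "'a cstar"
  fibre :: "'s \<Rightarrow> ('a, 'a) hilb_bimod"
  pmult :: "'s \<Rightarrow> 's \<Rightarrow> 'a \<Rightarrow> 'a \<Rightarrow> 'a"

text \<open>The last two axioms say that the product induces an isomorphism of \<open>M\<^sub>p \<otimes>\<^sub>A M\<^sub>q\<close> onto \<open>M\<^sub>p\<^sub>q\<close>;
  at \<open>p = 1\<close> this includes nondegeneracy of the left actions.\<close>

locale product_system = S: Group.monoid S for S :: "('s, 't) monoid_scheme" +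
  fixes M :: "('s, 'a) prod_system"
  assumes coeff_cstar: "cstar_algebra (coeff M)"
    and fibre_bimodule: "p \<in> carrier S \<Longrightarrow> hilbert_bimodule (coeff M) (fibre M p)"
    and fibre_one: "fibre M \<one>\<^bsub>S\<^esub> = standard_bimodule (coeff M)"
    and pmult_closed: "\<lbrakk>p \<in> carrier S; q \<in> carrier S; \<xi> \<in> carrier (fibre M p);
          \<eta> \<in> carrier (fibre M q)\<rbrakk> \<Longrightarrow> pmult M p q \<xi> \<eta> \<in> carrier (fibre M (p \<otimes>\<^bsub>S\<^esub> q))"
    and pmult_assoc: "\<lbrakk>p \<in> carrier S; q \<in> carrier S; r \<in> carrier S; \<xi> \<in> carrier (fibre M p);
          \<eta> \<in> carrier (fibre M q); \<zeta> \<in> carrier (fibre M r)\<rbrakk> \<Longrightarrow>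
          pmult M (p \<otimes>\<^bsub>S\<^esub> q) r (pmult M p q \<xi> \<eta>) \<zeta> = pmult M p (q \<otimes>\<^bsub>S\<^esub> r) \<xi> (pmult M q r \<eta> \<zeta>)"
    and pmult_lact: "\<lbrakk>p \<in> carrier S; a \<in> carrier (coeff M); \<xi> \<in> carrier (fibre M p)\<rbrakk> \<Longrightarrow>
          pmult M \<one>\<^bsub>S\<^esub> p a \<xi> = lact (fibre M p) a \<xi>"
    and pmult_ract: "\<lbrakk>p \<in> carrier S; a \<in> carrier (coeff M); \<xi> \<in> carrier (fibre M p)\<rbrakk> \<Longrightarrow>
          pmult M p \<one>\<^bsub>S\<^esub> \<xi> a = ract (fibre M p) \<xi> a"
    and pmult_add_left: "\<lbrakk>p \<in> carrier S; q \<in> carrier S; \<xi> \<in> carrier (fibre M p);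
          \<xi>' \<in> carrier (fibre M p); \<eta> \<in> carrier (fibre M q)\<rbrakk> \<Longrightarrow>
          pmult M p q (\<xi> \<oplus>\<^bsub>fibre M p\<^esub> \<xi>') \<eta> =
          pmult M p q \<xi> \<eta> \<oplus>\<^bsub>fibre M (p \<otimes>\<^bsub>S\<^esub> q)\<^esub> pmult M p q \<xi>' \<eta>"
    and pmult_add_right: "\<lbrakk>p \<in> carrier S; q \<in> carrier S; \<xi> \<in> carrier (fibre M p);
          \<eta> \<in> carrier (fibre M q); \<eta>' \<in> carrier (fibre M q)\<rbrakk> \<Longrightarrow>
          pmult M p q \<xi> (\<eta> \<oplus>\<^bsub>fibre M q\<^esub> \<eta>') =
          pmult M p q \<xi> \<eta> \<oplus>\<^bsub>fibre M (p \<otimes>\<^bsub>S\<^esub> q)\<^esub> pmult M p q \<xi> \<eta>'"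
    and pmult_smult_left: "\<lbrakk>p \<in> carrier S; q \<in> carrier S; \<xi> \<in> carrier (fibre M p);
          \<eta> \<in> carrier (fibre M q)\<rbrakk> \<Longrightarrow>
          pmult M p q (c \<odot>\<^bsub>fibre M p\<^esub> \<xi>) \<eta> = c \<odot>\<^bsub>fibre M (p \<otimes>\<^bsub>S\<^esub> q)\<^esub> pmult M p q \<xi> \<eta>"
    and pmult_smult_right: "\<lbrakk>p \<in> carrier S; q \<in> carrier S; \<xi> \<in> carrier (fibre M p);
          \<eta> \<in> carrier (fibre M q)\<rbrakk> \<Longrightarrow>
          pmult M p q \<xi> (c \<odot>\<^bsub>fibre M q\<^esub> \<eta>) = c \<odot>\<^bsub>fibre M (p \<otimes>\<^bsub>S\<^esub> q)\<^esub> pmult M p q \<xi> \<eta>"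
    and pmult_ip: "\<lbrakk>p \<in> carrier S; q \<in> carrier S; \<xi> \<in> carrier (fibre M p);
          \<xi>' \<in> carrier (fibre M p); \<eta> \<in> carrier (fibre M q); \<eta>' \<in> carrier (fibre M q)\<rbrakk> \<Longrightarrow>
          ip (fibre M (p \<otimes>\<^bsub>S\<^esub> q)) (pmult M p q \<xi> \<eta>) (pmult M p q \<xi>' \<eta>') =
          ip (fibre M q) \<eta> (lact (fibre M q) (ip (fibre M p) \<xi> \<xi>') \<eta>')"
    and pmult_dense: "\<lbrakk>p \<in> carrier S; q \<in> carrier S\<rbrakk> \<Longrightarrow>
          closed_span (fibre M (p \<otimes>\<^bsub>S\<^esub> q)) (ip_norm (coeff M) (fibre M (p \<otimes>\<^bsub>S\<^esub> q)))
            {pmult M p q \<xi> \<eta> | \<xi> \<eta>. \<xi> \<in> carrier (fibre M p) \<and> \<eta> \<in> carrier (fibre M q)} =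
          carrier (fibre M (p \<otimes>\<^bsub>S\<^esub> q))"

abbreviation fibre_compacts :: "('s, 'a) prod_system \<Rightarrow> 's \<Rightarrow> ('a \<Rightarrow> 'a) cstar" where
  "fibre_compacts M p \<equiv> compacts (coeff M) (fibre M p)"

text \<open>The homomorphism from \<open>\<L>(M\<^sub>p)\<close> to \<open>\<L>(M\<^sub>r)\<close> for \<open>r = pq\<close>; by left cancellation \<open>q\<close> is determined
  by \<open>p\<close> and \<open>r\<close>.\<close>

definition iota ::
    "('s, 't) monoid_scheme \<Rightarrow> ('s, 'a) prod_system \<Rightarrow> 's \<Rightarrow> 's \<Rightarrow> ('a \<Rightarrow> 'a) \<Rightarrow> 'a \<Rightarrow> 'a" where
  "iota S M p r T = (THE R. R \<in> carrier (adjointables (coeff M) (fibre M r)) \<and>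
     (\<forall>q\<in>carrier S. p \<otimes>\<^bsub>S\<^esub> q = r \<longrightarrow>
        (\<forall>\<xi>\<in>carrier (fibre M p). \<forall>\<eta>\<in>carrier (fibre M q).
           R (pmult M p q \<xi> \<eta>) = pmult M p q (T \<xi>) \<eta>)))"

definition compactly_aligned :: "('s, 't) monoid_scheme \<Rightarrow> ('s, 'a) prod_system \<Rightarrow> bool" where
  "compactly_aligned S M \<longleftrightarrow>
     (\<forall>p\<in>carrier S. \<forall>q\<in>carrier S. \<forall>r\<in>carrier S.
        (p <#\<^bsub>S\<^esub> carrier S) \<inter> (q <#\<^bsub>S\<^esub> carrier S) = r <#\<^bsub>S\<^esub> carrier S \<longrightarrow>
        (\<forall>T\<in>carrier (fibre_compacts M p). \<forall>R\<in>carrier (fibre_compacts M q).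
           compose (carrier (fibre M r)) (iota S M p r T) (iota S M q r R)
             \<in> carrier (fibre_compacts M r)))"

text \<open>A map from the disjoint union of the fibres is given by its restrictions \<open>\<psi> p\<close> to them.\<close>

definition prod_system_rep ::
    "('s, 't) monoid_scheme \<Rightarrow> ('s, 'a) prod_system \<Rightarrow> 'b cstar \<Rightarrow> ('s \<Rightarrow> 'a \<Rightarrow> 'b) \<Rightarrow> bool" where
  "prod_system_rep S M B \<psi> \<longleftrightarrow> cstar_algebra B \<and>
     (\<forall>p\<in>carrier S. \<psi> p \<in> carrier (fibre M p) \<rightarrow> carrier B \<and>
        (\<forall>\<xi>\<in>carrier (fibre M p). \<forall>\<eta>\<in>carrier (fibre M p).
           \<psi> p (\<xi> \<oplus>\<^bsub>fibre M p\<^esub> \<eta>) = \<psi> p \<xi> \<oplus>\<^bsub>B\<^esub> \<psi> p \<eta>) \<and>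
        (\<forall>c. \<forall>\<xi>\<in>carrier (fibre M p). \<psi> p (c \<odot>\<^bsub>fibre M p\<^esub> \<xi>) = c \<odot>\<^bsub>B\<^esub> \<psi> p \<xi>)) \<and>
     \<psi> \<one>\<^bsub>S\<^esub> \<in> star_hom (coeff M) B \<and>
     (\<forall>p\<in>carrier S. \<forall>q\<in>carrier S. \<forall>\<xi>\<in>carrier (fibre M p). \<forall>\<eta>\<in>carrier (fibre M q).
        \<psi> p \<xi> \<otimes>\<^bsub>B\<^esub> \<psi> q \<eta> = \<psi> (p \<otimes>\<^bsub>S\<^esub> q) (pmult M p q \<xi> \<eta>)) \<and>
     (\<forall>p\<in>carrier S. \<forall>\<xi>\<in>carrier (fibre M p). \<forall>\<eta>\<in>carrier (fibre M p).
        adj B (\<psi> p \<xi>) \<otimes>\<^bsub>B\<^esub> \<psi> p \<eta> = \<psi> \<one>\<^bsub>S\<^esub> (ip (fibre M p) \<xi> \<eta>))"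

definition compact_ext ::
    "('s, 'a) prod_system \<Rightarrow> 'b cstar \<Rightarrow> ('s \<Rightarrow> 'a \<Rightarrow> 'b) \<Rightarrow> 's \<Rightarrow> ('a \<Rightarrow> 'a) \<Rightarrow> 'b" where
  "compact_ext M B \<psi> p = (THE \<Phi>.
     \<Phi> \<in> star_hom (fibre_compacts M p) B \<and> \<Phi> \<in> extensional (carrier (fibre_compacts M p)) \<and>
     (\<forall>\<xi>\<in>carrier (fibre M p). \<forall>\<eta>\<in>carrier (fibre M p).
        \<Phi> (rank_one (fibre M p) \<xi> \<eta>) = \<psi> p \<xi> \<otimes>\<^bsub>B\<^esub> adj B (\<psi> p \<eta>)))"

definition nica_covariant_rep ::
    "('s, 't) monoid_scheme \<Rightarrow> ('s, 'a) prod_system \<Rightarrow> 'b cstar \<Rightarrow> ('s \<Rightarrow> 'a \<Rightarrow> 'b) \<Rightarrow> bool" where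
  "nica_covariant_rep S M B \<psi> \<longleftrightarrow> prod_system_rep S M B \<psi> \<and>
     (\<forall>p\<in>carrier S. \<forall>q\<in>carrier S.
        \<forall>T\<in>carrier (fibre_compacts M p). \<forall>R\<in>carrier (fibre_compacts M q).
        (\<forall>r\<in>carrier S. (p <#\<^bsub>S\<^esub> carrier S) \<inter> (q <#\<^bsub>S\<^esub> carrier S) = r <#\<^bsub>S\<^esub> carrier S \<longrightarrow>
           compact_ext M B \<psi> p T \<otimes>\<^bsub>B\<^esub> compact_ext M B \<psi> q R =
           compact_ext M B \<psi> r
             (compose (carrier (fibre M r)) (iota S M p r T) (iota S M q r R))) \<and>
        ((p <#\<^bsub>S\<^esub> carrier S) \<inter> (q <#\<^bsub>S\<^esub> carrier S) = {} \<longrightarrow>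
           compact_ext M B \<psi> p T \<otimes>\<^bsub>B\<^esub> compact_ext M B \<psi> q R = \<zero>\<^bsub>B\<^esub>))"

text \<open>As for \<open>full_semigroup_cstar\<close>, universality ranges over the C*-algebras carried by subsets of
  the type of \<open>N\<close>.\<close>

definition nica_toeplitz ::
    "('s, 't) monoid_scheme \<Rightarrow> ('s, 'a) prod_system \<Rightarrow> 'b cstar \<Rightarrow> ('s \<Rightarrow> 'a \<Rightarrow> 'b) \<Rightarrow> bool" where
  "nica_toeplitz S M N \<psi> \<longleftrightarrow> nica_covariant_rep S M N \<psi> \<and>
     cstar_generated_by N {\<psi> p \<xi> | p \<xi>. p \<in> carrier S \<and> \<xi> \<in> carrier (fibre M p)} \<and>
     (\<forall>(B :: 'b cstar) \<rho>. nica_covariant_rep S M B \<rho> \<longrightarrow>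
        (\<exists>\<phi> \<in> star_hom N B. \<forall>p\<in>carrier S. \<forall>\<xi>\<in>carrier (fibre M p). \<phi> (\<psi> p \<xi>) = \<rho> p \<xi>))"

definition complex_line_system :: "('s, complex) prod_system" where
  "complex_line_system =
     \<lparr>coeff = complex_cstar, fibre = (\<lambda>p. standard_bimodule complex_cstar),
      pmult = (\<lambda>p q. (*))\<rparr>"


section \<open>The line system is a compactly aligned product system\<close>

text \<open>These facts play no role in the definitions above; they confirm that the axioms apply to the
  intended example.\<close>

lemma complex_field_cring: "cring complex_field"
  by (rule cringI; (intro abelian_groupI comm_monoidI)?)
     (auto simp: complex_field_def algebra_simps intro: exI[of _ "- _"] add.left_inverse)

lemma module_complex:
  assumes "carrier E = (UNIV :: complex set)" "ring.zero E = 0" "add E = (+)" "smult E = (*)"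
  shows "Module.module complex_field E"
proof (rule moduleI)
  show "cring complex_field" by (rule complex_field_cring)
  show "abelian_group E"
    using assms by (intro abelian_groupI) (auto intro: exI[of _ "- _"] add.left_inverse)
qed (use assms in \<open>auto simp: complex_field_def algebra_simps\<close>)

lemma minus_complex:
  assumes "carrier E = (UNIV :: complex set)" "ring.zero E = 0" "add E = (+)" "smult E = (*)"
  shows "x \<ominus>\<^bsub>E\<^esub> y = x - y"
proof -
  interpret Module.module complex_field E
    using module_complex assms .
  have "\<ominus>\<^bsub>E\<^esub> y = - y"
    by (rule M.minus_equality) (simp_all add: assms)
  then show ?thesis
    by (simp add: a_minus_def assms)
qed

lemma norm_dist_complex:
  assumes "carrier E = (UNIV :: complex set)" "ring.zero E = 0" "add E = (+)" "smult E = (*)"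
  shows "norm_dist E cmod = dist"
  by (intro ext) (simp add: norm_dist_def minus_complex[OF assms] assms dist_norm)

lemma complex_cstar_simps [simp]:
  "carrier complex_cstar = UNIV" "ring.zero complex_cstar = 0" "add complex_cstar = (+)"
  "smult complex_cstar = (*)" "monoid.mult complex_cstar = (*)" "one complex_cstar = 1"
  "adj complex_cstar = cnj" "nrm complex_cstar = cmod"
  by (simp_all add: complex_cstar_def)

lemma cstar_algebra_complex: "cstar_algebra complex_cstar"
proof -
  have "norm_complete complex_cstar cmod"
    by (simp add: norm_dist_complex complete_UNIV)
  moreover have "cmod (cnj x * x) = (cmod x)\<^sup>2" for x
    by (simp add: norm_mult power2_eq_square)
  ultimately show ?thesis
    by (intro cstar_algebra.intro module_complex cstar_algebra_axioms.intro)
       (simp_all add: algebra_simps norm_triangle_ineq norm_mult)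
qed

lemma standard_bimodule_complex_simps [simp]:
  "carrier (standard_bimodule complex_cstar) = UNIV"
  "ring.zero (standard_bimodule complex_cstar) = 0"
  "add (standard_bimodule complex_cstar) = (+)"
  "smult (standard_bimodule complex_cstar) = (*)"
  "ract (standard_bimodule complex_cstar) = (*)"
  "lact (standard_bimodule complex_cstar) = (*)"
  "ip (standard_bimodule complex_cstar) = (\<lambda>a b. cnj a * b)"
  by (simp_all add: standard_bimodule_def)

lemma ip_norm_complex [simp]: "ip_norm complex_cstar (standard_bimodule complex_cstar) = cmod"
  by (intro ext) (simp add: ip_norm_def norm_mult)

lemma hilbert_bimodule_complex:
  "hilbert_bimodule complex_cstar (standard_bimodule complex_cstar)"
proof -
  have "norm_complete (standard_bimodule complex_cstar) cmod"
    by (simp add: norm_dist_complex complete_UNIV)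
  then show ?thesis
    by (intro hilbert_bimodule.intro cstar_algebra_complex module_complex
        hilbert_bimodule_axioms.intro)
       (auto simp: algebra_simps)
qed

lemma complex_line_system_simps [simp]:
  "coeff complex_line_system = complex_cstar"
  "fibre complex_line_system p = standard_bimodule complex_cstar"
  "pmult complex_line_system p q = (*)"
  by (simp_all add: complex_line_system_def)

lemma product_system_complex_line:
  assumes "Group.monoid S"
  shows "product_system S complex_line_system"
proof -
  let ?E = "standard_bimodule complex_cstar"
  have all: "{u * v | u v :: complex. True} = UNIV"
    by (metis (mono_tags, lifting) UNIV_eq_I mem_Collect_eq mult_1)
  then have "complex_span ?E {u * v | u v :: complex. True} = UNIV"
    unfolding complex_span_def by auto
  then have "closed_span ?E cmod {u * v | u v :: complex. True} = UNIV"
    unfolding closed_span_def by (simp add: norm_dist_complex)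
  with assms show ?thesis
    by (intro product_system.intro product_system_axioms.intro)
       (auto simp: cstar_algebra_complex hilbert_bimodule_complex algebra_simps)
qed

lemma adjoint_pair_complex:
  "adjoint_pair (standard_bimodule complex_cstar) T T' \<longleftrightarrow>
     (\<exists>c. T = (*) c \<and> T' = (*) (cnj c))"
proof
  assume "adjoint_pair (standard_bimodule complex_cstar) T T'"
  then have adj: "cnj (T \<xi>) * \<eta> = cnj \<xi> * T' \<eta>" for \<xi> \<eta>
    by (simp add: adjoint_pair_def)
  have T': "T' \<eta> = cnj (T 1) * \<eta>" for \<eta>
    using adj[of 1 \<eta>] by simp
  have T: "T \<xi> = T 1 * \<xi>" for \<xi>
  proof -
    have "cnj (T \<xi>) = cnj (T 1 * \<xi>)"
      using adj[of \<xi> 1] T'[of 1] by (simp add: mult.commute)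
    then show ?thesis
      by (simp only: complex_cnj_cancel_iff)
  qed
  show "\<exists>c. T = (*) c \<and> T' = (*) (cnj c)"
    by (intro exI[of _ "T 1"] conjI ext) (rule T, rule T')
qed (auto simp: adjoint_pair_def)

lemma adjointables_complex:
  defines "L \<equiv> adjointables complex_cstar (standard_bimodule complex_cstar)"
  shows "carrier L = range (*)" "ring.zero L = (*) 0" "add L ((*) c) ((*) d) = (*) (c + d)"
    "smult L c ((*) d) = (*) (c * d)" "nrm L ((*) c) = cmod c"
    "Module.module complex_field L"
proof -
  show carr: "carrier L = range (*)"
    by (auto simp: L_def adjointables_def adjoint_pair_complex)
  show zero: "ring.zero L = (*) 0"
    by (auto simp: L_def adjointables_def)
  show add: "add L ((*) c) ((*) d) = (*) (c + d)" for c d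
    by (auto simp: L_def adjointables_def algebra_simps)
  show smult: "smult L c ((*) d) = (*) (c * d)" for c d
    by (auto simp: L_def adjointables_def algebra_simps)
  have "(SUP \<xi>\<in>{\<xi>. cmod \<xi> \<le> 1}. cmod (c * \<xi>)) = cmod c"
    by (rule cSup_eq_maximum)
       (auto simp: norm_mult mult_left_le intro!: image_eqI[of _ _ 1])
  then show "nrm L ((*) c) = cmod c"
    by (simp add: L_def adjointables_def)
  show "Module.module complex_field L"
  proof (rule moduleI)
    show "cring complex_field" by (rule complex_field_cring)
    show "abelian_group L"
    proof (intro abelian_groupI)
      fix x assume "x \<in> carrier L"
      then obtain c where "x = (*) c"
        using carr by auto
      then show "\<exists>y\<in>carrier L. y \<oplus>\<^bsub>L\<^esub> x = \<zero>\<^bsub>L\<^esub>"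
        using carr zero by (intro bexI[of _ "(*) (- c)"]) (auto simp only: add zero left_minus)
    qed (auto simp: carr zero add algebra_simps)
  qed (auto simp: complex_field_def carr zero add smult algebra_simps)
qed

lemma compacts_complex:
  "carrier (compacts complex_cstar (standard_bimodule complex_cstar)) = range (*)"
proof -
  define L where "L = adjointables complex_cstar (standard_bimodule complex_cstar)"
  note L = adjointables_complex[folded L_def]
  interpret L: Module.module complex_field L by (rule L(6))
  have minus: "(*) c \<ominus>\<^bsub>L\<^esub> (*) d = (*) (c - d)" for c d
  proof -
    have "\<ominus>\<^bsub>L\<^esub> (*) d = (*) (- d)"
      by (rule L.minus_equality) (simp_all only: L rangeI left_minus)
    then show ?thesis
      by (simp add: a_minus_def L)
  qed
  have dist: "norm_dist L (nrm L) ((*) c) ((*) d) = cmod (c - d)" for c d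
    by (simp add: norm_dist_def minus L)
  have inj: "(*) c = (*) d \<longleftrightarrow> c = d" for c d :: complex
    by (metis mult.right_neutral)
  interpret M: Metric_space "carrier L" "norm_dist L (nrm L)"
  proof
    fix x y
    show "0 \<le> norm_dist L (nrm L) x y"
      by (auto simp: norm_dist_def L minus)
    show "norm_dist L (nrm L) x y = norm_dist L (nrm L) y x"
      by (auto simp: norm_dist_def L minus norm_minus_commute)
  next
    fix x y assume "x \<in> carrier L" "y \<in> carrier L"
    then show "norm_dist L (nrm L) x y = 0 \<longleftrightarrow> x = y"
      by (auto simp: L dist inj)
  next
    fix x y z assume "x \<in> carrier L" "y \<in> carrier L" "z \<in> carrier L"
    then obtain a b c where "x = (*) a" "y = (*) b" "z = (*) c"
      by (auto simp: L)
    then show "norm_dist L (nrm L) x z \<le> norm_dist L (nrm L) x y + norm_dist L (nrm L) y z"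
      using norm_triangle_ineq[of "a - b" "b - c"] by (simp add: dist)
  qed
  let ?R = "{rank_one (standard_bimodule complex_cstar) \<xi> \<eta> | \<xi> \<eta>. True}"
  have "rank_one (standard_bimodule complex_cstar) c 1 = (*) c" for c
    by (auto simp: rank_one_def)
  then have "carrier L \<subseteq> ?R"
    unfolding L(1) by (metis (mono_tags, lifting) image_subsetI mem_Collect_eq)
  moreover have "submodule (carrier L) complex_field L"
    by (rule L.carrier_is_submodule)
  moreover have "?R \<subseteq> carrier L"
  proof -
    have "rank_one (standard_bimodule complex_cstar) \<xi> \<eta> = (*) (\<xi> * cnj \<eta>)" for \<xi> \<eta>
      by (auto simp: rank_one_def)
    then show ?thesis
      by (auto simp: L(1))
  qed
  ultimately have "complex_span L ?R = carrier L"
    unfolding complex_span_def by auto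
  then have "closed_span L (nrm L) ?R = carrier L"
    using closure_of_topspace[of M.mtopology] by (simp add: closed_span_def)
  then show ?thesis
    by (simp add: compacts_def L_def[symmetric] L(1))
qed

lemma iota_complex:
  assumes "p \<in> carrier S" "q \<in> carrier S"
  shows "iota S complex_line_system p (p \<otimes>\<^bsub>S\<^esub> q) ((*) c) = (*) c"
  unfolding iota_def
proof (rule the_equality)
  fix R
  assume R: "R \<in> carrier (adjointables (coeff complex_line_system)
                (fibre complex_line_system (p \<otimes>\<^bsub>S\<^esub> q))) \<and>
     (\<forall>q'\<in>carrier S. p \<otimes>\<^bsub>S\<^esub> q' = p \<otimes>\<^bsub>S\<^esub> q \<longrightarrow>
        (\<forall>\<xi>\<in>carrier (fibre complex_line_system p). \<forall>\<eta>\<in>carrier (fibre complex_line_system q').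
           R (pmult complex_line_system p q' \<xi> \<eta>) =
           pmult complex_line_system p q' (c * \<xi>) \<eta>))"
  have "R \<eta> = c * \<eta>" for \<eta>
  proof -
    have "R (\<xi> * \<eta>) = (c * \<xi>) * \<eta>" for \<xi>
      using R assms(2) by auto
    from this[of 1] show ?thesis by simp
  qed
  then show "R = (*) c"
    by (rule ext)
qed (simp add: adjointables_complex(1))

lemma compactly_aligned_complex_line:
  assumes "Group.monoid S"
  shows "compactly_aligned S complex_line_system"
  unfolding compactly_aligned_def
proof (intro ballI impI)
  interpret S: Group.monoid S by fact
  fix p q r T R
  assume pqr: "p \<in> carrier S" "q \<in> carrier S" "r \<in> carrier S"
    and ideal: "(p <#\<^bsub>S\<^esub> carrier S) \<inter> (q <#\<^bsub>S\<^esub> carrier S) = r <#\<^bsub>S\<^esub> carrier S"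
    and "T \<in> carrier (fibre_compacts complex_line_system p)"
    and "R \<in> carrier (fibre_compacts complex_line_system q)"
  then obtain c d where T: "T = (*) c" and R: "R = (*) d"
    by (auto simp: compacts_complex)
  have "r \<otimes>\<^bsub>S\<^esub> \<one>\<^bsub>S\<^esub> \<in> r <#\<^bsub>S\<^esub> carrier S"
    unfolding l_coset_def by blast
  then have "r \<in> p <#\<^bsub>S\<^esub> carrier S" "r \<in> q <#\<^bsub>S\<^esub> carrier S"
    using pqr unfolding ideal[symmetric] by simp_all
  then obtain p' q' where "p' \<in> carrier S" "q' \<in> carrier S"
    "r = p \<otimes>\<^bsub>S\<^esub> p'" "r = q \<otimes>\<^bsub>S\<^esub> q'"
    unfolding l_coset_def by blast
  then have "iota S complex_line_system p r T = (*) c" "iota S complex_line_system q r R = (*) d"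
    using pqr T R iota_complex by metis+
  moreover have "compose UNIV ((*) c) ((*) d) = (*) (c * d)"
    by (auto simp: compose_def)
  ultimately show "compose (carrier (fibre complex_line_system r))
      (iota S complex_line_system p r T) (iota S complex_line_system q r R)
        \<in> carrier (fibre_compacts complex_line_system r)"
    by (simp add: compacts_complex)
qed

end

theory Submission
  imports Defs
begin

text \<open>Both algebras are universal for the same data. Since every fibre is \<open>\<complex>\<close>, a representation \<open>\<psi>\<close> of the
  line system is determined by the elements \<open>v\<^sub>p = \<psi>\<^sub>p(1)\<close>, through \<open>\<psi>\<^sub>p(c) = c v\<^sub>p\<close>. The
  axioms of a representation say that \<open>v\<^sub>p v\<^sub>q = v\<^sub>p\<^sub>q\<close> and \<open>v\<^sub>p\<^sup>* v\<^sub>p = v\<^sub>1\<close>, so that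
  \<open>u = v\<^sub>1\<close> is a projection which acts as a unit on everything generated by the \<open>v\<^sub>p\<close>. The map
  \<open>\<psi>\<^sup>(\<^sup>p\<^sup>)\<close> sends the scalar operator \<open>c\<close> to \<open>c v\<^sub>p v\<^sub>p\<^sup>*\<close>, hence Nica covariance says that the
  range projections \<open>v\<^sub>p v\<^sub>p\<^sup>*\<close> multiply like the ideals \<open>pS\<close> intersect. Putting
  \<open>e\<^sub>p\<^sub>S = v\<^sub>p v\<^sub>p\<^sup>*\<close> turns such a family into a representation of the relations of \<open>C\<^sup>*(S)\<close> in
  the corner \<open>uBu\<close>, and conversely these relations force \<open>e\<^sub>p\<^sub>S = v\<^sub>p v\<^sub>p\<^sup>*\<close>. Therefore
  \<open>C\<^sup>*(S)\<close> with \<open>\<psi>\<^sub>p(c) = c v\<^sub>p\<close> has the universal property of the Nica-Toeplitz algebra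
  (\<open>full_semigroup_cstar_nica_toeplitz\<close>).\<close>

text \<open>Two algebras with that property are isomorphic: the homomorphisms given by universality are
  inverse to each other on generators, hence everywhere, because the set on which two
  *-homomorphisms agree is a C*-subalgebra (\<open>star_hom_equalizer\<close>). That this set is closed rests
  on the automatic contractivity of *-homomorphisms (\<open>star_hom_contractive\<close>), for which there is a
  proof without spectral theory. A self-adjoint \<open>h\<close> with \<open>\<parallel>h\<parallel> < 1\<close> is the real part of the unitary
  \<open>h + \<i> (1 - k)\<close>, where \<open>k = 1 - sqrt (1 - h\<^sup>2)\<close> is found in the algebra itself as a fixed point
  of a contraction. The image of a unitary is a unitary, and the real part of a unitary has norm at
  most 1. To avoid adjoining a unit, \<open>1\<close> acts here as the identity operator on the algebra.\<close>

text \<open>For the existence of \<open>C\<^sup>*(S)\<close> inside the given type, let \<open>P\<close> be the bounded product of all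
  representations whose underlying sets lie in this type, and let \<open>D\<close> be the C*-subalgebra of \<open>P\<close> that
  the diagonal generators generate. Evaluation at a factor gives the required homomorphism into it.
  As \<open>S\<close> is countable, \<open>D\<close> is separable and thus has at most the cardinality of the continuum
  (\<open>cstar_generated_lepoll_real\<close>), so a copy of \<open>D\<close> fits into the type.\<close>


section \<open>Normed spaces and C*-algebras on carriers\<close>

lemma complex_field_simps [simp]:
  "carrier complex_field = UNIV" "monoid.mult complex_field = (*)" "one complex_field = 1"
  "ring.zero complex_field = 0" "add complex_field = (+)"
  by (simp_all add: complex_field_def)

locale normed_space = Module.module complex_field E for E :: "(complex, 'a, 'm) module_scheme" (structure) +
  fixes N :: "'a \<Rightarrow> real"
  assumes N_nonneg: "x \<in> carrier E \<Longrightarrow> 0 \<le> N x"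
    and N_eq_0: "x \<in> carrier E \<Longrightarrow> N x = 0 \<longleftrightarrow> x = \<zero>"
    and N_triangle: "\<lbrakk>x \<in> carrier E; y \<in> carrier E\<rbrakk> \<Longrightarrow> N (x \<oplus> y) \<le> N x + N y"
    and N_smult: "x \<in> carrier E \<Longrightarrow> N (c \<odot> x) = cmod c * N x"

context Module.module
begin

lemma submodule_mem:
  assumes "submodule H R M"
  shows "H \<subseteq> carrier M" "\<zero>\<^bsub>M\<^esub> \<in> H"
    "\<lbrakk>x \<in> H; y \<in> H\<rbrakk> \<Longrightarrow> x \<oplus>\<^bsub>M\<^esub> y \<in> H"
    "\<lbrakk>a \<in> carrier R; x \<in> H\<rbrakk> \<Longrightarrow> a \<odot>\<^bsub>M\<^esub> x \<in> H"
    "\<lbrakk>x \<in> H; y \<in> H\<rbrakk> \<Longrightarrow> x \<ominus>\<^bsub>M\<^esub> y \<in> H"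
proof -
  note E = submoduleE[OF assms]
  show "H \<subseteq> carrier M" by (rule E(1))
  show add: "\<lbrakk>x \<in> H; y \<in> H\<rbrakk> \<Longrightarrow> x \<oplus>\<^bsub>M\<^esub> y \<in> H" for x y by (rule E(5))
  show "\<lbrakk>a \<in> carrier R; x \<in> H\<rbrakk> \<Longrightarrow> a \<odot>\<^bsub>M\<^esub> x \<in> H" by (rule E(4))
  show minus: "\<lbrakk>x \<in> H; y \<in> H\<rbrakk> \<Longrightarrow> x \<ominus>\<^bsub>M\<^esub> y \<in> H" for x y
    unfolding a_minus_def by (intro add E(3))
  obtain x where x: "x \<in> H" using E(2) by auto
  then show "\<zero>\<^bsub>M\<^esub> \<in> H"
    using minus[OF x x] E(1) by (auto simp: a_minus_def M.r_neg)
qed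

end

lemma (in Module.module) minus_self [simp]: "x \<in> carrier M \<Longrightarrow> x \<ominus>\<^bsub>M\<^esub> x = \<zero>\<^bsub>M\<^esub>"
  by (simp add: a_minus_def M.r_neg)

lemma (in Module.module) minus_add_cancel: 
  "\<lbrakk>x \<in> carrier M; y \<in> carrier M\<rbrakk> \<Longrightarrow> (x \<ominus>\<^bsub>M\<^esub> y) \<oplus>\<^bsub>M\<^esub> y = x"
  by (simp add: a_minus_def M.a_assoc M.l_neg)

lemma (in Module.module) minus_trans: 
  "\<lbrakk>x \<in> carrier M; y \<in> carrier M; z \<in> carrier M\<rbrakk> \<Longrightarrow> (x \<ominus>\<^bsub>M\<^esub> y) \<oplus>\<^bsub>M\<^esub> (y \<ominus>\<^bsub>M\<^esub> z) = x \<ominus>\<^bsub>M\<^esub> z"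
  by (metis M.a_assoc M.minus_closed a_minus_def minus_add_cancel M.a_inv_closed)

lemma (in Module.module) minus_eq_0_iff: 
  "\<lbrakk>x \<in> carrier M; y \<in> carrier M\<rbrakk> \<Longrightarrow> x \<ominus>\<^bsub>M\<^esub> y = \<zero>\<^bsub>M\<^esub> \<longleftrightarrow> x = y"
  by (metis M.l_zero minus_add_cancel minus_self)

text \<open>Expressing subtraction through scalar multiplication reduces the algebra of differences to associative
  and commutative rewriting of sums.\<close>
lemma complex_minus_eq:
  assumes "Module.module complex_field E" "x \<in> carrier E" "y \<in> carrier E"
  shows "x \<ominus>\<^bsub>E\<^esub> y = x \<oplus>\<^bsub>E\<^esub> (-1) \<odot>\<^bsub>E\<^esub> y"
proof -
  interpret E: Module.module complex_field E by fact
  have "y \<oplus>\<^bsub>E\<^esub> (-1) \<odot>\<^bsub>E\<^esub> y = \<zero>\<^bsub>E\<^esub>"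
    using E.smult_l_distr[of 1 "-1" y] E.smult_one[of y] E.smult_l_null[of y] assms by simp
  then have "\<ominus>\<^bsub>E\<^esub> y = (-1) \<odot>\<^bsub>E\<^esub> y"
    using assms by (intro E.M.minus_equality) (simp_all add: E.M.a_comm)
  then show ?thesis by (simp add: a_minus_def)
qed

context normed_space
begin

lemmas minus_eq = complex_minus_eq[OF module_axioms]

lemma smult_mem [simp]: "x \<in> carrier E \<Longrightarrow> c \<odot> x \<in> carrier E"
  by simp

lemma smult_add: "x \<in> carrier E \<Longrightarrow> (c + d) \<odot> x = c \<odot> x \<oplus> d \<odot> x"
  using smult_l_distr[of c d x] by simp

lemma smult_smult: "x \<in> carrier E \<Longrightarrow> c \<odot> (d \<odot> x) = (c * d) \<odot> x"
  using smult_assoc1[of c d x] by simp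

lemma smult_1 [simp]: "x \<in> carrier E \<Longrightarrow> 1 \<odot> x = x"
  using smult_one[of x] by simp

lemma smult_0 [simp]: "x \<in> carrier E \<Longrightarrow> 0 \<odot> x = \<zero>"
  using smult_l_null[of x] by simp

lemma smult_zero [simp]: "c \<odot> \<zero> = \<zero>"
  using smult_r_null[of c] by simp

lemma smult_add_vec: "\<lbrakk>x \<in> carrier E; y \<in> carrier E\<rbrakk> \<Longrightarrow> c \<odot> (x \<oplus> y) = c \<odot> x \<oplus> c \<odot> y"
  using smult_r_distr[of c x y] by simp

lemma smult_minus_vec: "\<lbrakk>x \<in> carrier E; y \<in> carrier E\<rbrakk> \<Longrightarrow> c \<odot> (x \<ominus> y) = c \<odot> x \<ominus> c \<odot> y"
  by (simp add: minus_eq smult_add_vec smult_smult)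

lemma smult_minus: "x \<in> carrier E \<Longrightarrow> (c - d) \<odot> x = c \<odot> x \<ominus> d \<odot> x"
  using smult_add[of x c "-d"] by (simp add: minus_eq smult_smult)

lemma N_zero [simp]: "N \<zero> = 0"
  by (simp add: N_eq_0)

lemma minus_commute: "\<lbrakk>x \<in> carrier E; y \<in> carrier E\<rbrakk> \<Longrightarrow> y \<ominus> x = (-1) \<odot> (x \<ominus> y)"
  by (simp add: minus_eq smult_add_vec smult_smult M.a_comm)

lemma N_minus_commute: "\<lbrakk>x \<in> carrier E; y \<in> carrier E\<rbrakk> \<Longrightarrow> N (y \<ominus> x) = N (x \<ominus> y)"
  by (simp add: minus_commute[of x y] N_smult)

lemma N_minus_triangle:
  "\<lbrakk>x \<in> carrier E; y \<in> carrier E; z \<in> carrier E\<rbrakk> \<Longrightarrow> N (x \<ominus> z) \<le> N (x \<ominus> y) + N (y \<ominus> z)"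
  using N_triangle[of "x \<ominus> y" "y \<ominus> z"] by (simp add: minus_trans)

lemma add_minus_add:
  "\<lbrakk>x \<in> carrier E; y \<in> carrier E; x' \<in> carrier E; y' \<in> carrier E\<rbrakk>
    \<Longrightarrow> (x \<oplus> y) \<ominus> (x' \<oplus> y') = (x \<ominus> x') \<oplus> (y \<ominus> y')"
  by (simp add: minus_eq smult_add_vec M.a_ac)

lemma N_add_minus_add:
  "\<lbrakk>x \<in> carrier E; y \<in> carrier E; x' \<in> carrier E; y' \<in> carrier E\<rbrakk>
    \<Longrightarrow> N ((x \<oplus> y) \<ominus> (x' \<oplus> y')) \<le> N (x \<ominus> x') + N (y \<ominus> y')"
  by (simp add: add_minus_add N_triangle)

sublocale Metric: Metric_space "carrier E" "norm_dist E N"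
proof
  show "0 \<le> norm_dist E N x y" for x y
    by (simp add: norm_dist_def N_nonneg)
  show "norm_dist E N x y = norm_dist E N y x" for x y
    by (simp add: norm_dist_def N_minus_commute[of x y])
  show "\<lbrakk>x \<in> carrier E; y \<in> carrier E\<rbrakk> \<Longrightarrow> norm_dist E N x y = 0 \<longleftrightarrow> x = y" for x y
    by (simp add: norm_dist_def N_eq_0 minus_eq_0_iff)
  show "\<lbrakk>x \<in> carrier E; y \<in> carrier E; z \<in> carrier E\<rbrakk> \<Longrightarrow>
      norm_dist E N x z \<le> norm_dist E N x y + norm_dist E N y z" for x y z
    by (simp add: norm_dist_def N_minus_triangle)
qed

lemma closure_of_iff:
  "x \<in> Abstract_Topology.closure_of (norm_topology E N) S \<longleftrightarrow>
     x \<in> carrier E \<and> (\<forall>\<epsilon>>0. \<exists>y\<in>S. y \<in> carrier E \<and> N (x \<ominus> y) < \<epsilon>)"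
  by (force simp: Metric.metric_closure_of norm_dist_def)

text \<open>The metric descriptions of closedness and completeness below are phrased with the norm of a difference only,
  which is what algebraic manipulation can produce.\<close>
lemma closedin_iff:
  "closedin (norm_topology E N) C \<longleftrightarrow> C \<subseteq> carrier E \<and>
     (\<forall>x\<in>carrier E. (\<forall>\<epsilon>>0. \<exists>y\<in>C. N (x \<ominus> y) < \<epsilon>) \<longrightarrow> x \<in> C)"
proof (cases "C \<subseteq> carrier E")
  case True
  then have "(closedin (norm_topology E N) C) = (Abstract_Topology.closure_of (norm_topology E N) C \<subseteq> C)"
    using closure_of_subset_eq[of C "norm_topology E N"] by simp
  also have "\<dots> \<longleftrightarrow> (\<forall>x\<in>carrier E. (\<forall>\<epsilon>>0. \<exists>y\<in>C. N (x \<ominus> y) < \<epsilon>) \<longrightarrow> x \<in> C)"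
    using True by (simp add: subset_iff closure_of_iff) blast
  finally show ?thesis using True by blast
next
  case False
  then show ?thesis
    using closedin_subset[of "norm_topology E N" C] by auto
qed

lemma norm_complete_iff:
  "norm_complete E N \<longleftrightarrow>
     (\<forall>\<sigma> :: nat \<Rightarrow> _. (\<forall>n. \<sigma> n \<in> carrier E) \<longrightarrow> (\<forall>\<epsilon>>0. \<exists>n0. \<forall>m\<ge>n0. \<forall>n\<ge>n0. N (\<sigma> m \<ominus> \<sigma> n) < \<epsilon>) \<longrightarrow>
        (\<exists>x\<in>carrier E. \<forall>\<epsilon>>0. \<exists>n0. \<forall>n\<ge>n0. N (\<sigma> n \<ominus> x) < \<epsilon>))"
proof -
  have C: "Metric.MCauchy \<sigma> \<longleftrightarrow> (\<forall>n. \<sigma> n \<in> carrier E) \<and>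
      (\<forall>\<epsilon>>0. \<exists>n0. \<forall>m\<ge>n0. \<forall>n\<ge>n0. N (\<sigma> m \<ominus> \<sigma> n) < \<epsilon>)" for \<sigma>
    unfolding Metric.MCauchy_def norm_dist_def image_subset_iff
    by (cases "\<forall>n. \<sigma> n \<in> carrier E") (simp_all, blast)
  have L: "limitin Metric.mtopology \<sigma> x sequentially \<longleftrightarrow>
      x \<in> carrier E \<and> (\<forall>\<epsilon>>0. \<exists>n0. \<forall>n\<ge>n0. N (\<sigma> n \<ominus> x) < \<epsilon>)"
    if "\<forall>n. \<sigma> n \<in> carrier E" for \<sigma> x
    unfolding Metric.limit_metric_sequentially norm_dist_def using that by auto
  have "norm_complete E N \<longleftrightarrow> (\<forall>\<sigma>. Metric.MCauchy \<sigma> \<longrightarrow> (\<exists>x. limitin Metric.mtopology \<sigma> x sequentially))"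
    by (simp add: Metric.mcomplete_def)
  also have "\<dots> \<longleftrightarrow> (\<forall>\<sigma> :: nat \<Rightarrow> _. (\<forall>n. \<sigma> n \<in> carrier E) \<longrightarrow> (\<forall>\<epsilon>>0. \<exists>n0. \<forall>m\<ge>n0. \<forall>n\<ge>n0. N (\<sigma> m \<ominus> \<sigma> n) < \<epsilon>) \<longrightarrow>
        (\<exists>x\<in>carrier E. \<forall>\<epsilon>>0. \<exists>n0. \<forall>n\<ge>n0. N (\<sigma> n \<ominus> x) < \<epsilon>))" (is "_ \<longleftrightarrow> (\<forall>\<sigma>. ?Q \<sigma>)")
  proof (rule arg_cong[where f = All], rule ext)
    fix \<sigma>
    show "(Metric.MCauchy \<sigma> \<longrightarrow> (\<exists>x. limitin Metric.mtopology \<sigma> x sequentially)) \<longleftrightarrow> ?Q \<sigma>"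
    proof (cases "\<forall>n. \<sigma> n \<in> carrier E")
      case True
      then show ?thesis by (simp only: C L[OF True] Bex_def simp_thms)
    qed (use C in blast)
  qed
  finally show ?thesis .
qed

end

text \<open>The constant \<open>C\<close> absorbs the operator norms that appear when a relation is passed to a limit.\<close>
lemma (in normed_space) eq_if_arbitrarily_close:
  assumes "x \<in> carrier E" "y \<in> carrier E" "\<And>\<epsilon>. \<epsilon> > 0 \<Longrightarrow> N (x \<ominus> y) \<le> C * \<epsilon>"
  shows "x = y"
proof -
  have "N (x \<ominus> y) \<le> 0"
  proof (rule field_le_epsilon)
    fix e :: real assume "e > 0"
    then have "e / (\<bar>C\<bar> + 1) > 0" by simp
    from assms(3)[OF this] have "N (x \<ominus> y) \<le> C * (e / (\<bar>C\<bar> + 1))" .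
    also have "\<dots> \<le> (\<bar>C\<bar> + 1) * (e / (\<bar>C\<bar> + 1))"
      using \<open>e / (\<bar>C\<bar> + 1) > 0\<close> by (intro mult_right_mono) auto
    also have "\<dots> = 0 + e" by simp
    finally show "N (x \<ominus> y) \<le> 0 + e" .
  qed
  then show ?thesis
    using assms(1,2) N_nonneg[of "x \<ominus> y"] N_eq_0[of "x \<ominus> y"] by (simp add: minus_eq_0_iff)
qed

context cstar_algebra
begin

sublocale normed_space A "nrm A"
  by unfold_locales (simp_all add: nrm_nonneg nrm_eq_0 nrm_triangle nrm_smult)

lemmas [simp] = mult_closed adj_closed adj_adj nrm_nonneg

lemma mult_zero_left [simp]: "x \<in> carrier A \<Longrightarrow> \<zero> \<otimes> x = \<zero>"
  using mult_smult_left[of \<zero> x 0] by simp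

lemma mult_zero_right [simp]: "x \<in> carrier A \<Longrightarrow> x \<otimes> \<zero> = \<zero>"
  using mult_smult_right[of x \<zero> 0] by simp

lemma mult_minus_left:
  "\<lbrakk>x \<in> carrier A; y \<in> carrier A; z \<in> carrier A\<rbrakk> \<Longrightarrow> (x \<ominus> y) \<otimes> z = x \<otimes> z \<ominus> y \<otimes> z"
  by (simp add: minus_eq mult_add_left mult_smult_left)

lemma mult_minus_right:
  "\<lbrakk>x \<in> carrier A; y \<in> carrier A; z \<in> carrier A\<rbrakk> \<Longrightarrow> z \<otimes> (x \<ominus> y) = z \<otimes> x \<ominus> z \<otimes> y"
  by (simp add: minus_eq mult_add_right mult_smult_right)

lemma adj_zero [simp]: "adj A \<zero> = \<zero>"
  using adj_smult[of \<zero> 0] by simp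

lemma adj_minus: "\<lbrakk>x \<in> carrier A; y \<in> carrier A\<rbrakk> \<Longrightarrow> adj A (x \<ominus> y) = adj A x \<ominus> adj A y"
  by (simp add: minus_eq adj_add adj_smult)

text \<open>From \<open>\<parallel>x\<parallel>\<^sup>2 = \<parallel>x\<^sup>*x\<parallel> \<le> \<parallel>x\<^sup>*\<parallel> \<parallel>x\<parallel>\<close> one gets \<open>\<parallel>x\<parallel> \<le> \<parallel>x\<^sup>*\<parallel>\<close>, and applying this to \<open>x\<^sup>*\<close> gives equality.\<close>
lemma nrm_adj [simp]:
  assumes "x \<in> carrier A" shows "nrm A (adj A x) = nrm A x"
proof -
  have le: "nrm A y \<le> nrm A (adj A y)" if y: "y \<in> carrier A" for y
  proof (cases "nrm A y = 0")
    case False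
    have "nrm A y * nrm A y \<le> nrm A (adj A y) * nrm A y"
      using cstar_identity[OF y] nrm_mult[of "adj A y" y] y by (simp add: power2_eq_square)
    then show ?thesis
      using False nrm_nonneg[OF y] by (simp add: mult_le_cancel_right)
  qed (use y in simp)
  from le[of x] le[of "adj A x"] assms show ?thesis by simp
qed

lemma nrm_mult_minus_mult:
  assumes "x \<in> carrier A" "y \<in> carrier A" "x' \<in> carrier A" "y' \<in> carrier A"
  shows "nrm A ((x \<otimes> y) \<ominus> (x' \<otimes> y')) \<le> nrm A x * nrm A (y \<ominus> y') + nrm A (x \<ominus> x') * nrm A y'"
proof -
  have "nrm A ((x \<otimes> y) \<ominus> (x' \<otimes> y')) \<le> nrm A (x \<otimes> y \<ominus> x \<otimes> y') + nrm A (x \<otimes> y' \<ominus> x' \<otimes> y')"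
    using assms by (intro N_minus_triangle) auto
  also have "\<dots> = nrm A (x \<otimes> (y \<ominus> y')) + nrm A ((x \<ominus> x') \<otimes> y')"
    using assms by (simp add: mult_minus_left mult_minus_right)
  also have "\<dots> \<le> nrm A x * nrm A (y \<ominus> y') + nrm A (x \<ominus> x') * nrm A y'"
    using assms by (intro add_mono nrm_mult) auto
  finally show ?thesis .
qed

lemma isometry_nrm_le_1:
  assumes "isometry A x" "nrm A \<one> \<le> 1" shows "nrm A x \<le> 1"
  using assms cstar_identity[of x] unfolding isometry_def
  by (metis nrm_nonneg power2_le_imp_le one_power2 zero_le_one)

lemma projection_nrm_le_1:
  assumes "projection A x" shows "nrm A x \<le> 1"
proof -
  have x: "x \<in> carrier A" "nrm A x = nrm A x * nrm A x"
    using assms cstar_identity[of x] by (simp_all add: projection_def power2_eq_square)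
  then show ?thesis
    by (metis mult_cancel_left1 order_refl zero_le_one)
qed

end

lemma cstar_subalgebra_iff:
  assumes "cstar_algebra A"
  shows "cstar_subalgebra A D \<longleftrightarrow> D \<subseteq> carrier A \<and> \<zero>\<^bsub>A\<^esub> \<in> D \<and>
     (\<forall>x\<in>D. \<forall>y\<in>D. x \<oplus>\<^bsub>A\<^esub> y \<in> D) \<and> (\<forall>c. \<forall>x\<in>D. c \<odot>\<^bsub>A\<^esub> x \<in> D) \<and>
     (\<forall>x\<in>D. \<forall>y\<in>D. x \<otimes>\<^bsub>A\<^esub> y \<in> D) \<and> (\<forall>x\<in>D. adj A x \<in> D) \<and>
     (\<forall>x\<in>carrier A. (\<forall>\<epsilon>>0. \<exists>y\<in>D. nrm A (x \<ominus>\<^bsub>A\<^esub> y) < \<epsilon>) \<longrightarrow> x \<in> D)"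
proof -
  interpret cstar_algebra A by fact
  have "submodule D complex_field A \<longleftrightarrow> D \<subseteq> carrier A \<and> \<zero>\<^bsub>A\<^esub> \<in> D \<and>
     (\<forall>x\<in>D. \<forall>y\<in>D. x \<oplus>\<^bsub>A\<^esub> y \<in> D) \<and> (\<forall>c. \<forall>x\<in>D. c \<odot>\<^bsub>A\<^esub> x \<in> D)" (is "?l = ?r")
  proof
    assume ?l
    from submodule_mem[OF this] show ?r by (simp add: subset_iff)
  next
    assume r: ?r
    have "\<ominus>\<^bsub>A\<^esub> x \<in> D" if "x \<in> D" for x
    proof -
      have "\<ominus>\<^bsub>A\<^esub> x = (-1) \<odot>\<^bsub>A\<^esub> x"
        using that r minus_eq[of "\<zero>\<^bsub>A\<^esub>" x] by (auto simp: a_minus_def subset_iff)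
      then show ?thesis using r that by auto
    qed
    then show ?l by (intro submoduleI) (use r in auto)
  qed
  then show ?thesis
    by (auto simp: cstar_subalgebra_def closedin_iff)
qed


section \<open>Subalgebras, corners and isomorphic copies\<close>

text \<open>\<open>f\<close> identifies \<open>B\<close>, so far a mere record of operations, with a C*-subalgebra of \<open>A\<close>. Then \<open>B\<close> inherits the axioms.
  With \<open>f\<close> an inclusion this handles subalgebras and corners, whose unit differs from that of \<open>A\<close>;
  with \<open>f\<close> the inverse of an injection it moves an algebra to another type.\<close>
locale cstar_embedding = A: cstar_algebra A
  for f :: "'b \<Rightarrow> 'a" and B :: "'b cstar" and A :: "'a cstar" +
  assumes inj: "inj_on f (carrier B)"
    and image: "cstar_subalgebra A (f ` carrier B)"
    and zero: "\<zero>\<^bsub>B\<^esub> \<in> carrier B" "f \<zero>\<^bsub>B\<^esub> = \<zero>\<^bsub>A\<^esub>"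
    and add: "\<And>x y. \<lbrakk>x \<in> carrier B; y \<in> carrier B\<rbrakk> \<Longrightarrow>
          x \<oplus>\<^bsub>B\<^esub> y \<in> carrier B \<and> f (x \<oplus>\<^bsub>B\<^esub> y) = f x \<oplus>\<^bsub>A\<^esub> f y"
    and mult: "\<And>x y. \<lbrakk>x \<in> carrier B; y \<in> carrier B\<rbrakk> \<Longrightarrow>
          x \<otimes>\<^bsub>B\<^esub> y \<in> carrier B \<and> f (x \<otimes>\<^bsub>B\<^esub> y) = f x \<otimes>\<^bsub>A\<^esub> f y"
    and smult: "\<And>c x. x \<in> carrier B \<Longrightarrow>
          c \<odot>\<^bsub>B\<^esub> x \<in> carrier B \<and> f (c \<odot>\<^bsub>B\<^esub> x) = c \<odot>\<^bsub>A\<^esub> f x"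
    and adj: "\<And>x. x \<in> carrier B \<Longrightarrow> adj B x \<in> carrier B \<and> f (adj B x) = adj A (f x)"
    and nrm: "\<And>x. x \<in> carrier B \<Longrightarrow> nrm B x = nrm A (f x)"
begin

lemmas image_subalgebra = image[unfolded cstar_subalgebra_iff[OF A.cstar_algebra_axioms]]
lemmas ops = zero add mult smult adj

lemma mem [simp]: "x \<in> carrier B \<Longrightarrow> f x \<in> carrier A"
  using image_subalgebra by blast

lemma eqI: "\<lbrakk>f x = f y; x \<in> carrier B; y \<in> carrier B\<rbrakk> \<Longrightarrow> x = y"
  using inj by (auto dest: inj_onD)

lemma domain_module: "Module.module complex_field B"
proof (rule moduleI)
  show "cring complex_field" by (rule complex_field_cring)
  show "abelian_group B"
  proof (rule abelian_groupI)
    fix x assume x: "x \<in> carrier B"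
    have "f x \<oplus>\<^bsub>A\<^esub> (-1) \<odot>\<^bsub>A\<^esub> f x = \<zero>\<^bsub>A\<^esub>"
      using x A.minus_eq[of "f x" "f x"] by simp
    then show "\<exists>y\<in>carrier B. y \<oplus>\<^bsub>B\<^esub> x = \<zero>\<^bsub>B\<^esub>"
      using x by (intro bexI[of _ "(-1) \<odot>\<^bsub>B\<^esub> x"] eqI) (simp_all add: ops A.a_comm)
  qed (((rule eqI; simp add: ops A.a_ac; fail) | (simp add: ops; fail))+)
qed (((rule eqI; simp add: ops A.smult_add A.smult_add_vec A.smult_smult; fail) | (simp add: ops; fail))+)

lemma map_minus: "\<lbrakk>x \<in> carrier B; y \<in> carrier B\<rbrakk> \<Longrightarrow> f (x \<ominus>\<^bsub>B\<^esub> y) = f x \<ominus>\<^bsub>A\<^esub> f y"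
  by (simp add: complex_minus_eq[OF domain_module] A.minus_eq ops)

text \<open>Equations hold in \<open>B\<close> because their images hold in \<open>A\<close> and \<open>f\<close> is injective. For completeness, the image
  of a Cauchy sequence converges in \<open>A\<close>, and the limit stays in the image since that is closed.\<close>
theorem domain_cstar_algebra: "cstar_algebra B"
proof -
  note module = domain_module
  note minus = map_minus
  note sub = image_subalgebra
  interpret B: normed_space B "nrm B"
  proof (intro normed_space.intro module normed_space_axioms.intro)
    show "nrm B x = 0 \<longleftrightarrow> x = \<zero>\<^bsub>B\<^esub>" if "x \<in> carrier B" for x
      using that ops nrm eqI by (auto simp: A.N_eq_0)
  qed (simp_all add: nrm ops A.N_triangle A.N_smult)
  have complete: "norm_complete B (nrm B)"
    unfolding B.norm_complete_iff
  proof (intro allI impI)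
    fix \<sigma> :: "nat \<Rightarrow> 'b" assume \<sigma>: "\<forall>n. \<sigma> n \<in> carrier B"
      and cauchy: "\<forall>\<epsilon>>0. \<exists>n0. \<forall>m\<ge>n0. \<forall>n\<ge>n0. nrm B (\<sigma> m \<ominus>\<^bsub>B\<^esub> \<sigma> n) < \<epsilon>"
    have "\<forall>n. f (\<sigma> n) \<in> carrier A" using \<sigma> by simp
    moreover have "\<forall>\<epsilon>>0. \<exists>n0. \<forall>m\<ge>n0. \<forall>n\<ge>n0. nrm A (f (\<sigma> m) \<ominus>\<^bsub>A\<^esub> f (\<sigma> n)) < \<epsilon>"
      using cauchy \<sigma> by (simp add: nrm minus)
    ultimately obtain y where y: "y \<in> carrier A"
      and lim: "\<forall>\<epsilon>>0. \<exists>n0. \<forall>n\<ge>n0. nrm A (f (\<sigma> n) \<ominus>\<^bsub>A\<^esub> y) < \<epsilon>"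
      using A.nrm_complete[unfolded A.norm_complete_iff, rule_format, of "\<lambda>n. f (\<sigma> n)"] by blast
    have "\<exists>z\<in>f ` carrier B. nrm A (y \<ominus>\<^bsub>A\<^esub> z) < \<epsilon>" if \<epsilon>: "\<epsilon> > 0" for \<epsilon>
    proof -
      obtain n where "nrm A (f (\<sigma> n) \<ominus>\<^bsub>A\<^esub> y) < \<epsilon>"
        using lim \<epsilon> by (meson order_refl)
      then show ?thesis
        using \<sigma> y A.N_minus_commute[of y "f (\<sigma> n)"] by (intro bexI[of _ "f (\<sigma> n)"]) auto
    qed
    then have "y \<in> f ` carrier B" using sub y by blast
    then obtain x where x: "x \<in> carrier B" "y = f x" by blast
    show "\<exists>x\<in>carrier B. \<forall>\<epsilon>>0. \<exists>n0. \<forall>n\<ge>n0. nrm B (\<sigma> n \<ominus>\<^bsub>B\<^esub> x) < \<epsilon>"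
      using lim \<sigma> x by (intro bexI[of _ x]) (simp_all add: nrm minus)
  qed
  note simps = nrm ops A.mult_assoc A.mult_add_left A.mult_add_right A.mult_smult_left
    A.mult_smult_right A.adj_add A.adj_smult A.adj_mult A.N_triangle A.N_smult A.nrm_mult
    A.cstar_identity
  show ?thesis
  proof (intro cstar_algebra.intro module cstar_algebra_axioms.intro)
    show "nrm B x = 0 \<longleftrightarrow> x = \<zero>\<^bsub>B\<^esub>" if "x \<in> carrier B" for x
      using that by (rule B.N_eq_0)
  qed ((rule complete | (rule eqI; simp add: simps; fail) | (simp add: simps; fail))+)
qed


text \<open>A point of \<open>A\<close> that is a limit of points of \<open>f ` D\<close> lies in the closed image of \<open>B\<close> first, and then its preimage
  is a limit of points of \<open>D\<close>.\<close>
lemma image_cstar_subalgebra: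
  assumes "cstar_subalgebra B D"
  shows "cstar_subalgebra A (f ` D)"
proof -
  note D = assms[unfolded cstar_subalgebra_iff[OF domain_cstar_algebra]]
  have mem_D: "x \<in> carrier B" if "x \<in> D" for x using that D by blast
  have closed: "x \<in> f ` D" if x: "x \<in> carrier A" and approx: "\<forall>\<epsilon>>0. \<exists>y\<in>f ` D. nrm A (x \<ominus>\<^bsub>A\<^esub> y) < \<epsilon>" for x
  proof -
    have "\<forall>\<epsilon>>0. \<exists>y\<in>f ` carrier B. nrm A (x \<ominus>\<^bsub>A\<^esub> y) < \<epsilon>"
      using approx mem_D by blast
    then obtain x' where x': "x' \<in> carrier B" "x = f x'"
      using x image_subalgebra by blast
    have "\<exists>y\<in>D. nrm B (x' \<ominus>\<^bsub>B\<^esub> y) < \<epsilon>" if \<epsilon>: "\<epsilon> > 0" for \<epsilon>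
    proof -
      obtain y where "y \<in> D" "nrm A (x \<ominus>\<^bsub>A\<^esub> f y) < \<epsilon>" using approx \<epsilon> by blast
      then show ?thesis
        using x' mem_D module.axioms(2)[OF domain_module]
        by (intro bexI[of _ y]) (simp_all add: nrm map_minus abelian_group.minus_closed)
    qed
    then show ?thesis using D x' by blast
  qed
  have "f x \<oplus>\<^bsub>A\<^esub> f y \<in> f ` D" "f x \<otimes>\<^bsub>A\<^esub> f y \<in> f ` D" "c \<odot>\<^bsub>A\<^esub> f x \<in> f ` D" "adj A (f x) \<in> f ` D"
    if "x \<in> D" "y \<in> D" for x y c
    using add[of x y] mult[of x y] smult[of x c] adj[of x] D that mem_D
    by (metis imageI)+
  moreover have "\<zero>\<^bsub>A\<^esub> \<in> f ` D" using D zero by (metis imageI)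
  ultimately show ?thesis
    unfolding cstar_subalgebra_iff[OF A.cstar_algebra_axioms] using closed mem_D by (auto simp: subset_iff)
qed

end

lemma unital_cstar_algebraI:
  assumes "cstar_algebra B" "\<one>\<^bsub>B\<^esub> \<in> carrier B"
    and "\<And>x. x \<in> carrier B \<Longrightarrow> \<one>\<^bsub>B\<^esub> \<otimes>\<^bsub>B\<^esub> x = x" "\<And>x. x \<in> carrier B \<Longrightarrow> x \<otimes>\<^bsub>B\<^esub> \<one>\<^bsub>B\<^esub> = x"
  shows "unital_cstar_algebra B"
proof -
  interpret cstar_algebra B by fact
  show ?thesis
    by (intro unital_cstar_algebra.intro assms(1) Group.monoid.intro) (use assms in \<open>auto simp: mult_assoc\<close>)
qed

text \<open>The update of \<open>one\<close> serves corners, whose unit is not that of \<open>A\<close>.\<close>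
lemma cstar_algebra_restrict:
  assumes "cstar_algebra A" "cstar_subalgebra A D"
  shows "cstar_algebra (A\<lparr>carrier := D, one := u\<rparr>)"
proof -
  note sub = assms(2)[unfolded cstar_subalgebra_iff[OF assms(1)]]
  show ?thesis
    by (rule cstar_embedding.domain_cstar_algebra[where f = "\<lambda>x. x"],
        intro cstar_embedding.intro cstar_embedding_axioms.intro assms(1))
      (simp_all add: sub assms image_def)
qed

text \<open>The relations \<open>ux = x = xu\<close> are preserved by limits because multiplication by \<open>u\<close> does not increase the
  norm.\<close>
lemma cstar_subalgebra_corner:
  assumes "cstar_algebra A" "projection A u"
  shows "cstar_subalgebra A {x \<in> carrier A. u \<otimes>\<^bsub>A\<^esub> x = x \<and> x \<otimes>\<^bsub>A\<^esub> u = x}" (is "cstar_subalgebra A ?D")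
proof -
  interpret cstar_algebra A by fact
  have u: "u \<in> carrier A" "adj A u = u" and nrm_u: "nrm A u \<le> 1"
    using assms(2) projection_nrm_le_1 by (auto simp: projection_def)
  have closed: "x \<in> ?D" if x: "x \<in> carrier A" and approx: "\<forall>\<epsilon>>0. \<exists>y\<in>?D. nrm A (x \<ominus>\<^bsub>A\<^esub> y) < \<epsilon>" for x
  proof -
    have small: "nrm A (u \<otimes>\<^bsub>A\<^esub> x \<ominus>\<^bsub>A\<^esub> x) \<le> 2 * \<epsilon> \<and> nrm A (x \<otimes>\<^bsub>A\<^esub> u \<ominus>\<^bsub>A\<^esub> x) \<le> 2 * \<epsilon>" if "\<epsilon> > 0" for \<epsilon>
    proof -
      obtain y where y: "y \<in> carrier A" "u \<otimes>\<^bsub>A\<^esub> y = y" "y \<otimes>\<^bsub>A\<^esub> u = y" "nrm A (x \<ominus>\<^bsub>A\<^esub> y) < \<epsilon>"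
        using approx \<open>\<epsilon> > 0\<close> by blast
      have "nrm A (u \<otimes>\<^bsub>A\<^esub> x \<ominus>\<^bsub>A\<^esub> y) = nrm A (u \<otimes>\<^bsub>A\<^esub> (x \<ominus>\<^bsub>A\<^esub> y))"
        using u x y by (simp add: mult_minus_right)
      also have "\<dots> \<le> 1 * nrm A (x \<ominus>\<^bsub>A\<^esub> y)"
        using u x y nrm_u by (intro order_trans[OF nrm_mult] mult_right_mono) auto
      finally have l: "nrm A (u \<otimes>\<^bsub>A\<^esub> x \<ominus>\<^bsub>A\<^esub> y) \<le> \<epsilon>" using y(4) by simp
      have "nrm A (x \<otimes>\<^bsub>A\<^esub> u \<ominus>\<^bsub>A\<^esub> y) = nrm A ((x \<ominus>\<^bsub>A\<^esub> y) \<otimes>\<^bsub>A\<^esub> u)"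
        using u x y by (simp add: mult_minus_left)
      also have "\<dots> \<le> nrm A (x \<ominus>\<^bsub>A\<^esub> y) * 1"
        using u x y nrm_u by (intro order_trans[OF nrm_mult] mult_left_mono) auto
      finally have r: "nrm A (x \<otimes>\<^bsub>A\<^esub> u \<ominus>\<^bsub>A\<^esub> y) \<le> \<epsilon>" using y(4) by simp
      have "nrm A (y \<ominus>\<^bsub>A\<^esub> x) < \<epsilon>" using y x N_minus_commute[of x y] by simp
      with l r show ?thesis
        using N_minus_triangle[of "u \<otimes>\<^bsub>A\<^esub> x" y x] N_minus_triangle[of "x \<otimes>\<^bsub>A\<^esub> u" y x] u x y by simp
    qed
    then show ?thesis
      using eq_if_arbitrarily_close[of "u \<otimes>\<^bsub>A\<^esub> x" x 2] eq_if_arbitrarily_close[of "x \<otimes>\<^bsub>A\<^esub> u" x 2] u x by simp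
  qed
  have "u \<otimes>\<^bsub>A\<^esub> adj A x = adj A x" "adj A x \<otimes>\<^bsub>A\<^esub> u = adj A x" if "x \<in> ?D" for x
    using adj_mult[of x u] adj_mult[of u x] that u by auto
  moreover have "u \<otimes>\<^bsub>A\<^esub> (x \<otimes>\<^bsub>A\<^esub> y) = x \<otimes>\<^bsub>A\<^esub> y" if "x \<in> ?D" "y \<in> ?D" for x y
    using mult_assoc[of u x y] that u by auto
  ultimately show ?thesis
    unfolding cstar_subalgebra_iff[OF assms(1)] using closed u
    by (auto simp: mult_assoc mult_add_left mult_add_right mult_smult_left mult_smult_right)
qed


section \<open>Automatic continuity of *-homomorphisms\<close>

text \<open>The element \<open>k\<close> is \<open>1 - sqrt (1 - h\<^sup>2)\<close>; in these terms \<open>(1 - k)\<^sup>2 = 1 - h\<^sup>2\<close> reads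
  \<open>h\<^sup>2 + k\<^sup>2 = 2k\<close>, which makes sense without a unit. It is the fixed point of
  \<open>F k = (h\<^sup>2 + k\<^sup>2) / 2\<close>. On the ball of radius \<open>r = \<parallel>h\<parallel> < 1\<close> the map \<open>F\<close> contracts by the factor
  \<open>r\<close>, since \<open>k\<^sup>2 - l\<^sup>2 = k (k - l) + (k - l) l\<close>.\<close>
lemma (in cstar_algebra) self_adjoint_half_angle:
  assumes h: "h \<in> carrier A" "adj A h = h" and lt: "nrm A h < 1"
  obtains k where "k \<in> carrier A" "adj A k = k" "h \<otimes> k = k \<otimes> h" "h \<otimes> h \<oplus> k \<otimes> k = 2 \<odot> k"
proof -
  define r where "r = nrm A h"
  have r: "0 \<le> r" "r < 1" using h lt by (simp_all add: r_def)
  define F where "F k = (1/2) \<odot> (h \<otimes> h \<oplus> k \<otimes> k)" for k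
  let ?M = "{k \<in> carrier A. nrm A k \<le> r}"
  have F [simp]: "F k \<in> carrier A" if "k \<in> carrier A" for k
    using that h by (simp add: F_def)
  have F_minus: "nrm A (F k \<ominus> F l) \<le> r * nrm A (k \<ominus> l)"
    if kl: "k \<in> ?M" "l \<in> ?M" for k l
  proof -
    have "F k \<ominus> F l = (1/2) \<odot> ((h \<otimes> h \<oplus> k \<otimes> k) \<ominus> (h \<otimes> h \<oplus> l \<otimes> l))"
      using kl h unfolding F_def by (intro smult_minus_vec[symmetric]) auto
    also have "\<dots> = (1/2) \<odot> (k \<otimes> k \<ominus> l \<otimes> l)"
      using kl h by (simp add: add_minus_add)
    finally have "nrm A (F k \<ominus> F l) = nrm A (k \<otimes> k \<ominus> l \<otimes> l) / 2"
      using kl by (simp add: nrm_smult)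
    also have "\<dots> \<le> (nrm A k * nrm A (k \<ominus> l) + nrm A (k \<ominus> l) * nrm A l) / 2"
      using kl nrm_mult_minus_mult[of k k l l] by simp
    also have "\<dots> \<le> (r * nrm A (k \<ominus> l) + nrm A (k \<ominus> l) * r) / 2"
      using kl by (intro divide_right_mono add_mono mult_right_mono mult_left_mono) auto
    finally show ?thesis by simp
  qed
  have F_ball: "F k \<in> ?M" if k: "k \<in> ?M" for k
  proof -
    have "nrm A (F k) = nrm A (h \<otimes> h \<oplus> k \<otimes> k) / 2"
      using k h by (simp add: F_def nrm_smult)
    also have "\<dots> \<le> (nrm A h * nrm A h + nrm A k * nrm A k) / 2"
      using k h by (intro divide_right_mono order_trans[OF nrm_triangle] add_mono nrm_mult) auto
    also have "\<dots> \<le> (1 * r + 1 * r) / 2"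
      using k h r by (intro divide_right_mono add_mono mult_mono) (auto simp: r_def)
    finally show ?thesis using k by simp
  qed
  have "closedin (norm_topology A (nrm A)) ?M"
    unfolding closedin_iff
  proof (intro conjI ballI impI)
    fix x assume x: "x \<in> carrier A" and approx: "\<forall>\<epsilon>>0. \<exists>y\<in>?M. nrm A (x \<ominus> y) < \<epsilon>"
    have "nrm A x \<le> r + \<epsilon>" if \<epsilon>: "\<epsilon> > 0" for \<epsilon>
    proof -
      obtain y where "y \<in> carrier A" "nrm A y \<le> r" "nrm A (x \<ominus> y) < \<epsilon>"
        using approx \<epsilon> by blast
      then show ?thesis
        using x nrm_triangle[of "x \<ominus> y" y] by (simp add: minus_add_cancel)
    qed
    then show "x \<in> ?M" using x field_le_epsilon[of "nrm A x" r] by simp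
  qed auto
  then have closed: "closedin Metric.mtopology ?M" .
  interpret S: Submetric "carrier A" "norm_dist A (nrm A)" ?M
    by unfold_locales auto
  have complete: "S.sub.mcomplete"
    using closed nrm_complete by (rule S.closedin_mcomplete_imp_mcomplete)
  have nonempty: "?M \<noteq> {}" using r by (auto intro!: exI[of _ \<zero>])
  have F_dist: "norm_dist A (nrm A) (F k) (F l) \<le> r * norm_dist A (nrm A) k l"
    if "k \<in> ?M" "l \<in> ?M" for k l
    using F_minus[of k l] that by (simp add: norm_dist_def)
  obtain k where k: "k \<in> ?M" "F k = k"
  proof (rule S.sub.Banach_fixedpoint_thm[OF complete nonempty _ r(2) F_dist])
    show "F \<in> ?M \<rightarrow> ?M" using F_ball by blast
  qed auto
  have kA: "k \<in> carrier A" using k by simp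
  \<comment> \<open>The norms of \<open>k\<^sup>* - k\<close> and of \<open>hk - kh\<close> turn out to be at most \<open>r\<close> times themselves: the
    first because \<open>k\<^sup>*\<close> is also a fixed point, the second because
    \<open>2 (hk - kh) = (hk - kh) k + k (hk - kh)\<close>.\<close>
  have zero: "x = y" if "x \<in> carrier A" "y \<in> carrier A" "nrm A (x \<ominus> y) \<le> r * nrm A (x \<ominus> y)" for x y
  proof -
    have "(1 - r) * nrm A (x \<ominus> y) \<le> 0" using that(3) by (simp add: algebra_simps)
    then have "nrm A (x \<ominus> y) \<le> 0" using r by (simp add: mult_le_0_iff)
    then show ?thesis
      using that nrm_nonneg[of "x \<ominus> y"] by (metis antisym nrm_eq_0 minus_closed minus_eq_0_iff)
  qed
  have "F (adj A k) = adj A (F k)"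
    using kA h by (simp add: F_def adj_smult adj_add adj_mult)
  then have "nrm A (adj A k \<ominus> k) \<le> r * nrm A (adj A k \<ominus> k)"
    using F_minus[of "adj A k" k] k by simp
  then have adj_k: "adj A k = k" using kA by (intro zero) auto
  have hk: "h \<otimes> k = (1/2) \<odot> (h \<otimes> (h \<otimes> h) \<oplus> h \<otimes> (k \<otimes> k))" 
    using kA h by (subst k(2)[symmetric]) (simp add: F_def mult_smult_right mult_add_right)
  have kh: "k \<otimes> h = (1/2) \<odot> (h \<otimes> (h \<otimes> h) \<oplus> k \<otimes> (k \<otimes> h))" 
    using kA h by (subst k(2)[symmetric]) (simp add: F_def mult_smult_left mult_add_left mult_assoc)
  have "h \<otimes> k \<ominus> k \<otimes> h = (1/2) \<odot> (h \<otimes> (k \<otimes> k) \<ominus> k \<otimes> (k \<otimes> h))"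
    by (subst hk, subst kh) (use kA h in \<open>simp add: add_minus_add flip: smult_minus_vec\<close>)
  also have "h \<otimes> (k \<otimes> k) \<ominus> k \<otimes> (k \<otimes> h) = (h \<otimes> k \<ominus> k \<otimes> h) \<otimes> k \<oplus> k \<otimes> (h \<otimes> k \<ominus> k \<otimes> h)"
    using kA h by (simp add: mult_minus_left mult_minus_right mult_assoc minus_trans)
  finally have eq: "h \<otimes> k \<ominus> k \<otimes> h =
      (1/2) \<odot> ((h \<otimes> k \<ominus> k \<otimes> h) \<otimes> k \<oplus> k \<otimes> (h \<otimes> k \<ominus> k \<otimes> h))" .
  have "nrm A (h \<otimes> k \<ominus> k \<otimes> h) =
      nrm A ((h \<otimes> k \<ominus> k \<otimes> h) \<otimes> k \<oplus> k \<otimes> (h \<otimes> k \<ominus> k \<otimes> h)) / 2"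
    using kA h by (subst eq) (simp add: nrm_smult)
  also have "\<dots> \<le> (nrm A (h \<otimes> k \<ominus> k \<otimes> h) * nrm A k + nrm A k * nrm A (h \<otimes> k \<ominus> k \<otimes> h)) / 2"
    using kA h by (intro divide_right_mono order_trans[OF nrm_triangle] add_mono nrm_mult) auto
  also have "\<dots> = nrm A k * nrm A (h \<otimes> k \<ominus> k \<otimes> h)"
    by simp
  also have "\<dots> \<le> r * nrm A (h \<otimes> k \<ominus> k \<otimes> h)"
    using k h by (intro mult_right_mono) auto
  finally have comm: "h \<otimes> k = k \<otimes> h" using kA h by (intro zero) auto
  have "2 \<odot> k = 2 \<odot> F k" using k by simp
  also have "\<dots> = h \<otimes> h \<oplus> k \<otimes> k" using kA h by (simp add: F_def smult_smult)
  finally show thesis using that[OF kA adj_k comm] by simp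
qed

text \<open>Think of \<open>w = h + \<i> (1 - k)\<close>. The hypotheses say that \<open>w\<^sup>*w = 1 = w w\<^sup>*\<close>, so left multiplication by \<open>w\<close> and by
  \<open>w\<^sup>*\<close> preserves norms (compare \<open>(wb)\<^sup>*(wb) = b\<^sup>*b\<close> with the C*-identity). Hence \<open>hb\<close>, the average of \<open>wb\<close>
  and \<open>w\<^sup>*b\<close>, has norm at most \<open>\<parallel>b\<parallel>\<close>, and \<open>b = h\<close> gives \<open>\<parallel>h\<parallel>\<^sup>2 \<le> \<parallel>h\<parallel>\<close>.\<close>
lemma (in cstar_algebra) nrm_le_1_if_half_angle:
  assumes h: "h \<in> carrier A" "adj A h = h" and k: "k \<in> carrier A" "adj A k = k"
    and comm: "h \<otimes> k = k \<otimes> h" and eq: "h \<otimes> h \<oplus> k \<otimes> k = 2 \<odot> k"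
  shows "nrm A h \<le> 1"
proof -
  have le: "nrm A (h \<otimes> b) \<le> nrm A b" if b: "b \<in> carrier A" for b
  proof -
    define x where "x = h \<otimes> b"
    define y where "y = b \<ominus> k \<otimes> b"
    let ?b = "adj A b"
    \<comment> \<open>With \<open>x\<close> and \<open>y\<close> as above, \<open>wb = x + \<i> y\<close>; the following are the monomials occurring in \<open>(wb)\<^sup>*(wb)\<close>.\<close>
    define p q r s t w where "p = ?b \<otimes> b" and "q = ?b \<otimes> (h \<otimes> b)" and "r = ?b \<otimes> (k \<otimes> b)"
      and "s = ?b \<otimes> (h \<otimes> (h \<otimes> b))" and "t = ?b \<otimes> (k \<otimes> (k \<otimes> b))" and "w = ?b \<otimes> (h \<otimes> (k \<otimes> b))"
    note defs = p_def q_def r_def s_def t_def w_def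
    have mem [simp]: "x \<in> carrier A" "y \<in> carrier A" "p \<in> carrier A" "q \<in> carrier A" "r \<in> carrier A"
      "s \<in> carrier A" "t \<in> carrier A" "w \<in> carrier A"
      using h k b by (simp_all add: x_def y_def defs)
    have adj_x: "adj A x = ?b \<otimes> h" and adj_y: "adj A y = ?b \<ominus> ?b \<otimes> k"
      using h k b by (simp_all add: x_def y_def adj_mult adj_minus)
    have w': "?b \<otimes> (k \<otimes> (h \<otimes> b)) = w"
    proof -
      have "?b \<otimes> (k \<otimes> (h \<otimes> b)) = ?b \<otimes> ((k \<otimes> h) \<otimes> b)" using h k b by (simp add: mult_assoc)
      then show ?thesis using h k b by (simp add: w_def mult_assoc flip: comm)
    qed
    have xx: "adj A x \<otimes> x = s" and xy: "adj A x \<otimes> y = q \<ominus> w"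
      and yx: "adj A y \<otimes> x = q \<ominus> w" and yy: "adj A y \<otimes> y = (p \<ominus> r) \<ominus> (r \<ominus> t)"
      using h k b w'
      by (simp_all add: adj_x adj_y mult_minus_left mult_minus_right mult_assoc) (simp_all add: x_def y_def defs mult_minus_left mult_minus_right mult_assoc)
    have st: "s \<oplus> t = 2 \<odot> r"
    proof -
      have "s \<oplus> t = ?b \<otimes> ((h \<otimes> h \<oplus> k \<otimes> k) \<otimes> b)"
        using h k b by (simp add: defs mult_add_left mult_add_right mult_assoc)
      also have "\<dots> = 2 \<odot> r"
        using h k b unfolding eq by (simp add: defs mult_smult_left mult_smult_right)
      finally show ?thesis .
    qed
    have "(p \<ominus> r) \<ominus> (r \<ominus> t) = p \<oplus> (t \<oplus> (-2) \<odot> r)"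
      using smult_add[of r "-1" "-1"] by (simp add: minus_eq smult_add_vec smult_smult M.a_ac)
    then have "s \<oplus> ((p \<ominus> r) \<ominus> (r \<ominus> t)) = p \<oplus> ((s \<oplus> t) \<oplus> (-2) \<odot> r)"
      by (simp add: M.a_ac)
    also have "\<dots> = p"
      unfolding st using smult_add[of r 2 "-2"] by simp
    finally have sum: "s \<oplus> ((p \<ominus> r) \<ominus> (r \<ominus> t)) = p" .
    \<comment> \<open>The two cases \<open>c = \<i>\<close> and \<open>c = -\<i>\<close> give \<open>wb\<close> and \<open>w\<^sup>*b\<close>.\<close>
    have norm: "nrm A (x \<oplus> c \<odot> y) = nrm A b" if c: "cnj c = -c" "c * c = -1" for c
    proof -
      have "adj A (x \<oplus> c \<odot> y) \<otimes> (x \<oplus> c \<odot> y) =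
          (s \<oplus> (-c) \<odot> (q \<ominus> w)) \<oplus> (c \<odot> (q \<ominus> w) \<oplus> ((p \<ominus> r) \<ominus> (r \<ominus> t)))"
        using c by (simp add: adj_add adj_smult mult_add_left mult_add_right mult_smult_left
            mult_smult_right smult_smult smult_add_vec xx xy yx yy)
      also have "\<dots> = (s \<oplus> ((p \<ominus> r) \<ominus> (r \<ominus> t))) \<oplus> (c \<odot> (q \<ominus> w) \<oplus> (-c) \<odot> (q \<ominus> w))"
        by (simp add: M.a_ac)
      also have "c \<odot> (q \<ominus> w) \<oplus> (-c) \<odot> (q \<ominus> w) = \<zero>"
        using smult_add[of "q \<ominus> w" c "-c"] by simp
      finally have "adj A (x \<oplus> c \<odot> y) \<otimes> (x \<oplus> c \<odot> y) = p"
        by (simp add: sum)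
      then have "(nrm A (x \<oplus> c \<odot> y))\<^sup>2 = (nrm A b)\<^sup>2"
        using cstar_identity[of b] cstar_identity[of "x \<oplus> c \<odot> y"] b by (simp add: p_def)
      then show ?thesis
        using b by (simp add: power2_eq_iff_nonneg)
    qed
    have "2 \<odot> x = (x \<oplus> x) \<oplus> (\<i> \<odot> y \<oplus> (-\<i>) \<odot> y)"
      using smult_add[of y \<i> "-\<i>"] smult_add[of x 1 1] by simp
    also have "\<dots> = (x \<oplus> \<i> \<odot> y) \<oplus> (x \<oplus> (-\<i>) \<odot> y)"
      by (simp add: M.a_ac)
    finally have "2 * nrm A x = nrm A ((x \<oplus> \<i> \<odot> y) \<oplus> (x \<oplus> (-\<i>) \<odot> y))"
      by (metis mem(1) nrm_smult norm_numeral)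
    also have "\<dots> \<le> nrm A b + nrm A b"
      using nrm_triangle[of "x \<oplus> \<i> \<odot> y" "x \<oplus> (-\<i>) \<odot> y"] norm[of \<i>] norm[of "-\<i>"] by simp
    finally show ?thesis by (simp add: x_def)
  qed
  have "nrm A h * nrm A h \<le> nrm A h * 1"
    using le[OF h(1)] cstar_identity[OF h(1)] h by (simp add: power2_eq_square)
  then show ?thesis
    using nrm_nonneg[OF h(1)] mult_le_cancel_left_pos[of "nrm A h" "nrm A h" 1]
    by (cases "nrm A h = 0") auto
qed

lemma star_hom_props:
  assumes "\<phi> \<in> star_hom A B"
  shows "x \<in> carrier A \<Longrightarrow> \<phi> x \<in> carrier B"
    "\<lbrakk>x \<in> carrier A; y \<in> carrier A\<rbrakk> \<Longrightarrow> \<phi> (x \<oplus>\<^bsub>A\<^esub> y) = \<phi> x \<oplus>\<^bsub>B\<^esub> \<phi> y"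
    "x \<in> carrier A \<Longrightarrow> \<phi> (c \<odot>\<^bsub>A\<^esub> x) = c \<odot>\<^bsub>B\<^esub> \<phi> x"
    "\<lbrakk>x \<in> carrier A; y \<in> carrier A\<rbrakk> \<Longrightarrow> \<phi> (x \<otimes>\<^bsub>A\<^esub> y) = \<phi> x \<otimes>\<^bsub>B\<^esub> \<phi> y"
    "x \<in> carrier A \<Longrightarrow> \<phi> (adj A x) = adj B (\<phi> x)"
  using assms by (auto simp: star_hom_def)

lemma star_hom_zero_minus:
  assumes "cstar_algebra A" "cstar_algebra B" "\<phi> \<in> star_hom A B"
  shows "\<phi> \<zero>\<^bsub>A\<^esub> = \<zero>\<^bsub>B\<^esub>"
    "\<lbrakk>x \<in> carrier A; y \<in> carrier A\<rbrakk> \<Longrightarrow> \<phi> (x \<ominus>\<^bsub>A\<^esub> y) = \<phi> x \<ominus>\<^bsub>B\<^esub> \<phi> y"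
proof -
  interpret A: cstar_algebra A by fact
  interpret B: cstar_algebra B by fact
  note \<phi> [simp] = star_hom_props[OF assms(3)]
  show "\<phi> \<zero>\<^bsub>A\<^esub> = \<zero>\<^bsub>B\<^esub>"
    using \<phi>(3)[of "\<zero>\<^bsub>A\<^esub>" 0] \<phi>(1)[of "\<zero>\<^bsub>A\<^esub>"] by (simp del: \<phi>)
  show "\<lbrakk>x \<in> carrier A; y \<in> carrier A\<rbrakk> \<Longrightarrow> \<phi> (x \<ominus>\<^bsub>A\<^esub> y) = \<phi> x \<ominus>\<^bsub>B\<^esub> \<phi> y"
    by (simp add: A.minus_eq B.minus_eq)
qed

text \<open>The equation between \<open>h\<close> and \<open>k\<close> is preserved by \<open>\<phi>\<close>, which bounds the images of self-adjoint elements of norm less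
  than 1. Scaling extends the bound to all self-adjoint elements, and the C*-identity to all elements.\<close>
theorem star_hom_contractive:
  assumes "cstar_algebra A" "cstar_algebra B" "\<phi> \<in> star_hom A B" "x \<in> carrier A"
  shows "nrm B (\<phi> x) \<le> nrm A x"
proof -
  interpret A: cstar_algebra A by fact
  interpret B: cstar_algebra B by fact
  note \<phi> = star_hom_props[OF assms(3)]
  have lt_1: "nrm B (\<phi> h) \<le> 1" if h: "h \<in> carrier A" "adj A h = h" "nrm A h < 1" for h
  proof -
    obtain k where k: "k \<in> carrier A" "adj A k = k" "h \<otimes>\<^bsub>A\<^esub> k = k \<otimes>\<^bsub>A\<^esub> h"
      "h \<otimes>\<^bsub>A\<^esub> h \<oplus>\<^bsub>A\<^esub> k \<otimes>\<^bsub>A\<^esub> k = 2 \<odot>\<^bsub>A\<^esub> k"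
      using A.self_adjoint_half_angle h by blast
    show ?thesis
    proof (rule B.nrm_le_1_if_half_angle)
      show "\<phi> h \<in> carrier B" "\<phi> k \<in> carrier B" using h k by (simp_all add: \<phi>)
      show "adj B (\<phi> h) = \<phi> h" "adj B (\<phi> k) = \<phi> k" using h k by (simp_all flip: \<phi>(5))
      show "\<phi> h \<otimes>\<^bsub>B\<^esub> \<phi> k = \<phi> k \<otimes>\<^bsub>B\<^esub> \<phi> h" using h k by (simp flip: \<phi>(4))
      show "\<phi> h \<otimes>\<^bsub>B\<^esub> \<phi> h \<oplus>\<^bsub>B\<^esub> \<phi> k \<otimes>\<^bsub>B\<^esub> \<phi> k = 2 \<odot>\<^bsub>B\<^esub> \<phi> k"
        using h k by (simp flip: \<phi>(2-4))
    qed
  qed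
  have self_adjoint: "nrm B (\<phi> h) \<le> nrm A h" if h: "h \<in> carrier A" "adj A h = h" for h
  proof (rule field_le_epsilon)
    fix e :: real assume "e > 0"
    define t where "t = nrm A h + e"
    have t: "t > 0" "nrm A h < t" using \<open>e > 0\<close> A.nrm_nonneg[OF h(1)] by (simp_all add: t_def)
    have "nrm B (\<phi> ((1 / of_real t) \<odot>\<^bsub>A\<^esub> h)) \<le> 1"
      using h t by (intro lt_1) (simp_all add: A.adj_smult A.nrm_smult norm_divide)
    then show "nrm B (\<phi> h) \<le> nrm A h + e"
      using h t by (simp add: \<phi> B.nrm_smult norm_divide t_def[symmetric])
  qed
  have "(nrm B (\<phi> x))\<^sup>2 = nrm B (\<phi> (adj A x \<otimes>\<^bsub>A\<^esub> x))"
    using assms(4) by (simp add: \<phi> B.cstar_identity)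
  also have "\<dots> \<le> nrm A (adj A x \<otimes>\<^bsub>A\<^esub> x)"
    using assms(4) by (intro self_adjoint) (simp_all add: A.adj_mult)
  also have "\<dots> = (nrm A x)\<^sup>2" using assms(4) by (rule A.cstar_identity)
  finally show ?thesis using assms(4) by (simp add: power2_le_iff_abs_le)
qed

text \<open>Contractivity is what makes the set closed.\<close>
lemma star_hom_equalizer:
  assumes A: "cstar_algebra A" and B: "cstar_algebra B"
    and \<phi>: "\<phi> \<in> star_hom A B" and \<psi>: "\<psi> \<in> star_hom A B"
  shows "cstar_subalgebra A {x \<in> carrier A. \<phi> x = \<psi> x}" (is "cstar_subalgebra A ?D")
proof -
  interpret A: cstar_algebra A by fact
  interpret B: cstar_algebra B by fact
  have "x \<in> ?D" if x: "x \<in> carrier A" and approx: "\<forall>\<epsilon>>0. \<exists>y\<in>?D. nrm A (x \<ominus>\<^bsub>A\<^esub> y) < \<epsilon>" for x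
  proof -
    have "nrm B (\<phi> x \<ominus>\<^bsub>B\<^esub> \<psi> x) \<le> 2 * \<epsilon>" if \<epsilon>: "\<epsilon> > 0" for \<epsilon>
    proof -
      obtain y where y: "y \<in> carrier A" "\<phi> y = \<psi> y" "nrm A (x \<ominus>\<^bsub>A\<^esub> y) < \<epsilon>"
        using approx \<epsilon> by blast
      have "nrm B (\<theta> x \<ominus>\<^bsub>B\<^esub> \<theta> y) < \<epsilon>" if "\<theta> \<in> star_hom A B" for \<theta>
        using star_hom_contractive[OF A B that, of "x \<ominus>\<^bsub>A\<^esub> y"] x y
          star_hom_zero_minus(2)[OF A B that, of x y] by simp
      from this[OF \<phi>] this[OF \<psi>] show ?thesis
        using B.N_minus_triangle[of "\<phi> x" "\<phi> y" "\<psi> x"] B.N_minus_commute[of "\<psi> x" "\<psi> y"] x y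
          star_hom_props(1)[OF \<phi>] star_hom_props(1)[OF \<psi>] by simp
    qed
    then have "\<phi> x = \<psi> x"
      using x star_hom_props(1)[OF \<phi>] star_hom_props(1)[OF \<psi>]
      by (intro B.eq_if_arbitrarily_close[of _ _ 2]) auto
    then show ?thesis using x by simp
  qed
  then show ?thesis
    unfolding cstar_subalgebra_iff[OF A]
    using star_hom_zero_minus(1)[OF A B \<phi>] star_hom_zero_minus(1)[OF A B \<psi>] star_hom_props[OF \<phi>] star_hom_props[OF \<psi>]
    by (auto simp: A.mult_closed A.adj_closed)
qed


section \<open>Bounded products of C*-algebras\<close>

text \<open>The family is indexed by a whole type, so that pointwise operations need no restriction to an
  index set and the supremum is never over the empty set.\<close>
definition cstar_product :: "('i \<Rightarrow> 'a cstar) \<Rightarrow> ('i \<Rightarrow> 'a) cstar" where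
  "cstar_product B =
     \<lparr>carrier = {x. (\<forall>i. x i \<in> carrier (B i)) \<and> (\<exists>C. \<forall>i. nrm (B i) (x i) \<le> C)},
      monoid.mult = (\<lambda>x y i. x i \<otimes>\<^bsub>B i\<^esub> y i), one = (\<lambda>i. \<one>\<^bsub>B i\<^esub>),
      ring.zero = (\<lambda>i. \<zero>\<^bsub>B i\<^esub>), add = (\<lambda>x y i. x i \<oplus>\<^bsub>B i\<^esub> y i),
      smult = (\<lambda>c x i. c \<odot>\<^bsub>B i\<^esub> x i), adj = (\<lambda>x i. adj (B i) (x i)),
      nrm = (\<lambda>x. SUP i. nrm (B i) (x i))\<rparr>"

lemma cstar_product_simps [simp]:
  "monoid.mult (cstar_product B) x y i = x i \<otimes>\<^bsub>B i\<^esub> y i"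
  "\<one>\<^bsub>cstar_product B\<^esub> i = \<one>\<^bsub>B i\<^esub>"
  "\<zero>\<^bsub>cstar_product B\<^esub> i = \<zero>\<^bsub>B i\<^esub>"
  "add (cstar_product B) x y i = x i \<oplus>\<^bsub>B i\<^esub> y i"
  "smult (cstar_product B) c x i = c \<odot>\<^bsub>B i\<^esub> x i"
  "adj (cstar_product B) x i = adj (B i) (x i)"
  by (simp_all add: cstar_product_def)

lemma cstar_product_carrier:
  "x \<in> carrier (cstar_product B) \<longleftrightarrow>
     (\<forall>i. x i \<in> carrier (B i)) \<and> (\<exists>C. \<forall>i. nrm (B i) (x i) \<le> C)"
  by (simp add: cstar_product_def)

lemma cstar_product_mem [simp]: "x \<in> carrier (cstar_product B) \<Longrightarrow> x i \<in> carrier (B i)"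
  by (simp add: cstar_product_carrier)

lemma nrm_le_cstar_product:
  assumes "x \<in> carrier (cstar_product B)"
  shows "nrm (B i) (x i) \<le> nrm (cstar_product B) x"
  using assms unfolding cstar_product_def by (auto intro!: cSUP_upper bdd_aboveI)

lemma cstar_product_nrm_le:
  assumes "\<And>i. nrm (B i) (x i) \<le> C"
  shows "nrm (cstar_product B) x \<le> C"
  using assms unfolding cstar_product_def by (auto intro!: cSUP_least)

lemma cstar_productI:
  assumes "\<And>i. x i \<in> carrier (B i)" "\<And>i. nrm (B i) (x i) \<le> C"
  shows "x \<in> carrier (cstar_product B)"
  using assms unfolding cstar_product_carrier by blast

text \<open>The axioms are checked factor by factor; the C*-identity survives the supremum because squaring is
  monotone. A Cauchy sequence converges in every factor, and the Cauchy estimate, being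
  uniform in the index, yields convergence in the supremum norm and boundedness of the limit.\<close>
theorem cstar_algebra_product:
  fixes B :: "'i \<Rightarrow> 'a cstar"
  assumes "\<And>i. cstar_algebra (B i)"
  shows "cstar_algebra (cstar_product B)"
proof -
  let ?P = "cstar_product B"
  interpret B: cstar_algebra "B i" for i by (rule assms)
  note mem = cstar_product_mem[of _ B]
  note le = nrm_le_cstar_product[of _ B]
  have zero: "\<zero>\<^bsub>?P\<^esub> \<in> carrier ?P"
    by (rule cstar_productI[where C = 0]) simp_all
  have add: "x \<oplus>\<^bsub>?P\<^esub> y \<in> carrier ?P" if "x \<in> carrier ?P" "y \<in> carrier ?P" for x y
    by (rule cstar_productI[where C = "nrm ?P x + nrm ?P y"])
      (use that le in \<open>auto intro!: order_trans[OF B.nrm_triangle] add_mono\<close>)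
  have smult: "c \<odot>\<^bsub>?P\<^esub> x \<in> carrier ?P" if "x \<in> carrier ?P" for x c
    by (rule cstar_productI[where C = "cmod c * nrm ?P x"])
      (use that le in \<open>auto simp: B.nrm_smult intro!: mult_left_mono\<close>)
  have nonneg: "0 \<le> nrm ?P x" if "x \<in> carrier ?P" for x
    using le[OF that, of undefined] B.nrm_nonneg[OF mem[OF that], of undefined] by linarith
  have mult_le: "nrm (B i) (x i \<otimes>\<^bsub>B i\<^esub> y i) \<le> nrm ?P x * nrm ?P y"
    if "x \<in> carrier ?P" "y \<in> carrier ?P" for x y i
    using that le nonneg by (intro order_trans[OF B.nrm_mult] mult_mono) auto
  have mult: "x \<otimes>\<^bsub>?P\<^esub> y \<in> carrier ?P" if "x \<in> carrier ?P" "y \<in> carrier ?P" for x y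
    by (rule cstar_productI[where C = "nrm ?P x * nrm ?P y"])
      (use that mult_le in auto)
  have adj: "adj ?P x \<in> carrier ?P" if "x \<in> carrier ?P" for x
    by (rule cstar_productI[where C = "nrm ?P x"]) (use that le in auto)
  have module: "Module.module complex_field ?P"
  proof (rule moduleI)
    show "cring complex_field" by (rule complex_field_cring)
    show "abelian_group ?P"
    proof (rule abelian_groupI)
      fix x assume x: "x \<in> carrier ?P"
      have "(-1) \<odot>\<^bsub>B i\<^esub> x i \<oplus>\<^bsub>B i\<^esub> x i = \<zero>\<^bsub>B i\<^esub>" for i
        using x B.minus_eq[of "x i" i "x i"] by (simp add: B.a_comm)
      then show "\<exists>y\<in>carrier ?P. y \<oplus>\<^bsub>?P\<^esub> x = \<zero>\<^bsub>?P\<^esub>"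
        using x smult by (intro bexI[of _ "(-1) \<odot>\<^bsub>?P\<^esub> x"] ext) simp_all
    qed (use add zero in \<open>auto intro!: ext simp: B.a_ac\<close>)
  qed (use smult in \<open>auto intro!: ext simp: B.smult_add B.smult_add_vec B.smult_smult\<close>)
  interpret normed_space ?P "nrm ?P"
  proof (intro normed_space.intro module normed_space_axioms.intro)
    fix x c assume x: "x \<in> carrier ?P"
    show "0 \<le> nrm ?P x" using x by (rule nonneg)
    show "nrm ?P x = 0 \<longleftrightarrow> x = \<zero>\<^bsub>?P\<^esub>"
    proof
      assume "nrm ?P x = 0"
      then have "nrm (B i) (x i) = 0" for i
        using le[OF x, of i] B.nrm_nonneg[OF mem[OF x], of i] by simp
      then show "x = \<zero>\<^bsub>?P\<^esub>" using x by (intro ext) (simp add: B.N_eq_0)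
    next
      assume "x = \<zero>\<^bsub>?P\<^esub>"
      then have "nrm ?P x \<le> 0" by (intro cstar_product_nrm_le) simp
      then show "nrm ?P x = 0" using nonneg[OF x] by simp
    qed
    have "nrm ?P (c \<odot>\<^bsub>?P\<^esub> x) \<le> cmod c * nrm ?P x"
      using x le by (intro cstar_product_nrm_le) (auto simp: B.nrm_smult intro!: mult_left_mono)
    moreover have "cmod c * nrm ?P x \<le> nrm ?P (c \<odot>\<^bsub>?P\<^esub> x)"
    proof (cases "c = 0")
      case False
      have "nrm ?P x \<le> nrm ?P (c \<odot>\<^bsub>?P\<^esub> x) / cmod c"
      proof (rule cstar_product_nrm_le)
        show "nrm (B i) (x i) \<le> nrm ?P (c \<odot>\<^bsub>?P\<^esub> x) / cmod c" for i
          using le[OF smult[OF x, of c], of i] x False by (simp add: B.nrm_smult field_simps)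
      qed
      then show ?thesis using False by (simp add: field_simps)
    qed (use nonneg[OF smult[OF x]] in simp)
    ultimately show "nrm ?P (c \<odot>\<^bsub>?P\<^esub> x) = cmod c * nrm ?P x" by simp
  next
    fix x y assume "x \<in> carrier ?P" "y \<in> carrier ?P"
    then show "nrm ?P (x \<oplus>\<^bsub>?P\<^esub> y) \<le> nrm ?P x + nrm ?P y"
      using le by (intro cstar_product_nrm_le) (auto intro!: order_trans[OF B.nrm_triangle] add_mono)
  qed
  have minus: "(x \<ominus>\<^bsub>?P\<^esub> y) i = x i \<ominus>\<^bsub>B i\<^esub> y i" if "x \<in> carrier ?P" "y \<in> carrier ?P" for x y i
    using that by (simp add: minus_eq B.minus_eq)
  have complete: "norm_complete ?P (nrm ?P)"
    unfolding norm_complete_iff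
  proof (intro allI impI)
    fix \<sigma> :: "nat \<Rightarrow> 'i \<Rightarrow> 'a"
    assume "\<forall>n. \<sigma> n \<in> carrier ?P"
      and cauchy: "\<forall>\<epsilon>>0. \<exists>n0. \<forall>m\<ge>n0. \<forall>n\<ge>n0. nrm ?P (\<sigma> m \<ominus>\<^bsub>?P\<^esub> \<sigma> n) < \<epsilon>"
    then have \<sigma>: "\<sigma> n \<in> carrier ?P" for n by blast
    have uniform: "\<exists>n0. \<forall>m\<ge>n0. \<forall>n\<ge>n0. \<forall>i. nrm (B i) (\<sigma> m i \<ominus>\<^bsub>B i\<^esub> \<sigma> n i) < \<epsilon>"
      if \<epsilon>: "\<epsilon> > 0" for \<epsilon>
    proof -
      obtain n0 where n0: "\<forall>m\<ge>n0. \<forall>n\<ge>n0. nrm ?P (\<sigma> m \<ominus>\<^bsub>?P\<^esub> \<sigma> n) < \<epsilon>"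
        using cauchy \<epsilon> by blast
      have "nrm (B i) (\<sigma> m i \<ominus>\<^bsub>B i\<^esub> \<sigma> n i) < \<epsilon>" if "m \<ge> n0" "n \<ge> n0" for m n i
        using le[OF minus_closed[OF \<sigma>[of m] \<sigma>[of n]], of i] n0[rule_format, OF that]
        by (simp add: minus[OF \<sigma>[of m] \<sigma>[of n]])
      then show ?thesis by blast
    qed
    have "\<exists>y\<in>carrier (B i). \<forall>\<epsilon>>0. \<exists>n0. \<forall>n\<ge>n0. nrm (B i) (\<sigma> n i \<ominus>\<^bsub>B i\<^esub> y) < \<epsilon>" for i
    proof -
      have "\<forall>n. \<sigma> n i \<in> carrier (B i)" using \<sigma> by simp
      moreover have "\<forall>\<epsilon>>0. \<exists>n0. \<forall>m\<ge>n0. \<forall>n\<ge>n0. nrm (B i) (\<sigma> m i \<ominus>\<^bsub>B i\<^esub> \<sigma> n i) < \<epsilon>"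
        using uniform by blast
      ultimately show ?thesis
        using B.nrm_complete[of i, unfolded B.norm_complete_iff, rule_format, of "\<lambda>n. \<sigma> n i"] by blast
    qed
    then obtain y where y: "\<And>i. y i \<in> carrier (B i)"
      and lim: "\<And>i \<epsilon>. \<epsilon> > 0 \<Longrightarrow> \<exists>n0. \<forall>n\<ge>n0. nrm (B i) (\<sigma> n i \<ominus>\<^bsub>B i\<^esub> y i) < \<epsilon>"
      by metis
    have bound: "\<exists>n0. \<forall>n\<ge>n0. \<forall>i. nrm (B i) (\<sigma> n i \<ominus>\<^bsub>B i\<^esub> y i) \<le> \<epsilon>" if \<epsilon>: "\<epsilon> > 0" for \<epsilon>
    proof -
      obtain n0 where n0: "\<forall>m\<ge>n0. \<forall>n\<ge>n0. \<forall>i. nrm (B i) (\<sigma> m i \<ominus>\<^bsub>B i\<^esub> \<sigma> n i) < \<epsilon>"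
        using uniform \<epsilon> by blast
      have "nrm (B i) (\<sigma> n i \<ominus>\<^bsub>B i\<^esub> y i) \<le> \<epsilon>" if n: "n \<ge> n0" for n i
      proof (rule field_le_epsilon)
        fix e :: real assume "e > 0"
        from lim[OF this] obtain n1 where n1: "\<forall>n\<ge>n1. nrm (B i) (\<sigma> n i \<ominus>\<^bsub>B i\<^esub> y i) < e"
          by blast
        define m where "m = max n0 n1"
        have "nrm (B i) (\<sigma> n i \<ominus>\<^bsub>B i\<^esub> \<sigma> m i) < \<epsilon>" using n0 n by (simp add: m_def)
        moreover have "nrm (B i) (\<sigma> m i \<ominus>\<^bsub>B i\<^esub> y i) < e" using n1 by (simp add: m_def)
        ultimately show "nrm (B i) (\<sigma> n i \<ominus>\<^bsub>B i\<^esub> y i) \<le> \<epsilon> + e"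
          using B.N_minus_triangle[of "\<sigma> n i" i "\<sigma> m i" "y i"] \<sigma> y by simp
      qed
      then show ?thesis by blast
    qed
    have y_mem: "y \<in> carrier ?P"
    proof -
      obtain n0 where n0: "\<And>i. nrm (B i) (\<sigma> n0 i \<ominus>\<^bsub>B i\<^esub> y i) \<le> 1"
        using bound[of 1] by auto
      show ?thesis
      proof (rule cstar_productI[where C = "1 + nrm ?P (\<sigma> n0)"])
        show "nrm (B i) (y i) \<le> 1 + nrm ?P (\<sigma> n0)" for i
          using B.nrm_triangle[of "y i \<ominus>\<^bsub>B i\<^esub> \<sigma> n0 i" i "\<sigma> n0 i"] n0[of i] le[OF \<sigma>[of n0], of i] y \<sigma>
          by (simp add: B.minus_add_cancel B.N_minus_commute[of "\<sigma> n0 i" i "y i"])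
      qed (rule y)
    qed
    have "\<exists>n0. \<forall>n\<ge>n0. nrm ?P (\<sigma> n \<ominus>\<^bsub>?P\<^esub> y) < \<epsilon>" if \<epsilon>: "\<epsilon> > 0" for \<epsilon>
    proof -
      obtain n0 where n0: "\<forall>n\<ge>n0. \<forall>i. nrm (B i) (\<sigma> n i \<ominus>\<^bsub>B i\<^esub> y i) \<le> \<epsilon> / 2"
        using bound[of "\<epsilon> / 2"] \<epsilon> by auto
      have "nrm ?P (\<sigma> n \<ominus>\<^bsub>?P\<^esub> y) < \<epsilon>" if "n \<ge> n0" for n
        using cstar_product_nrm_le[of B "\<sigma> n \<ominus>\<^bsub>?P\<^esub> y" "\<epsilon> / 2"] n0 that \<epsilon> minus[OF \<sigma> y_mem] by simp
      then show ?thesis by blast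
    qed
    then show "\<exists>x\<in>carrier ?P. \<forall>\<epsilon>>0. \<exists>n0. \<forall>n\<ge>n0. nrm ?P (\<sigma> n \<ominus>\<^bsub>?P\<^esub> x) < \<epsilon>"
      using y_mem by blast
  qed
  have cstar_identity: "nrm ?P (adj ?P x \<otimes>\<^bsub>?P\<^esub> x) = (nrm ?P x)\<^sup>2" if x: "x \<in> carrier ?P" for x
  proof (rule antisym)
    have sq: "nrm (B i) (adj ?P x i \<otimes>\<^bsub>B i\<^esub> x i) = (nrm (B i) (x i))\<^sup>2" for i
      using x by (simp add: B.cstar_identity)
    show "nrm ?P (adj ?P x \<otimes>\<^bsub>?P\<^esub> x) \<le> (nrm ?P x)\<^sup>2"
      using sq le[OF x] x by (intro cstar_product_nrm_le) (simp add: power_mono)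
    have "nrm ?P x \<le> sqrt (nrm ?P (adj ?P x \<otimes>\<^bsub>?P\<^esub> x))"
    proof (rule cstar_product_nrm_le)
      show "nrm (B i) (x i) \<le> sqrt (nrm ?P (adj ?P x \<otimes>\<^bsub>?P\<^esub> x))" for i
        using sq[of i] le[OF mult[OF adj[OF x] x], of i] by (intro real_le_rsqrt) simp
    qed
    then have "(nrm ?P x)\<^sup>2 \<le> (sqrt (nrm ?P (adj ?P x \<otimes>\<^bsub>?P\<^esub> x)))\<^sup>2"
      using nonneg[OF x] by (rule power_mono)
    then show "(nrm ?P x)\<^sup>2 \<le> nrm ?P (adj ?P x \<otimes>\<^bsub>?P\<^esub> x)"
      using nonneg[OF mult[OF adj[OF x] x]] by simp
  qed
  have mult_nrm: "nrm ?P (x \<otimes>\<^bsub>?P\<^esub> y) \<le> nrm ?P x * nrm ?P y"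
    if "x \<in> carrier ?P" "y \<in> carrier ?P" for x y
    using mult_le[OF that] by (intro cstar_product_nrm_le) simp
  note simps = B.mult_assoc B.mult_add_left B.mult_add_right B.mult_smult_left
    B.mult_smult_right B.adj_add B.adj_smult B.adj_mult
  show ?thesis
  proof (intro cstar_algebra.intro module cstar_algebra_axioms.intro)
    fix x assume "x \<in> carrier ?P"
    then show "nrm ?P x = 0 \<longleftrightarrow> x = \<zero>\<^bsub>?P\<^esub>" by (rule N_eq_0)
  qed ((rule complete | (intro N_triangle N_smult mult_nrm cstar_identity nonneg mult adj; assumption)
      | (rule ext; simp add: simps; fail))+)
qed


section \<open>Generated subalgebras and their cardinality\<close>

definition cstar_generated :: "'a cstar \<Rightarrow> 'a set \<Rightarrow> 'a set" where
  "cstar_generated A X = \<Inter>{D. cstar_subalgebra A D \<and> X \<subseteq> D}"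

lemma cstar_generated_superset: "X \<subseteq> cstar_generated A X"
  by (auto simp: cstar_generated_def)

lemma cstar_generated_least: "\<lbrakk>cstar_subalgebra A D; X \<subseteq> D\<rbrakk> \<Longrightarrow> cstar_generated A X \<subseteq> D"
  by (auto simp: cstar_generated_def)

lemma cstar_subalgebra_carrier:
  assumes "cstar_algebra A" shows "cstar_subalgebra A (carrier A)"
proof -
  interpret cstar_algebra A by fact
  show ?thesis by (simp add: cstar_subalgebra_iff[OF assms])
qed

lemma cstar_subalgebra_generated:
  assumes A: "cstar_algebra A" and X: "X \<subseteq> carrier A"
  shows "cstar_subalgebra A (cstar_generated A X)"
proof -
  note iff = cstar_subalgebra_iff[OF A]
  have least: "cstar_generated A X \<subseteq> D" if "cstar_subalgebra A D" "X \<subseteq> D" for D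
    using that by (rule cstar_generated_least)
  have I: "x \<in> cstar_generated A X" if "\<And>D. \<lbrakk>cstar_subalgebra A D; X \<subseteq> D\<rbrakk> \<Longrightarrow> x \<in> D" for x
    using that by (auto simp: cstar_generated_def)
  show ?thesis
    unfolding iff
  proof (intro conjI ballI allI impI)
    show "cstar_generated A X \<subseteq> carrier A"
      using cstar_subalgebra_carrier[OF A] X by (rule cstar_generated_least)
  next
    fix x assume x: "x \<in> carrier A"
      and approx: "\<forall>\<epsilon>>0. \<exists>y\<in>cstar_generated A X. nrm A (x \<ominus>\<^bsub>A\<^esub> y) < \<epsilon>"
    show "x \<in> cstar_generated A X"
    proof (rule I)
      fix D assume D: "cstar_subalgebra A D" "X \<subseteq> D"
      have "\<forall>\<epsilon>>0. \<exists>y\<in>D. nrm A (x \<ominus>\<^bsub>A\<^esub> y) < \<epsilon>"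
        using approx least[OF D] by blast
      then show "x \<in> D" using D(1)[unfolded iff] x by blast
    qed
  qed (rule I; frule (1) least; simp add: iff subset_iff)+
qed

text \<open>The countable set \<open>D\<close> consists of the *-polynomials in \<open>X\<close> with coefficients from a countable dense subset \<open>Q\<close> of \<open>\<complex>\<close>.
  Its closure is a C*-subalgebra: closure under arbitrary scalars follows from the density of \<open>Q\<close>.\<close>
lemma cstar_generated_dense:
  assumes A: "cstar_algebra A" and X: "X \<subseteq> carrier A" "countable X"
  obtains D where "countable D" "D \<subseteq> carrier A"
    "\<And>x \<epsilon>. \<lbrakk>x \<in> cstar_generated A X; \<epsilon> > 0\<rbrakk> \<Longrightarrow> \<exists>d\<in>D. nrm A (x \<ominus>\<^bsub>A\<^esub> d) < \<epsilon>"
proof -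
  interpret cstar_algebra A by fact
  obtain Q :: "complex set" where Q: "countable Q"
    and dense: "\<And>U. \<lbrakk>open U; U \<noteq> {}\<rbrakk> \<Longrightarrow> \<exists>q\<in>Q. q \<in> U"
    using countable_dense_exists by blast
  define F where "F Y = Y \<union> (\<lambda>(x, y). x \<oplus>\<^bsub>A\<^esub> y) ` (Y \<times> Y) \<union> (\<lambda>(x, y). x \<otimes>\<^bsub>A\<^esub> y) ` (Y \<times> Y)
    \<union> (\<lambda>(c, y). c \<odot>\<^bsub>A\<^esub> y) ` (Q \<times> Y) \<union> adj A ` Y" for Y
  define D where "D = (\<Union>n. (F ^^ n) (insert \<zero>\<^bsub>A\<^esub> X))"
  have F_carrier: "F Y \<subseteq> carrier A" if "Y \<subseteq> carrier A" for Y
    using that unfolding F_def by (auto simp: subset_iff)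
  have F_countable: "countable (F Y)" if "countable Y" for Y
    using that Q unfolding F_def by (intro countable_Un countable_image countable_SIGMA)
  have iter: "(F ^^ n) (insert \<zero>\<^bsub>A\<^esub> X) \<subseteq> carrier A \<and> countable ((F ^^ n) (insert \<zero>\<^bsub>A\<^esub> X))" for n
    using X F_carrier F_countable by (induction n) auto
  have mono: "(F ^^ m) Y \<subseteq> (F ^^ n) Y" if "m \<le> n" for m n Y
    using lift_Suc_mono_le[of "\<lambda>n. (F ^^ n) Y" m n] that by (auto simp: F_def)
  have D_step: "F Y \<subseteq> D" if Y: "finite Y" "Y \<subseteq> D" for Y
  proof -
    obtain n where n: "Y \<subseteq> (F ^^ n) (insert \<zero>\<^bsub>A\<^esub> X)"
    proof -
      have "\<forall>y\<in>Y. \<exists>n. y \<in> (F ^^ n) (insert \<zero>\<^bsub>A\<^esub> X)"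
        using Y(2) unfolding D_def by blast
      from bchoice[OF this] obtain k where k: "\<And>y. y \<in> Y \<Longrightarrow> y \<in> (F ^^ k y) (insert \<zero>\<^bsub>A\<^esub> X)"
        by blast
      have "y \<in> (F ^^ Max (k ` Y)) (insert \<zero>\<^bsub>A\<^esub> X)" if "y \<in> Y" for y
        using k[OF that] mono[of "k y" "Max (k ` Y)"] Y(1) that by auto
      then show thesis using that by blast
    qed
    have "F Y \<subseteq> F ((F ^^ n) (insert \<zero>\<^bsub>A\<^esub> X))" using n unfolding F_def by fast
    also have "\<dots> = (F ^^ Suc n) (insert \<zero>\<^bsub>A\<^esub> X)" by simp
    also have "\<dots> \<subseteq> D" unfolding D_def by blast
    finally show ?thesis .
  qed
  have D_ops: "x \<oplus>\<^bsub>A\<^esub> y \<in> D" "x \<otimes>\<^bsub>A\<^esub> y \<in> D" "q \<in> Q \<Longrightarrow> q \<odot>\<^bsub>A\<^esub> x \<in> D" "adj A x \<in> D"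
    if "x \<in> D" "y \<in> D" for x y q
    using D_step[of "{x, y}"] that unfolding F_def by auto
  have D_X: "insert \<zero>\<^bsub>A\<^esub> X \<subseteq> D"
    unfolding D_def using UN_upper[of 0 UNIV "\<lambda>n. (F ^^ n) (insert \<zero>\<^bsub>A\<^esub> X)"] by simp
  have D: "D \<subseteq> carrier A" "countable D"
    unfolding D_def using iter by auto
  define H where "H = {x \<in> carrier A. \<forall>\<epsilon>>0. \<exists>d\<in>D. nrm A (x \<ominus>\<^bsub>A\<^esub> d) < \<epsilon>}"
  \<comment> \<open>Closure of \<open>H\<close> under an operation is checked with errors of the form \<open>C * \<delta>\<close>, \<open>\<delta>\<close> small.\<close>
  have H_I: "x \<in> H" if x: "x \<in> carrier A"
    and C: "\<And>\<delta>. \<lbrakk>0 < \<delta>; \<delta> \<le> 1\<rbrakk> \<Longrightarrow> \<exists>d\<in>D. nrm A (x \<ominus>\<^bsub>A\<^esub> d) \<le> C * \<delta>" for x C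
  proof -
    have "\<exists>d\<in>D. nrm A (x \<ominus>\<^bsub>A\<^esub> d) < \<epsilon>" if \<epsilon>: "\<epsilon> > 0" for \<epsilon>
    proof -
      define \<delta> where "\<delta> = min 1 (\<epsilon> / (\<bar>C\<bar> + 1))"
      have \<delta>: "0 < \<delta>" "\<delta> \<le> 1" "\<delta> \<le> \<epsilon> / (\<bar>C\<bar> + 1)" using \<epsilon> by (auto simp: \<delta>_def)
      obtain d where d: "d \<in> D" "nrm A (x \<ominus>\<^bsub>A\<^esub> d) \<le> C * \<delta>" using C[OF \<delta>(1,2)] by blast
      have "C * \<delta> < (\<bar>C\<bar> + 1) * \<delta>" using \<delta>(1) by (intro mult_strict_right_mono) auto
      also have "\<dots> \<le> \<epsilon>" using \<delta>(3) by (simp add: field_simps)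
      finally show ?thesis using d by (intro bexI[of _ d]) auto
    qed
    then show ?thesis using x by (simp add: H_def)
  qed
  have H_D: "\<exists>d\<in>D. d \<in> carrier A \<and> nrm A (x \<ominus>\<^bsub>A\<^esub> d) < \<delta>" if "x \<in> H" "\<delta> > 0" for x \<delta>
    using that D unfolding H_def by blast
  have H_carrier: "x \<in> carrier A" if "x \<in> H" for x using that by (simp add: H_def)
  have "cstar_subalgebra A H"
    unfolding cstar_subalgebra_iff[OF A]
  proof (intro conjI ballI allI impI)
    show "H \<subseteq> carrier A" by (auto simp: H_def)
    have "\<zero>\<^bsub>A\<^esub> \<in> D" using D_X by blast
    then show "\<zero>\<^bsub>A\<^esub> \<in> H" by (intro H_I[of _ 0]) (auto intro!: bexI[of _ "\<zero>\<^bsub>A\<^esub>"])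
  next
    fix x y assume xy: "x \<in> H" "y \<in> H"
    show "x \<oplus>\<^bsub>A\<^esub> y \<in> H"
    proof (rule H_I[of _ 2])
      fix \<delta> :: real assume "0 < \<delta>"
      obtain d e where "d \<in> D" "e \<in> D" "d \<in> carrier A" "e \<in> carrier A"
        "nrm A (x \<ominus>\<^bsub>A\<^esub> d) < \<delta>" "nrm A (y \<ominus>\<^bsub>A\<^esub> e) < \<delta>"
        using H_D[OF xy(1) \<open>0 < \<delta>\<close>] H_D[OF xy(2) \<open>0 < \<delta>\<close>] by blast
      then show "\<exists>d\<in>D. nrm A (x \<oplus>\<^bsub>A\<^esub> y \<ominus>\<^bsub>A\<^esub> d) \<le> 2 * \<delta>"
        using D_ops(1)[of d e] N_add_minus_add[of x y d e] H_carrier xy by (intro bexI[of _ "d \<oplus>\<^bsub>A\<^esub> e"]) auto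
    qed (use H_carrier xy in simp)
    show "x \<otimes>\<^bsub>A\<^esub> y \<in> H"
    proof (rule H_I[of _ "nrm A x + (nrm A y + 1)"])
      fix \<delta> :: real assume \<delta>: "0 < \<delta>" "\<delta> \<le> 1"
      obtain d e where de: "d \<in> D" "e \<in> D" "d \<in> carrier A" "e \<in> carrier A"
        "nrm A (x \<ominus>\<^bsub>A\<^esub> d) < \<delta>" "nrm A (y \<ominus>\<^bsub>A\<^esub> e) < \<delta>"
        using H_D[OF xy(1) \<open>0 < \<delta>\<close>] H_D[OF xy(2) \<open>0 < \<delta>\<close>] by blast
      have "nrm A e \<le> nrm A (e \<ominus>\<^bsub>A\<^esub> y) + nrm A y"
        using nrm_triangle[of "e \<ominus>\<^bsub>A\<^esub> y" y] de H_carrier[OF xy(2)] by (simp add: minus_add_cancel)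
      then have e: "nrm A e \<le> nrm A y + 1"
        using de \<delta> N_minus_commute[of y e] H_carrier[OF xy(2)] by simp
      have "nrm A (x \<otimes>\<^bsub>A\<^esub> y \<ominus>\<^bsub>A\<^esub> d \<otimes>\<^bsub>A\<^esub> e) \<le>
          nrm A x * nrm A (y \<ominus>\<^bsub>A\<^esub> e) + nrm A (x \<ominus>\<^bsub>A\<^esub> d) * nrm A e"
        using de H_carrier xy by (intro nrm_mult_minus_mult) auto
      also have "\<dots> \<le> nrm A x * \<delta> + \<delta> * (nrm A y + 1)"
        using de e \<delta> H_carrier xy by (intro add_mono mult_mono) auto
      finally show "\<exists>d\<in>D. nrm A (x \<otimes>\<^bsub>A\<^esub> y \<ominus>\<^bsub>A\<^esub> d) \<le> (nrm A x + (nrm A y + 1)) * \<delta>"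
        using D_ops(2)[of d e] de by (intro bexI[of _ "d \<otimes>\<^bsub>A\<^esub> e"]) (auto simp: algebra_simps)
    qed (use H_carrier xy in simp)
  next
    fix x c assume x: "x \<in> H"
    show "c \<odot>\<^bsub>A\<^esub> x \<in> H"
    proof (rule H_I[of _ "nrm A x + (cmod c + 1)"])
      fix \<delta> :: real assume \<delta>: "0 < \<delta>" "\<delta> \<le> 1"
      obtain q where q: "q \<in> Q" "cmod (c - q) < \<delta>"
        using dense[of "ball c \<delta>"] \<delta> by (auto simp: dist_norm)
      obtain d where d: "d \<in> D" "d \<in> carrier A" "nrm A (x \<ominus>\<^bsub>A\<^esub> d) < \<delta>"
        using H_D[OF x \<open>0 < \<delta>\<close>] by blast
      have q_le: "cmod q \<le> cmod c + 1"
        using norm_triangle_ineq4[of c "c - q"] q \<delta> by simp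
      have "nrm A (c \<odot>\<^bsub>A\<^esub> x \<ominus>\<^bsub>A\<^esub> q \<odot>\<^bsub>A\<^esub> d) \<le>
          nrm A (c \<odot>\<^bsub>A\<^esub> x \<ominus>\<^bsub>A\<^esub> q \<odot>\<^bsub>A\<^esub> x) + nrm A (q \<odot>\<^bsub>A\<^esub> x \<ominus>\<^bsub>A\<^esub> q \<odot>\<^bsub>A\<^esub> d)"
        using d H_carrier[OF x] by (intro N_minus_triangle) auto
      also have "\<dots> = cmod (c - q) * nrm A x + cmod q * nrm A (x \<ominus>\<^bsub>A\<^esub> d)"
        using d H_carrier[OF x] by (simp add: nrm_smult flip: smult_minus smult_minus_vec)
      also have "\<dots> \<le> \<delta> * nrm A x + (cmod c + 1) * \<delta>"
        using d q q_le \<delta> H_carrier[OF x] by (intro add_mono mult_mono) auto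
      finally show "\<exists>d\<in>D. nrm A (c \<odot>\<^bsub>A\<^esub> x \<ominus>\<^bsub>A\<^esub> d) \<le> (nrm A x + (cmod c + 1)) * \<delta>"
        using D_ops(3)[of d d q] d q by (intro bexI[of _ "q \<odot>\<^bsub>A\<^esub> d"]) (auto simp: algebra_simps)
    qed (use H_carrier x in simp)
  next
    fix x assume x: "x \<in> H"
    show "adj A x \<in> H"
    proof (rule H_I[of _ 1])
      fix \<delta> :: real assume "0 < \<delta>"
      obtain d where d: "d \<in> D" "d \<in> carrier A" "nrm A (x \<ominus>\<^bsub>A\<^esub> d) < \<delta>"
        using H_D[OF x \<open>0 < \<delta>\<close>] by blast
      then have "nrm A (adj A x \<ominus>\<^bsub>A\<^esub> adj A d) < \<delta>"
        using H_carrier[OF x] by (simp flip: adj_minus)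
      then show "\<exists>d\<in>D. nrm A (adj A x \<ominus>\<^bsub>A\<^esub> d) \<le> 1 * \<delta>"
        using D_ops(4) d by (intro bexI[of _ "adj A d"]) auto
    qed (use H_carrier x in simp)
  next
    fix x assume x: "x \<in> carrier A" and approx: "\<forall>\<epsilon>>0. \<exists>y\<in>H. nrm A (x \<ominus>\<^bsub>A\<^esub> y) < \<epsilon>"
    show "x \<in> H"
    proof (rule H_I[of _ 2])
      fix \<delta> :: real assume "0 < \<delta>"
      obtain y where y: "y \<in> H" "nrm A (x \<ominus>\<^bsub>A\<^esub> y) < \<delta>"
        using approx \<open>0 < \<delta>\<close> by blast
      obtain d where d: "d \<in> D" "d \<in> carrier A" "nrm A (y \<ominus>\<^bsub>A\<^esub> d) < \<delta>"
        using H_D[OF y(1) \<open>0 < \<delta>\<close>] by blast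
      then show "\<exists>d\<in>D. nrm A (x \<ominus>\<^bsub>A\<^esub> d) \<le> 2 * \<delta>"
        using N_minus_triangle[of x y d] x y H_carrier[OF y(1)] by (intro bexI[of _ d]) auto
    qed (rule x)
  qed
  moreover have "X \<subseteq> H"
  proof
    fix x assume "x \<in> X"
    then show "x \<in> H" using D_X X by (intro H_I[of _ 0]) (auto intro!: bexI[of _ x])
  qed
  ultimately have "cstar_generated A X \<subseteq> H" by (rule cstar_generated_least)
  then show thesis
    using that[of D] D unfolding H_def by blast
qed

text \<open>A separable metric space has at most as many points as there are sets of natural numbers.\<close>
lemma cstar_generated_lepoll_real:
  assumes A: "cstar_algebra A" and X: "X \<subseteq> carrier A" "countable X"
  shows "cstar_generated A X \<lesssim> (UNIV :: real set)"
proof -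
  interpret cstar_algebra A by fact
  obtain D where D: "countable D" "D \<subseteq> carrier A"
    and dense: "\<And>x \<epsilon>. \<lbrakk>x \<in> cstar_generated A X; \<epsilon> > 0\<rbrakk> \<Longrightarrow> \<exists>d\<in>D. nrm A (x \<ominus>\<^bsub>A\<^esub> d) < \<epsilon>"
    using cstar_generated_dense[OF A X] by blast
  have mem: "x \<in> carrier A" if "x \<in> cstar_generated A X" for x
    using that cstar_generated_least[OF cstar_subalgebra_carrier[OF A] X(1)] by blast
  \<comment> \<open>A point is determined by the set of balls of radius \<open>1 / (n + 1)\<close> around the points of \<open>D\<close>
    that contain it.\<close>
  define h where "h x = {prod_encode (n, to_nat_on D d) | n d. d \<in> D \<and> nrm A (x \<ominus>\<^bsub>A\<^esub> d) < 1 / (real n + 1)}" for x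
  have "inj_on h (cstar_generated A X)"
  proof (rule inj_onI)
    fix x y assume xy: "x \<in> cstar_generated A X" "y \<in> cstar_generated A X" and eq: "h x = h y"
    show "x = y"
    proof (rule eq_if_arbitrarily_close[where C = 2])
      fix \<epsilon> :: real assume "\<epsilon> > 0"
      then obtain n where n: "1 / (real n + 1) < \<epsilon>"
        using nat_approx_posE[of \<epsilon>] by (metis add.commute of_nat_Suc)
      obtain d where d: "d \<in> D" "nrm A (x \<ominus>\<^bsub>A\<^esub> d) < 1 / (real n + 1)"
        using dense[OF xy(1), of "1 / (real n + 1)"] by auto
      then have "prod_encode (n, to_nat_on D d) \<in> h x"
        unfolding h_def by blast
      then have "prod_encode (n, to_nat_on D d) \<in> h y" unfolding eq .
      then obtain d' where d': "d' \<in> D" "to_nat_on D d' = to_nat_on D d"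
        "nrm A (y \<ominus>\<^bsub>A\<^esub> d') < 1 / (real n + 1)"
        by (auto simp: h_def)
      have "d' = d" using d d' D(1) by simp
      then show "nrm A (x \<ominus>\<^bsub>A\<^esub> y) \<le> 2 * \<epsilon>"
        using N_minus_triangle[of x d y] N_minus_commute[of y d] d d' D(2) mem xy n by auto
    qed (use xy mem in auto)
  qed
  then have "cstar_generated A X \<lesssim> (UNIV :: nat set set)"
    unfolding lepoll_def by blast
  then show ?thesis
    using nat_sets_eqpoll_reals eqpoll_imp_lepoll lepoll_trans by blast
qed

definition cstar_transport :: "('a \<Rightarrow> 'b) \<Rightarrow> 'a set \<Rightarrow> 'a cstar \<Rightarrow> 'b cstar" where
  "cstar_transport g D A = (let f = inv_into D g in
     \<lparr>carrier = g ` D, monoid.mult = (\<lambda>x y. g (f x \<otimes>\<^bsub>A\<^esub> f y)), one = g \<one>\<^bsub>A\<^esub>,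
      ring.zero = g \<zero>\<^bsub>A\<^esub>, add = (\<lambda>x y. g (f x \<oplus>\<^bsub>A\<^esub> f y)), smult = (\<lambda>c x. g (c \<odot>\<^bsub>A\<^esub> f x)),
      adj = (\<lambda>x. g (adj A (f x))), nrm = (\<lambda>x. nrm A (f x))\<rparr>)"

lemma cstar_embedding_transport:
  assumes A: "cstar_algebra A" and D: "cstar_subalgebra A D" and inj: "inj_on g D"
  shows "cstar_embedding (inv_into D g) (cstar_transport g D A) A"
proof -
  note sub = D[unfolded cstar_subalgebra_iff[OF A]]
  have inv: "inv_into D g (g x) = x" if "x \<in> D" for x using inj that by simp
  have img: "inv_into D g ` g ` D = D" using inv by (force simp: image_image)
  show ?thesis
    by (intro cstar_embedding.intro cstar_embedding_axioms.intro A)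
      (auto simp: cstar_transport_def Let_def inv img D sub inj_on_inv_into)
qed

text \<open>A C*-subalgebra of the copy that contains the copied generators pulls back to a C*-subalgebra of \<open>A\<close> containing \<open>X\<close>,
  hence to the whole of the generated subalgebra.\<close>
lemma cstar_generated_by_transport:
  assumes A: "cstar_algebra A" and X: "X \<subseteq> carrier A" and inj_g: "inj_on g (cstar_generated A X)"
  shows "cstar_generated_by (cstar_transport g (cstar_generated A X) A) (g ` X)"
proof -
  let ?D = "cstar_generated A X"
  let ?f = "inv_into ?D g"
  let ?T = "cstar_transport g ?D A"
  have carrier: "carrier ?T = g ` ?D" by (simp add: cstar_transport_def Let_def)
  interpret cstar_embedding ?f ?T A
    using cstar_embedding_transport[OF A cstar_subalgebra_generated[OF A X] inj_g] .
  show ?thesis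
    unfolding cstar_generated_by_def
  proof (intro conjI allI impI; (elim conjE)?)
    show "g ` X \<subseteq> carrier ?T"
      using cstar_generated_superset[of X A] by (auto simp: carrier)
    fix E assume E: "cstar_subalgebra ?T E" "g ` X \<subseteq> E"
    have "X \<subseteq> ?f ` E"
    proof
      fix x assume "x \<in> X"
      then show "x \<in> ?f ` E"
        using E(2) cstar_generated_superset[of X A] inj_g
        by (intro image_eqI[of _ _ "g x"]) auto
    qed
    then have sub: "?D \<subseteq> ?f ` E"
      using image_cstar_subalgebra[OF E(1)] by (intro cstar_generated_least)
    have E_sub: "E \<subseteq> g ` ?D"
      using E(1) unfolding cstar_subalgebra_iff[OF domain_cstar_algebra] carrier by blast
    have "g x \<in> E" if x: "x \<in> ?D" for x
    proof -
      obtain y where "y \<in> E" "x = ?f y" using sub x by blast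
      then show ?thesis using E_sub by (auto simp: f_inv_into_f subset_iff)
    qed
    then show "E = carrier ?T" using E_sub by (auto simp: carrier)
  qed
qed


section \<open>Constructible right ideals\<close>

context right_LCM_semigroup
begin

lemma l_coset_l_coset:
  assumes "p \<in> carrier S" "q \<in> carrier S"
  shows "p <# (q <# carrier S) = (p \<otimes> q) <# carrier S"
  using assms by (simp add: l_coset_def m_assoc)

lemma mem_l_coset_self: "p \<in> carrier S \<Longrightarrow> p \<in> p <# carrier S"
  unfolding l_coset_def using r_one[of p] one_closed by blast

lemma l_coset_one [simp]: "\<one> <# carrier S = carrier S"
  by (simp add: l_coset_def)

lemma ideal_cases:
  assumes "X \<in> constructible_ideals S"
  obtains "X = {}" | p where "p \<in> carrier S" "X = p <# carrier S"
  using assms by (auto simp: constructible_ideals_def)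

lemma empty_ideal [simp]: "{} \<in> constructible_ideals S"
  by (simp add: constructible_ideals_def)

lemma principal_ideal [simp]: "p \<in> carrier S \<Longrightarrow> p <# carrier S \<in> constructible_ideals S"
  by (auto simp: constructible_ideals_def)

lemma carrier_ideal [simp]: "carrier S \<in> constructible_ideals S"
  using principal_ideal[OF one_closed] by simp

lemma l_coset_ideal:
  assumes p: "p \<in> carrier S" and X: "X \<in> constructible_ideals S"
  shows "p <# X \<in> constructible_ideals S"
  using X
proof (cases rule: ideal_cases)
  case 1
  then show ?thesis by (simp add: l_coset_def)
next
  case (2 q)
  then show ?thesis using p by (simp add: l_coset_l_coset)
qed

lemma inter_ideal:
  assumes X: "X \<in> constructible_ideals S" and Y: "Y \<in> constructible_ideals S"
  shows "X \<inter> Y \<in> constructible_ideals S"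
  using X
proof (cases rule: ideal_cases)
  case (2 p)
  note p = 2
  show ?thesis using Y
  proof (cases rule: ideal_cases)
    case (2 q)
    then show ?thesis
      using right_LCM[OF p(1) 2(1)] p by auto
  qed simp
qed simp

end

section \<open>Existence of the full semigroup C*-algebra\<close>

text \<open>The zero algebra is unital with \<open>1 = 0\<close>, so the relations of \<open>C\<^sup>*(S)\<close> hold in it. It provides a first representation in any type.\<close>
definition trivial_cstar :: "'a \<Rightarrow> 'a cstar" where
  "trivial_cstar a = \<lparr>carrier = {a}, monoid.mult = (\<lambda>_ _. a), one = a, ring.zero = a,
     add = (\<lambda>_ _. a), smult = (\<lambda>_ _. a), adj = (\<lambda>_. a), nrm = (\<lambda>_. 0)\<rparr>"

lemma cstar_algebra_trivial: "cstar_algebra (trivial_cstar a)"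
proof -
  have minus: "x \<ominus>\<^bsub>complex_cstar\<^esub> y = x - y" for x y
    by (rule minus_complex) simp_all
  have small: "(\<forall>\<epsilon>>0. cmod z < \<epsilon>) \<Longrightarrow> z = 0" for z
    by (metis less_irrefl zero_less_norm_iff)
  have "cstar_subalgebra complex_cstar {0}"
    unfolding cstar_subalgebra_iff[OF cstar_algebra_complex]
    by (auto simp: minus intro: small)
  then have "cstar_embedding (\<lambda>_. 0) (trivial_cstar a) complex_cstar"
    by (intro cstar_embedding.intro cstar_embedding_axioms.intro cstar_algebra_complex)
      (simp_all add: trivial_cstar_def)
  then show ?thesis by (rule cstar_embedding.domain_cstar_algebra)
qed

lemma semigroup_cstar_rep_trivial: "semigroup_cstar_rep S (trivial_cstar a) (\<lambda>_. a) (\<lambda>_. a)"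
proof -
  have "unital_cstar_algebra (trivial_cstar a)"
    by (intro unital_cstar_algebraI cstar_algebra_trivial) (simp_all add: trivial_cstar_def)
  then show ?thesis
    by (simp add: semigroup_cstar_rep_def isometry_def projection_def trivial_cstar_def)
qed

text \<open>The unit is a projection. Its norm is 0 in the zero algebra, hence the inequality.\<close>
lemma unital_nrm_one_le:
  assumes "unital_cstar_algebra A" shows "nrm A \<one>\<^bsub>A\<^esub> \<le> 1"
proof -
  interpret unital_cstar_algebra A by fact
  have "adj A \<one>\<^bsub>A\<^esub> = adj A \<one>\<^bsub>A\<^esub> \<otimes>\<^bsub>A\<^esub> adj A (adj A \<one>\<^bsub>A\<^esub>)" by simp
  also have "\<dots> = adj A (adj A \<one>\<^bsub>A\<^esub> \<otimes>\<^bsub>A\<^esub> \<one>\<^bsub>A\<^esub>)" by (subst adj_mult) simp_all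
  also have "\<dots> = \<one>\<^bsub>A\<^esub>" by simp
  finally show ?thesis by (intro projection_nrm_le_1) (simp add: projection_def)
qed

text \<open>The algebra is a copy, inside \<open>'u\<close>, of the subalgebra generated by the diagonal
  families \<open>w p\<close> and \<open>f X\<close> in the product of all representations. These families are bounded
  because isometries and projections have norm at most 1.\<close>
theorem full_semigroup_cstar_exists:
  fixes S :: "('s, 't) monoid_scheme"
  assumes S: "right_LCM_semigroup S" and countable: "countable (carrier S)"
    and universe: "\<exists>f :: real \<Rightarrow> 'u. inj f"
  shows "\<exists>(A :: 'u cstar) v e. full_semigroup_cstar S A v e"
proof -
  interpret S: right_LCM_semigroup S by fact
  define reps :: "('u cstar \<times> ('s \<Rightarrow> 'u) \<times> ('s set \<Rightarrow> 'u)) set"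
    where "reps = {(B, w, f). semigroup_cstar_rep S B w f}"
  define r0 where "r0 = (trivial_cstar (undefined :: 'u), (\<lambda>_::'s. undefined :: 'u), (\<lambda>_::'s set. undefined :: 'u))"
  have r0: "r0 \<in> reps" by (simp add: r0_def reps_def semigroup_cstar_rep_trivial)
  \<comment> \<open>The family runs over the whole type of triples; a triple that is not a representation is
    replaced by the zero representation, so every factor is one.\<close>
  define rep where "rep i = (if i \<in> reps then i else r0)" for i
  define B where "B i = fst (rep i)" for i
  define w where "w p i = fst (snd (rep i)) p" for p i
  define f where "f X i = snd (snd (rep i)) X" for X i
  have rep: "semigroup_cstar_rep S (B i) (\<lambda>p. w p i) (\<lambda>X. f X i)" for i
  proof -
    have "rep i \<in> reps" using r0 by (simp add: rep_def)
    then show ?thesis by (auto simp: reps_def B_def w_def f_def split: prod.splits)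
  qed
  have unital: "unital_cstar_algebra (B i)" for i
    using rep[of i] by (simp add: semigroup_cstar_rep_def)
  interpret B: unital_cstar_algebra "B i" for i by (rule unital)
  let ?P = "cstar_product B"
  have P: "cstar_algebra ?P" by (rule cstar_algebra_product) unfold_locales
  interpret P: cstar_algebra ?P by (rule P)
  let ?X = "w ` carrier S \<union> f ` constructible_ideals S"
  have w_mem: "w p \<in> carrier ?P" if p: "p \<in> carrier S" for p
  proof (rule cstar_productI)
    have "isometry (B i) (w p i)" for i using rep[of i] p by (simp add: semigroup_cstar_rep_def)
    then show "w p i \<in> carrier (B i)" "nrm (B i) (w p i) \<le> 1" for i
      using B.isometry_nrm_le_1 unital_nrm_one_le[OF unital] by (auto simp: isometry_def)
  qed
  have f_mem: "f X \<in> carrier ?P" if X: "X \<in> constructible_ideals S" for X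
  proof (rule cstar_productI)
    have "projection (B i) (f X i)" for i using rep[of i] X by (simp add: semigroup_cstar_rep_def)
    then show "f X i \<in> carrier (B i)" "nrm (B i) (f X i) \<le> 1" for i
      using B.projection_nrm_le_1 by (auto simp: projection_def)
  qed
  have X: "?X \<subseteq> carrier ?P" using w_mem f_mem by auto
  have "constructible_ideals S = insert {} ((\<lambda>p. p <#\<^bsub>S\<^esub> carrier S) ` carrier S)"
    by (auto simp: constructible_ideals_def)
  then have "countable ?X" using countable by simp
  then have "cstar_generated ?P ?X \<lesssim> (UNIV :: real set)"
    by (rule cstar_generated_lepoll_real[OF P X])
  then obtain h :: "_ \<Rightarrow> real" where "inj_on h (cstar_generated ?P ?X)"
    by (auto simp: lepoll_def)
  moreover obtain k :: "real \<Rightarrow> 'u" where "inj k" using universe by blast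
  ultimately have inj_g: "inj_on (k \<circ> h) (cstar_generated ?P ?X)"
    by (intro comp_inj_on) (auto intro: inj_on_subset)
  \<comment> \<open>\<open>g\<close> copies \<open>D\<close> into the target type, and \<open>u\<close> leads back.\<close>
  define g where "g = k \<circ> h"
  define D where "D = cstar_generated ?P ?X"
  define u where "u = inv_into D g"
  define T where "T = cstar_transport g D ?P"
  have inj: "inj_on g D" using inj_g by (simp add: g_def D_def)
  have sub: "cstar_subalgebra ?P D"
    unfolding D_def by (rule cstar_subalgebra_generated[OF P X])
  interpret emb: cstar_embedding u T ?P
    unfolding u_def T_def by (rule cstar_embedding_transport[OF P sub inj])
  have T: "cstar_algebra T" by (rule emb.domain_cstar_algebra)
  have u_g: "u (g x) = x" if "x \<in> D" for x using that inj by (simp add: u_def)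
  have g_mem: "g x \<in> carrier T" if "x \<in> D" for x
    using that by (simp add: T_def cstar_transport_def Let_def)
  have w_D: "w p \<in> D" if "p \<in> carrier S" for p
    using that cstar_generated_superset[of ?X ?P] by (auto simp: D_def)
  have f_D: "f X \<in> D" if "X \<in> constructible_ideals S" for X
    using that cstar_generated_superset[of ?X ?P] by (auto simp: D_def)
  have f_one: "f (carrier S) = \<one>\<^bsub>?P\<^esub>"
    using rep by (intro ext) (simp add: semigroup_cstar_rep_def)
  have one_T: "\<one>\<^bsub>T\<^esub> = g \<one>\<^bsub>?P\<^esub>" by (simp add: T_def cstar_transport_def Let_def)
  have one_D: "\<one>\<^bsub>?P\<^esub> \<in> D" using f_D[OF S.carrier_ideal] by (simp add: f_one)
  have unital_T: "unital_cstar_algebra T"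
  proof (intro unital_cstar_algebraI T)
    show one: "\<one>\<^bsub>T\<^esub> \<in> carrier T" unfolding one_T by (rule g_mem[OF one_D])
    fix x assume x: "x \<in> carrier T"
    show "\<one>\<^bsub>T\<^esub> \<otimes>\<^bsub>T\<^esub> x = x" "x \<otimes>\<^bsub>T\<^esub> \<one>\<^bsub>T\<^esub> = x"
      by (rule emb.eqI; use one x in \<open>simp add: emb.ops one_T u_g[OF one_D] fun_eq_iff\<close>)+
  qed
  have rep_T: "semigroup_cstar_rep S T (g \<circ> w) (g \<circ> f)"
  proof -
    note R = rep[unfolded semigroup_cstar_rep_def isometry_def projection_def]
    note s = emb.ops g_mem w_D f_D u_g one_T one_D
    note ideal = S.l_coset_ideal and inter = S.inter_ideal
    show ?thesis
      unfolding semigroup_cstar_rep_def isometry_def projection_def o_def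
    proof (intro conjI ballI unital_T)
      fix p assume p: "p \<in> carrier S"
      show "g (w p) \<in> carrier T" using p by (simp add: s)
      show "adj T (g (w p)) \<otimes>\<^bsub>T\<^esub> g (w p) = \<one>\<^bsub>T\<^esub>"
        by (rule emb.eqI) (use p R in \<open>simp_all add: s fun_eq_iff\<close>)
      fix q assume q: "q \<in> carrier S"
      show "g (w p) \<otimes>\<^bsub>T\<^esub> g (w q) = g (w (p \<otimes>\<^bsub>S\<^esub> q))"
        by (rule emb.eqI) (use p q R in \<open>simp_all add: s fun_eq_iff\<close>)
    next
      fix p X assume p: "p \<in> carrier S" and X: "X \<in> constructible_ideals S"
      show "g (w p) \<otimes>\<^bsub>T\<^esub> g (f X) \<otimes>\<^bsub>T\<^esub> adj T (g (w p)) = g (f (p <#\<^bsub>S\<^esub> X))"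
        by (rule emb.eqI) (use p X R ideal in \<open>simp_all add: s fun_eq_iff\<close>)
    next
      fix X assume X: "X \<in> constructible_ideals S"
      show "g (f X) \<in> carrier T" using X by (simp add: s)
      show "adj T (g (f X)) = g (f X)" "g (f X) \<otimes>\<^bsub>T\<^esub> g (f X) = g (f X)"
        by (rule emb.eqI; use X R in \<open>simp add: s fun_eq_iff\<close>)+
      fix Y assume Y: "Y \<in> constructible_ideals S"
      show "g (f X) \<otimes>\<^bsub>T\<^esub> g (f Y) = g (f (X \<inter> Y))"
        by (rule emb.eqI) (use X Y R inter in \<open>simp_all add: s fun_eq_iff\<close>)
    next
      note empty = S.empty_ideal
      show "g (f {}) = \<zero>\<^bsub>T\<^esub>"
        by (rule emb.eqI) (use empty R in \<open>simp_all add: s fun_eq_iff\<close>)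
      show "g (f (carrier S)) = \<one>\<^bsub>T\<^esub>" by (simp add: f_one one_T)
    qed
  qed
  have gen: "cstar_generated_by T ((g \<circ> w) ` carrier S \<union> (g \<circ> f) ` constructible_ideals S)"
    using cstar_generated_by_transport[OF P X inj[unfolded D_def]]
    by (simp add: T_def D_def image_Un image_comp)
  have "\<exists>\<phi>\<in>star_hom T B'. (\<forall>p\<in>carrier S. \<phi> ((g \<circ> w) p) = w' p) \<and>
      (\<forall>X\<in>constructible_ideals S. \<phi> ((g \<circ> f) X) = f' X)"
    if "semigroup_cstar_rep S B' w' f'" for B' :: "'u cstar" and w' f'
  proof -
    \<comment> \<open>A representation is its own index, so evaluation at it is the required map.\<close>
    define i where "i = (B', w', f')"
    have i: "B i = B'" "w p i = w' p" "f X i = f' X" for p X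
      using that by (simp_all add: B_def w_def f_def rep_def reps_def i_def)
    have "(\<lambda>x. u x i) \<in> star_hom T (B i)"
      by (simp add: star_hom_def emb.ops)
    then show ?thesis
      using i by (intro bexI[of _ "\<lambda>x. u x i"]) (simp_all add: u_g w_D f_D)
  qed
  then show ?thesis
    unfolding full_semigroup_cstar_def using rep_T gen by blast
qed


section \<open>Representations of the line system as isometries\<close>

text \<open>The families \<open>v\<^sub>p = \<psi>\<^sub>p(1)\<close> coming from representations of the line system. The algebra \<open>B\<close> need not be unital;
  \<open>v\<^sub>1\<close> replaces the unit in the requirement that \<open>v\<^sub>p\<close> be an isometry.\<close>
locale isometric_rep = right_LCM_semigroup S + B: cstar_algebra B
  for S :: "('s, 't) monoid_scheme" (structure) and B :: "'b cstar" +
  fixes v :: "'s \<Rightarrow> 'b"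
  assumes v_mem [simp]: "p \<in> carrier S \<Longrightarrow> v p \<in> carrier B"
    and v_mult: "\<lbrakk>p \<in> carrier S; q \<in> carrier S\<rbrakk> \<Longrightarrow> v p \<otimes>\<^bsub>B\<^esub> v q = v (p \<otimes> q)"
    and v_isometry: "p \<in> carrier S \<Longrightarrow> adj B (v p) \<otimes>\<^bsub>B\<^esub> v p = v \<one>"
begin

definition range_proj :: "'s \<Rightarrow> 'b" where
  "range_proj p = v p \<otimes>\<^bsub>B\<^esub> adj B (v p)"

lemma v_one_self_adjoint [simp]: "adj B (v \<one>) = v \<one>"
  using v_isometry[of \<one>] B.adj_mult[of "adj B (v \<one>)" "v \<one>"] by simp

lemma v_one_mult [simp]:
  assumes "p \<in> carrier S"
  shows "v \<one> \<otimes>\<^bsub>B\<^esub> v p = v p" "v p \<otimes>\<^bsub>B\<^esub> v \<one> = v p"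
    "v \<one> \<otimes>\<^bsub>B\<^esub> adj B (v p) = adj B (v p)" "adj B (v p) \<otimes>\<^bsub>B\<^esub> v \<one> = adj B (v p)"
proof -
  show l: "v \<one> \<otimes>\<^bsub>B\<^esub> v p = v p" and r: "v p \<otimes>\<^bsub>B\<^esub> v \<one> = v p"
    using assms by (simp_all add: v_mult)
  show "v \<one> \<otimes>\<^bsub>B\<^esub> adj B (v p) = adj B (v p)" "adj B (v p) \<otimes>\<^bsub>B\<^esub> v \<one> = adj B (v p)"
    using B.adj_mult[of "v p" "v \<one>"] B.adj_mult[of "v \<one>" "v p"] assms l r by simp_all
qed

lemma v_one_projection: "projection B (v \<one>)"
  by (simp add: projection_def)

lemma range_proj_mem [simp]: "p \<in> carrier S \<Longrightarrow> range_proj p \<in> carrier B"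
  by (simp add: range_proj_def)

lemma range_proj_projection: "p \<in> carrier S \<Longrightarrow> projection B (range_proj p)"
proof -
  assume p: "p \<in> carrier S"
  have "range_proj p \<otimes>\<^bsub>B\<^esub> range_proj p = v p \<otimes>\<^bsub>B\<^esub> ((adj B (v p) \<otimes>\<^bsub>B\<^esub> v p) \<otimes>\<^bsub>B\<^esub> adj B (v p))"
    using p by (simp add: range_proj_def B.mult_assoc)
  also have "\<dots> = range_proj p"
    using p by (simp only: v_isometry v_one_mult range_proj_def)
  finally show ?thesis
    using p by (simp add: projection_def) (simp add: range_proj_def B.adj_mult)
qed

lemma range_proj_conj:
  assumes "p \<in> carrier S" "q \<in> carrier S"
  shows "v p \<otimes>\<^bsub>B\<^esub> range_proj q \<otimes>\<^bsub>B\<^esub> adj B (v p) = range_proj (p \<otimes> q)"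
  using assms by (simp add: range_proj_def B.mult_assoc B.adj_mult flip: v_mult)

end

text \<open>Nica covariance in terms of the \<open>v\<^sub>p\<close>. A generator \<open>r\<close> of the intersection is not unique, and the
  condition for every choice of it makes \<open>range_proj r\<close> depend on the ideal only.\<close>
locale nica_isometric_rep = isometric_rep S B v
  for S :: "('s, 't) monoid_scheme" (structure) and B :: "'b cstar" and v :: "'s \<Rightarrow> 'b" +
  assumes range_proj_mult: "\<lbrakk>p \<in> carrier S; q \<in> carrier S; r \<in> carrier S;
        (p <# carrier S) \<inter> (q <# carrier S) = r <# carrier S\<rbrakk>
      \<Longrightarrow> range_proj p \<otimes>\<^bsub>B\<^esub> range_proj q = range_proj r"
    and range_proj_disjoint: "\<lbrakk>p \<in> carrier S; q \<in> carrier S;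
        (p <# carrier S) \<inter> (q <# carrier S) = {}\<rbrakk>
      \<Longrightarrow> range_proj p \<otimes>\<^bsub>B\<^esub> range_proj q = \<zero>\<^bsub>B\<^esub>"

lemma times_eq_iff: "(*) c = (*) d \<longleftrightarrow> c = d" for c d :: complex
  by (metis mult.right_neutral)

lemma compacts_complex_ops:
  defines "K \<equiv> compacts complex_cstar (standard_bimodule complex_cstar)"
  shows "add K ((*) c) ((*) d) = (*) (c + d)" "smult K c ((*) d) = (*) (c * d)"
    "monoid.mult K ((*) c) ((*) d) = (*) (c * d)" "adj K ((*) c) = (*) (cnj c)"
proof -
  let ?L = "adjointables complex_cstar (standard_bimodule complex_cstar)"
  have K: "add K = add ?L" "smult K = smult ?L" "monoid.mult K = monoid.mult ?L" "adj K = adj ?L"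
    by (simp_all add: K_def compacts_def)
  show "add K ((*) c) ((*) d) = (*) (c + d)" "smult K c ((*) d) = (*) (c * d)"
    unfolding K by (simp_all add: adjointables_complex)
  show "monoid.mult K ((*) c) ((*) d) = (*) (c * d)"
    unfolding K by (auto simp: adjointables_def compose_def mult.assoc)
  show "adj K ((*) c) = (*) (cnj c)"
    unfolding K by (auto simp: adjointables_def adjoint_pair_complex times_eq_iff intro!: the_equality)
qed

lemma rank_one_complex:
  "rank_one (standard_bimodule complex_cstar) \<xi> \<eta> = (*) (\<xi> * cnj \<eta>)"
  by (auto simp: rank_one_def mult.assoc)

context isometric_rep
begin

text \<open>The operator \<open>c\<close> on \<open>\<complex>\<close> is \<open>\<Theta>\<^bsub>c,1\<^esub>\<close>, so its image is forced to be \<open>(c v\<^sub>p) v\<^sub>p\<^sup>*\<close>; this does define a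
  homomorphism because \<open>v\<^sub>p v\<^sub>p\<^sup>*\<close> is a projection.\<close>
lemma compact_ext_line:
  assumes p: "p \<in> carrier S" and \<rho>: "\<And>c. \<rho> p c = c \<odot>\<^bsub>B\<^esub> v p"
  shows "compact_ext complex_line_system B \<rho> p ((*) c) = c \<odot>\<^bsub>B\<^esub> range_proj p"
proof -
  let ?K = "compacts complex_cstar (standard_bimodule complex_cstar)"
  define \<Phi> where "\<Phi> = (\<lambda>T\<in>range (*). T 1 \<odot>\<^bsub>B\<^esub> range_proj p)"
  have \<Phi>: "\<Phi> ((*) c) = c \<odot>\<^bsub>B\<^esub> range_proj p" for c by (simp add: \<Phi>_def)
  have range: "\<rho> p \<xi> \<otimes>\<^bsub>B\<^esub> adj B (\<rho> p \<eta>) = (\<xi> * cnj \<eta>) \<odot>\<^bsub>B\<^esub> range_proj p" for \<xi> \<eta>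
    using p by (simp add: \<rho> range_proj_def B.adj_smult B.mult_smult_left B.mult_smult_right
        B.smult_smult mult.commute)
  have E: "range_proj p \<otimes>\<^bsub>B\<^esub> range_proj p = range_proj p" "adj B (range_proj p) = range_proj p"
    using range_proj_projection[OF p] by (simp_all add: projection_def)
  have hom: "\<Phi> \<in> star_hom ?K B"
    unfolding star_hom_def compacts_complex
    using p by (auto simp: \<Phi> compacts_complex_ops B.smult_add B.smult_smult B.mult_smult_left
        B.mult_smult_right B.adj_smult E mult.commute)
  have "compact_ext complex_line_system B \<rho> p = \<Phi>"
    unfolding compact_ext_def complex_line_system_simps compacts_complex rank_one_complex
      standard_bimodule_complex_simps
  proof (rule the_equality)
    show "\<Phi> \<in> star_hom ?K B \<and> \<Phi> \<in> extensional (range (*)) \<and>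
        (\<forall>\<xi>\<in>UNIV. \<forall>\<eta>\<in>UNIV. \<Phi> ((*) (\<xi> * cnj \<eta>)) = \<rho> p \<xi> \<otimes>\<^bsub>B\<^esub> adj B (\<rho> p \<eta>))"
      using hom by (simp add: \<Phi> range) (simp add: \<Phi>_def)
    fix \<Psi> assume \<Psi>: "\<Psi> \<in> star_hom ?K B \<and> \<Psi> \<in> extensional (range (*)) \<and>
        (\<forall>\<xi>\<in>UNIV. \<forall>\<eta>\<in>UNIV. \<Psi> ((*) (\<xi> * cnj \<eta>)) = \<rho> p \<xi> \<otimes>\<^bsub>B\<^esub> adj B (\<rho> p \<eta>))"
    have "\<Psi> ((*) c) = \<Phi> ((*) c)" for c
    proof -
      have "\<Psi> ((*) (c * cnj 1)) = (c * cnj 1) \<odot>\<^bsub>B\<^esub> range_proj p"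
        using \<Psi>[THEN conjunct2, THEN conjunct2, rule_format, of c 1] range[of c 1] by simp
      then show ?thesis by (simp add: \<Phi>)
    qed
    then show "\<Psi> = \<Phi>"
      using \<Psi> by (intro extensionalityI[of _ "range (*)"]) (auto simp: \<Phi>_def)
  qed
  then show ?thesis by (simp add: \<Phi>)
qed

lemma iota_line:
  assumes "p \<in> carrier S" "r \<in> carrier S" "r <# carrier S \<subseteq> p <# carrier S"
  shows "iota S complex_line_system p r ((*) c) = (*) c"
proof -
  have "r \<in> p <# carrier S" using assms mem_l_coset_self by blast
  then obtain q where "q \<in> carrier S" "r = p \<otimes> q" by (auto simp: l_coset_def)
  then show ?thesis using iota_complex[of p S q c] assms by simp
qed

lemma compose_iota_line:
  assumes "p \<in> carrier S" "q \<in> carrier S" "r \<in> carrier S"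
    "(p <# carrier S) \<inter> (q <# carrier S) = r <# carrier S"
  shows "compose (carrier (fibre complex_line_system r))
      (iota S complex_line_system p r ((*) c)) (iota S complex_line_system q r ((*) d)) = (*) (c * d)"
proof -
  have "r <# carrier S \<subseteq> p <# carrier S" "r <# carrier S \<subseteq> q <# carrier S" using assms(4) by auto
  then show ?thesis using assms by (auto simp: iota_line compose_def mult.assoc)
qed

end

lemma nica_covariant_rep_line:
  assumes "nica_isometric_rep S B v"
  shows "nica_covariant_rep S complex_line_system B (\<lambda>p c. c \<odot>\<^bsub>B\<^esub> v p)"
proof -
  interpret nica_isometric_rep S B v by fact
  have hom: "(\<lambda>c. c \<odot>\<^bsub>B\<^esub> v \<one>\<^bsub>S\<^esub>) \<in> star_hom complex_cstar B"
    by (auto simp: star_hom_def B.smult_add B.smult_smult B.mult_smult_left B.mult_smult_right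
        B.adj_smult mult.commute)
  have rep: "prod_system_rep S complex_line_system B (\<lambda>p c. c \<odot>\<^bsub>B\<^esub> v p)"
    unfolding prod_system_rep_def complex_line_system_simps standard_bimodule_complex_simps
    using hom B.cstar_algebra_axioms
    by (auto simp: B.smult_add B.smult_smult B.mult_smult_left B.mult_smult_right
        B.adj_smult v_mult v_isometry mult.commute)
  have mult: "compact_ext complex_line_system B (\<lambda>p c. c \<odot>\<^bsub>B\<^esub> v p) p T \<otimes>\<^bsub>B\<^esub>
        compact_ext complex_line_system B (\<lambda>p c. c \<odot>\<^bsub>B\<^esub> v p) q R =
      compact_ext complex_line_system B (\<lambda>p c. c \<odot>\<^bsub>B\<^esub> v p) r
        (compose (carrier (fibre complex_line_system r))
          (iota S complex_line_system p r T) (iota S complex_line_system q r R))"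
    if pqr: "p \<in> carrier S" "q \<in> carrier S" "r \<in> carrier S"
      "(p <#\<^bsub>S\<^esub> carrier S) \<inter> (q <#\<^bsub>S\<^esub> carrier S) = r <#\<^bsub>S\<^esub> carrier S"
      and TR: "T \<in> range (*)" "R \<in> range (*)" for p q r T R
  proof -
    obtain c d where "T = (*) c" "R = (*) d" using TR by blast
    then show ?thesis
      using pqr by (simp add: compact_ext_line compose_iota_line[OF pqr] range_proj_mult[OF pqr, symmetric]
          B.mult_smult_left B.mult_smult_right B.smult_smult mult.commute del: complex_line_system_simps)
  qed
  have disjoint: "compact_ext complex_line_system B (\<lambda>p c. c \<odot>\<^bsub>B\<^esub> v p) p T \<otimes>\<^bsub>B\<^esub>
        compact_ext complex_line_system B (\<lambda>p c. c \<odot>\<^bsub>B\<^esub> v p) q R = \<zero>\<^bsub>B\<^esub>"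
    if pq: "p \<in> carrier S" "q \<in> carrier S" "(p <#\<^bsub>S\<^esub> carrier S) \<inter> (q <#\<^bsub>S\<^esub> carrier S) = {}"
      and TR: "T \<in> range (*)" "R \<in> range (*)" for p q T R
  proof -
    obtain c d where "T = (*) c" "R = (*) d" using TR by blast
    then show ?thesis
      using pq by (simp add: compact_ext_line range_proj_disjoint B.mult_smult_left B.mult_smult_right)
  qed
  have compacts: "carrier (fibre_compacts complex_line_system p) = range (*)" for p :: 's
    by (simp add: compacts_complex)
  show ?thesis
    unfolding nica_covariant_rep_def compacts
    by (intro conjI ballI impI rep; (rule mult | rule disjoint); assumption)
qed

text \<open>The converse passage: evaluating at \<open>1 \<in> \<complex>\<close> and applying Nica covariance to the identity operators, whose
  images under \<open>\<iota>\<close> are again identities.\<close>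
lemma nica_covariant_rep_lineD:
  assumes S: "right_LCM_semigroup S" and \<rho>: "nica_covariant_rep S complex_line_system B \<rho>"
  shows "nica_isometric_rep S B (\<lambda>p. \<rho> p 1)"
    and "p \<in> carrier S \<Longrightarrow> \<rho> p c = c \<odot>\<^bsub>B\<^esub> \<rho> p 1"
proof -
  interpret S: right_LCM_semigroup S by fact
  have rep: "prod_system_rep S complex_line_system B \<rho>"
    using \<rho> by (simp add: nica_covariant_rep_def)
  note R = rep[unfolded prod_system_rep_def complex_line_system_simps standard_bimodule_complex_simps]
  have R_smult: "\<rho> p (c * \<xi>) = c \<odot>\<^bsub>B\<^esub> \<rho> p \<xi>" if "p \<in> carrier S" for p c \<xi>
    using R that by blast
  have R_mult: "\<rho> p \<xi> \<otimes>\<^bsub>B\<^esub> \<rho> q \<eta> = \<rho> (p \<otimes>\<^bsub>S\<^esub> q) (\<xi> * \<eta>)"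
    if "p \<in> carrier S" "q \<in> carrier S" for p q \<xi> \<eta>
    using R that by blast
  have R_adj: "adj B (\<rho> p \<xi>) \<otimes>\<^bsub>B\<^esub> \<rho> p \<eta> = \<rho> \<one>\<^bsub>S\<^esub> (cnj \<xi> * \<eta>)" if "p \<in> carrier S" for p \<xi> \<eta>
    using R that by blast
  have linear: "\<rho> p c = c \<odot>\<^bsub>B\<^esub> \<rho> p 1" if "p \<in> carrier S" for p c
    using R_smult[OF that, of c 1] by simp
  interpret isometric_rep S B "\<lambda>p. \<rho> p 1"
  proof (intro isometric_rep.intro S isometric_rep_axioms.intro)
    show "cstar_algebra B" using R by blast
    show "\<rho> p 1 \<in> carrier B" if "p \<in> carrier S" for p using R that by blast
    show "\<rho> p 1 \<otimes>\<^bsub>B\<^esub> \<rho> q 1 = \<rho> (p \<otimes>\<^bsub>S\<^esub> q) 1" if "p \<in> carrier S" "q \<in> carrier S" for p q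
      using R_mult[OF that, of 1 1] by simp
    show "adj B (\<rho> p 1) \<otimes>\<^bsub>B\<^esub> \<rho> p 1 = \<rho> \<one>\<^bsub>S\<^esub> 1" if "p \<in> carrier S" for p
      using R_adj[OF that, of 1 1] by simp
  qed
  have ext: "compact_ext complex_line_system B \<rho> p ((*) 1) = range_proj p" if "p \<in> carrier S" for p
    using compact_ext_line[of p \<rho> 1, OF that linear[OF that]] that by simp
  have carrier: "(*) 1 \<in> carrier (fibre_compacts complex_line_system p)" for p :: 's
    by (simp add: compacts_complex)
  note N = \<rho>[unfolded nica_covariant_rep_def, THEN conjunct2, rule_format, OF _ _ carrier carrier]
  have "nica_isometric_rep_axioms S B (\<lambda>p. \<rho> p 1)"
  proof (rule nica_isometric_rep_axioms.intro)
    show "range_proj p \<otimes>\<^bsub>B\<^esub> range_proj q = range_proj r"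
      if pqr: "p \<in> carrier S" "q \<in> carrier S" "r \<in> carrier S"
        "(p <#\<^bsub>S\<^esub> carrier S) \<inter> (q <#\<^bsub>S\<^esub> carrier S) = r <#\<^bsub>S\<^esub> carrier S" for p q r
      using N[THEN conjunct1, rule_format, OF pqr] compose_iota_line[OF pqr, of 1 1] pqr
      by (simp add: ext del: complex_line_system_simps)
    show "range_proj p \<otimes>\<^bsub>B\<^esub> range_proj q = \<zero>\<^bsub>B\<^esub>"
      if pq: "p \<in> carrier S" "q \<in> carrier S" "(p <#\<^bsub>S\<^esub> carrier S) \<inter> (q <#\<^bsub>S\<^esub> carrier S) = {}" for p q
      using N[THEN conjunct2, rule_format, OF pq] pq by (simp add: ext)
  qed
  then show "nica_isometric_rep S B (\<lambda>p. \<rho> p 1)"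
    by (intro nica_isometric_rep.intro isometric_rep_axioms)
  show "p \<in> carrier S \<Longrightarrow> \<rho> p c = c \<odot>\<^bsub>B\<^esub> \<rho> p 1" by (rule linear)
qed

section \<open>Comparison with the full semigroup C*-algebra\<close>

text \<open>The projections belonging to ideals are determined by the isometries: take \<open>X = S\<close> in
  \<open>v\<^sub>p e\<^sub>X v\<^sub>p\<^sup>* = e\<^sub>p\<^sub>X\<close>.\<close>
lemma semigroup_cstar_rep_ideal:
  assumes S: "right_LCM_semigroup S" and rep: "semigroup_cstar_rep S B v e" and p: "p \<in> carrier S"
  shows "e (p <#\<^bsub>S\<^esub> carrier S) = v p \<otimes>\<^bsub>B\<^esub> adj B (v p)"
proof -
  interpret S: right_LCM_semigroup S by fact
  note R = rep[unfolded semigroup_cstar_rep_def]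
  interpret B: unital_cstar_algebra B using R by blast
  have "v p \<in> carrier B" using R p by (auto simp: isometry_def)
  moreover have "v p \<otimes>\<^bsub>B\<^esub> e (carrier S) \<otimes>\<^bsub>B\<^esub> adj B (v p) = e (p <#\<^bsub>S\<^esub> carrier S)"
    using R p S.carrier_ideal by blast
  moreover have "e (carrier S) = \<one>\<^bsub>B\<^esub>" using R by blast
  ultimately show ?thesis by simp
qed

text \<open>Here \<open>v\<^sub>1\<close> is the unit, because an idempotent isometry is.\<close>
lemma semigroup_cstar_rep_nica_isometric:
  assumes S: "right_LCM_semigroup S" and rep: "semigroup_cstar_rep S B v e"
  shows "nica_isometric_rep S B v"
proof -
  interpret S: right_LCM_semigroup S by fact
  note R = rep[unfolded semigroup_cstar_rep_def isometry_def]
  interpret B: unital_cstar_algebra B using R by blast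
  have mem: "v p \<in> carrier B" if "p \<in> carrier S" for p using R that by blast
  have one: "v \<one>\<^bsub>S\<^esub> = \<one>\<^bsub>B\<^esub>"
  proof -
    let ?u = "v \<one>\<^bsub>S\<^esub>"
    have u: "?u \<in> carrier B" by (simp add: mem)
    have "?u \<otimes>\<^bsub>B\<^esub> ?u = ?u" using R by (metis S.one_closed S.r_one)
    moreover have "adj B ?u \<otimes>\<^bsub>B\<^esub> ?u = \<one>\<^bsub>B\<^esub>" using R by blast
    ultimately show ?thesis
      using u B.mult_assoc[of "adj B ?u" ?u ?u] by simp
  qed
  interpret isometric_rep S B v
    using R one by (intro isometric_rep.intro S B.cstar_algebra_axioms isometric_rep_axioms.intro) auto
  have e: "range_proj p = e (p <#\<^bsub>S\<^esub> carrier S)" if "p \<in> carrier S" for p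
    using semigroup_cstar_rep_ideal[OF S rep that] by (simp add: range_proj_def)
  show ?thesis
  proof (intro nica_isometric_rep.intro isometric_rep_axioms nica_isometric_rep_axioms.intro)
    show "range_proj p \<otimes>\<^bsub>B\<^esub> range_proj q = range_proj r"
      if "p \<in> carrier S" "q \<in> carrier S" "r \<in> carrier S"
        "(p <#\<^bsub>S\<^esub> carrier S) \<inter> (q <#\<^bsub>S\<^esub> carrier S) = r <#\<^bsub>S\<^esub> carrier S" for p q r
      using R that by (simp add: e)
    show "range_proj p \<otimes>\<^bsub>B\<^esub> range_proj q = \<zero>\<^bsub>B\<^esub>"
      if "p \<in> carrier S" "q \<in> carrier S" "(p <#\<^bsub>S\<^esub> carrier S) \<inter> (q <#\<^bsub>S\<^esub> carrier S) = {}" for p q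
      using R that by (simp add: e)
  qed
qed

context nica_isometric_rep
begin

text \<open>The corner \<open>uBu\<close> for \<open>u = v\<^sub>1\<close>, described as the set on which \<open>u\<close> acts as a unit.\<close>
definition corner :: "'b cstar" where
  "corner = B\<lparr>carrier := {x \<in> carrier B. v \<one> \<otimes>\<^bsub>B\<^esub> x = x \<and> x \<otimes>\<^bsub>B\<^esub> v \<one> = x}, one := v \<one>\<rparr>"

text \<open>The chosen generator does not matter, by \<open>range_proj_eq\<close> below.\<close>
definition ideal_proj :: "'s set \<Rightarrow> 'b" where
  "ideal_proj X = (if X = {} then \<zero>\<^bsub>B\<^esub> else range_proj (SOME p. p \<in> carrier S \<and> X = p <# carrier S))"

lemma corner_simps [simp]:
  "x \<in> carrier corner \<longleftrightarrow> x \<in> carrier B \<and> v \<one> \<otimes>\<^bsub>B\<^esub> x = x \<and> x \<otimes>\<^bsub>B\<^esub> v \<one> = x"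
  "\<one>\<^bsub>corner\<^esub> = v \<one>" "monoid.mult corner = monoid.mult B" "adj corner = adj B"
  "\<zero>\<^bsub>corner\<^esub> = \<zero>\<^bsub>B\<^esub>" "add corner = add B" "smult corner = smult B"
  by (simp_all add: corner_def)

text \<open>If \<open>pS = qS\<close> then \<open>pS \<inter> qS\<close> is both \<open>pS\<close> and \<open>qS\<close>, so the product of the two projections equals each of them.\<close>
lemma range_proj_eq:
  assumes "p \<in> carrier S" "q \<in> carrier S" "p <# carrier S = q <# carrier S"
  shows "range_proj p = range_proj q"
  using range_proj_mult[of p q p] range_proj_mult[of p q q] assms by simp

lemma ideal_proj_principal: "p \<in> carrier S \<Longrightarrow> ideal_proj (p <# carrier S) = range_proj p"
proof -
  assume p: "p \<in> carrier S"
  define q where "q = (SOME q. q \<in> carrier S \<and> p <# carrier S = q <# carrier S)"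
  have q: "q \<in> carrier S \<and> p <# carrier S = q <# carrier S"
    unfolding q_def by (rule someI_ex) (use p in blast)
  have "p <# carrier S \<noteq> {}" using mem_l_coset_self[OF p] by blast
  then have "ideal_proj (p <# carrier S) = range_proj q"
    unfolding ideal_proj_def q_def by simp
  then show ?thesis using q range_proj_eq[of p q] p by simp
qed

text \<open>The right LCM property ensures that two nonempty ideals meet in the empty set or in a principal ideal, so that the two
  covariance conditions cover every product \<open>e\<^sub>X e\<^sub>Y\<close>.\<close>
lemma semigroup_cstar_rep_corner: "semigroup_cstar_rep S corner v ideal_proj"
proof -
  have "cstar_algebra corner"
    unfolding corner_def
    by (intro cstar_algebra_restrict cstar_subalgebra_corner v_one_projection B.cstar_algebra_axioms)
  then have unital: "unital_cstar_algebra corner"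
    by (rule unital_cstar_algebraI) auto
  have empty [simp]: "ideal_proj {} = \<zero>\<^bsub>B\<^esub>" by (simp add: ideal_proj_def)
  have range: "projection corner (range_proj p)" if p: "p \<in> carrier S" for p
  proof -
    have "v \<one> \<otimes>\<^bsub>B\<^esub> range_proj p = range_proj p" "range_proj p \<otimes>\<^bsub>B\<^esub> v \<one> = range_proj p"
      using p B.mult_assoc[of "v \<one>" "v p" "adj B (v p)"] B.mult_assoc[of "v p" "adj B (v p)" "v \<one>"]
      by (simp_all add: range_proj_def)
    then show ?thesis
      using range_proj_projection[OF p] p by (simp add: projection_def)
  qed
  have proj: "projection corner (ideal_proj X)" if "X \<in> constructible_ideals S" for X
    using that by (cases rule: ideal_cases) (simp_all add: ideal_proj_principal range projection_def[of _ "\<zero>\<^bsub>B\<^esub>"])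
  have conj: "v p \<otimes>\<^bsub>B\<^esub> ideal_proj X \<otimes>\<^bsub>B\<^esub> adj B (v p) = ideal_proj (p <# X)"
    if p: "p \<in> carrier S" and X: "X \<in> constructible_ideals S" for p X
    using X
  proof (cases rule: ideal_cases)
    case 1
    then show ?thesis using p by (simp add: l_coset_def)
  next
    case (2 q)
    then show ?thesis
      using p by (simp add: ideal_proj_principal l_coset_l_coset range_proj_conj)
  qed
  have inter: "ideal_proj X \<otimes>\<^bsub>B\<^esub> ideal_proj Y = ideal_proj (X \<inter> Y)"
    if X: "X \<in> constructible_ideals S" and Y: "Y \<in> constructible_ideals S" for X Y
  proof -
    have mem: "ideal_proj X \<in> carrier B" "ideal_proj Y \<in> carrier B"
      using proj[OF X] proj[OF Y] by (simp_all add: projection_def)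
    show ?thesis
    proof (cases "X = {} \<or> Y = {}")
      case True
      then show ?thesis using mem by auto
    next
      case False
      then obtain p q where pq: "p \<in> carrier S" "q \<in> carrier S"
        and XY: "X = p <# carrier S" "Y = q <# carrier S"
        using X Y by (auto simp: constructible_ideals_def)
      consider "X \<inter> Y = {}" | r where "r \<in> carrier S" "X \<inter> Y = r <# carrier S"
        using right_LCM[OF pq] unfolding XY by blast
      then show ?thesis
      proof cases
        case 1
        then show ?thesis using pq range_proj_disjoint by (simp add: XY ideal_proj_principal)
      next
        case (2 r)
        then show ?thesis using pq range_proj_mult[of p q r] by (simp add: XY ideal_proj_principal)
      qed
    qed
  qed
  have one: "ideal_proj (carrier S) = v \<one>"
    using ideal_proj_principal[OF one_closed] by (simp add: range_proj_def)
  show ?thesis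
    unfolding semigroup_cstar_rep_def
    using unital proj conj inter one by (auto simp: isometry_def v_isometry v_mult)
qed

end

text \<open>A Nica covariant representation in \<open>B\<close> gives a representation of the relations of \<open>C\<^sup>*(S)\<close> in a corner of \<open>B\<close>.
  The corner is carried by a subset of \<open>B\<close>, hence by the same type, so universality applies to it.\<close>
theorem full_semigroup_cstar_nica_toeplitz:
  fixes A :: "'b cstar"
  assumes S: "right_LCM_semigroup S" and full: "full_semigroup_cstar S A v e"
  shows "nica_toeplitz S complex_line_system A (\<lambda>p c. c \<odot>\<^bsub>A\<^esub> v p)"
proof -
  interpret S: right_LCM_semigroup S by fact
  have rep: "semigroup_cstar_rep S A v e" 
    and gen: "cstar_generated_by A (v ` carrier S \<union> e ` constructible_ideals S)"
    and univ: "\<And>(B :: 'b cstar) w f. semigroup_cstar_rep S B w f \<Longrightarrow>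
        \<exists>\<phi> \<in> star_hom A B. (\<forall>p\<in>carrier S. \<phi> (v p) = w p) \<and>
           (\<forall>X\<in>constructible_ideals S. \<phi> (e X) = f X)"
    using full unfolding full_semigroup_cstar_def by blast+
  interpret nica_isometric_rep S A v
    by (rule semigroup_cstar_rep_nica_isometric[OF S rep])
  let ?X = "{c \<odot>\<^bsub>A\<^esub> v p | p c. p \<in> carrier S \<and> c \<in> carrier (fibre complex_line_system p)}"
  have gen': "cstar_generated_by A ?X"
    unfolding cstar_generated_by_def
  proof (intro conjI allI impI; (elim conjE)?)
    show "?X \<subseteq> carrier A" by auto
    fix D assume D: "cstar_subalgebra A D" "?X \<subseteq> D"
    note sub = D(1)[unfolded cstar_subalgebra_iff[OF B.cstar_algebra_axioms]]
    have v: "v p \<in> D" if p: "p \<in> carrier S" for p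
    proof -
      have "1 \<odot>\<^bsub>A\<^esub> v p \<in> ?X" using p by fastforce
      then show ?thesis using D(2) p by (auto simp: subset_iff)
    qed
    have "e X \<in> D" if X: "X \<in> constructible_ideals S" for X
      using X
    proof (cases rule: S.ideal_cases)
      case 1
      then show ?thesis using rep sub by (simp add: semigroup_cstar_rep_def)
    next
      case (2 p)
      then show ?thesis using semigroup_cstar_rep_ideal[OF S rep, of p] sub v by simp
    qed
    then show "D = carrier A"
      using gen D(1) v unfolding cstar_generated_by_def by blast
  qed
  have univ': "\<exists>\<phi>\<in>star_hom A B. \<forall>p\<in>carrier S. \<forall>\<xi>\<in>carrier (fibre complex_line_system p).
      \<phi> (\<xi> \<odot>\<^bsub>A\<^esub> v p) = \<rho> p \<xi>"
    if \<rho>: "nica_covariant_rep S complex_line_system B \<rho>" for B :: "'b cstar" and \<rho>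
  proof -
    interpret R: nica_isometric_rep S B "\<lambda>p. \<rho> p 1"
      by (rule nica_covariant_rep_lineD(1)[OF S \<rho>])
    obtain \<phi> where \<phi>: "\<phi> \<in> star_hom A R.corner" "\<And>p. p \<in> carrier S \<Longrightarrow> \<phi> (v p) = \<rho> p 1"
      using univ[OF R.semigroup_cstar_rep_corner] by blast
    have hom: "\<phi> \<in> star_hom A B"
      using \<phi>(1) by (auto simp: star_hom_def)
    have "\<phi> (\<xi> \<odot>\<^bsub>A\<^esub> v p) = \<rho> p \<xi>" if p: "p \<in> carrier S" for p \<xi>
      using star_hom_props(3)[OF hom, of "v p" \<xi>] \<phi>(2)[OF p] nica_covariant_rep_lineD(2)[OF S \<rho> p, of \<xi>] p
      by simp
    then show ?thesis using hom by blast
  qed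
  show ?thesis
    unfolding nica_toeplitz_def
    using nica_covariant_rep_line[OF nica_isometric_rep_axioms] gen' univ' by blast
qed

text \<open>Uniqueness of maps out of an algebra with given generators, in the form needed for composites of universal maps.\<close>
lemma star_hom_id_if_fixes_generators:
  assumes A: "cstar_algebra A" and gen: "cstar_generated_by A X" and \<phi>: "\<phi> \<in> star_hom A A"
    and fixed: "\<And>x. x \<in> X \<Longrightarrow> \<phi> x = x" and x: "x \<in> carrier A"
  shows "\<phi> x = x"
proof -
  have "(\<lambda>x. x) \<in> star_hom A A" by (simp add: star_hom_def)
  then have "cstar_subalgebra A {x \<in> carrier A. \<phi> x = x}"
    by (rule star_hom_equalizer[OF A A \<phi>])
  moreover have "X \<subseteq> {x \<in> carrier A. \<phi> x = x}"
    using gen fixed by (auto simp: cstar_generated_by_def)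
  ultimately have "{x \<in> carrier A. \<phi> x = x} = carrier A"
    using gen unfolding cstar_generated_by_def by blast
  then show ?thesis using x by blast
qed

lemma star_hom_compose: "\<lbrakk>\<phi> \<in> star_hom A B; \<theta> \<in> star_hom B C\<rbrakk> \<Longrightarrow> (\<lambda>x. \<theta> (\<phi> x)) \<in> star_hom A C"
  using star_hom_props[of \<phi> A B] star_hom_props[of \<theta> B C] by (simp add: star_hom_def[of A C])

theorem nica_toeplitz_unique:
  fixes A B :: "'b cstar"
  assumes A: "nica_toeplitz S M A \<psi>" and B: "nica_toeplitz S M B \<psi>'"
  shows "cstar_isomorphic A B"
proof -
  have cstar: "cstar_algebra A" "cstar_algebra B"
    using A B by (simp_all add: nica_toeplitz_def nica_covariant_rep_def prod_system_rep_def)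
  have gen: "cstar_generated_by A {\<psi> p \<xi> | p \<xi>. p \<in> carrier S \<and> \<xi> \<in> carrier (fibre M p)}"
    "cstar_generated_by B {\<psi>' p \<xi> | p \<xi>. p \<in> carrier S \<and> \<xi> \<in> carrier (fibre M p)}"
    using A B by (simp_all add: nica_toeplitz_def)
  obtain \<phi> where \<phi>: "\<phi> \<in> star_hom A B"
    "\<forall>p\<in>carrier S. \<forall>\<xi>\<in>carrier (fibre M p). \<phi> (\<psi> p \<xi>) = \<psi>' p \<xi>"
    using A B unfolding nica_toeplitz_def by blast
  obtain \<theta> where \<theta>: "\<theta> \<in> star_hom B A"
    "\<forall>p\<in>carrier S. \<forall>\<xi>\<in>carrier (fibre M p). \<theta> (\<psi>' p \<xi>) = \<psi> p \<xi>"
    using A B unfolding nica_toeplitz_def by blast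
  have "\<theta> (\<phi> x) = x" if "x \<in> carrier A" for x
    by (rule star_hom_id_if_fixes_generators[OF cstar(1) gen(1) star_hom_compose[OF \<phi>(1) \<theta>(1)] _ that])
      (use \<phi>(2) \<theta>(2) in auto)
  moreover have "\<phi> (\<theta> x) = x" if "x \<in> carrier B" for x
    by (rule star_hom_id_if_fixes_generators[OF cstar(2) gen(2) star_hom_compose[OF \<theta>(1) \<phi>(1)] _ that])
      (use \<phi>(2) \<theta>(2) in auto)
  ultimately have "bij_betw \<phi> (carrier A) (carrier B)"
    using star_hom_props(1)[OF \<phi>(1)] star_hom_props(1)[OF \<theta>(1)]
    by (intro bij_betw_byWitness[where f' = \<theta>]) auto
  then show ?thesis
    using \<phi>(1) by (auto simp: cstar_isomorphic_def)
qed

theorem corollary7p11: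
  fixes S :: "('s, 't) monoid_scheme"
  assumes "right_LCM_semigroup S"
    and "countable (carrier S)"
    and universe: "\<exists>f :: real \<Rightarrow> 'u. inj f"
  shows "(\<exists>(A :: 'u cstar) v e. full_semigroup_cstar S A v e) \<and>
         (\<exists>(N :: 'u cstar) \<psi>. nica_toeplitz S complex_line_system N \<psi>) \<and>
         (\<forall>(A :: 'u cstar) v e (N :: 'u cstar) \<psi>.
            full_semigroup_cstar S A v e \<and> nica_toeplitz S complex_line_system N \<psi> \<longrightarrow>
            cstar_isomorphic A N)"
proof (intro conjI allI impI)
  show full: "\<exists>(A :: 'u cstar) v e. full_semigroup_cstar S A v e"
    using full_semigroup_cstar_exists assms .
  then show "\<exists>(N :: 'u cstar) \<psi>. nica_toeplitz S complex_line_system N \<psi>"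
    using full_semigroup_cstar_nica_toeplitz[OF assms(1)] by blast
next
  fix A N :: "'u cstar" and v e \<psi>
  assume "full_semigroup_cstar S A v e \<and> nica_toeplitz S complex_line_system N \<psi>"
  then show "cstar_isomorphic A N"
    using full_semigroup_cstar_nica_toeplitz[OF assms(1)] nica_toeplitz_unique by blast
qed

end
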